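(* Let $\varepsilon>0$ and $r\ge1$. Let $A$ be the adjacency matrix drawn from the stochastic block model $G(n,\frac an,\frac bn)$. Assume that $$(a-b)^2>C_\varepsilon(a+b),$$ where $C_\varepsilon=Cr^4\varepsilon^{-2}$ and $C$ is an appropriately large absolute constant. Choose $\tau$ to be the average degree of the graph, i.e. $\tau=(d_1+\cdots+d_n)/n$, where $d_i=\sum_j A_{ij}$ are the vertex degrees. Then with probability at least $1-e^{-r}$ we have $$\min_{\beta=\pm1}\|v_2(\mathcal{L}(A_\tau))+\beta\, v_2(\mathcal{L}(\mathbb{E}A_\tau))\|\le\varepsilon.$$ In particular, the signs of the entries of $v_2(\mathcal{L}(A_\tau))$ correctly estimate the partition into the two communities, up to at most $\varepsilon n$ misclassified vertices.
   Context: Stochastic block model $G(n,\frac an,\frac bn)$ (balanced planted partition model): the set of $n$ vertices is divided into two subsets (communities) of size $n/2$ each, and edges between vertices are drawn independently, with probability $a/n$ if the vertices are in the same community and with probability $b/n$ otherwise. $A$ is the symmetric $0/1$ adjacency matrix of the resulting graph. For a symmetric matrix $B$ with nonnegative entries and positive row sums, the (symmetric, normalized) Laplacian is $\mathcal{L}(B)=I-D^{-1/2}BD^{-1/2}$, where $I$ is the identity matrix and $D$ is the diagonal matrix of the row sums of $B$. For $\tau>0$, $A_\tau:=A+(\tau/n)\mathbf{1}\mathbf{1}^{\mathsf T}$, where $\mathbf{1}$ is the all-ones vector, and $\mathbb{E}A_\tau$ stands for $\mathbb{E}A+(\tau/n)\mathbf{1}\mathbf{1}^{\mathsf T}$ with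 the same value of $\tau$. For a symmetric matrix $X$, $v_2(X)$ denotes a unit-norm eigenvector corresponding to the second smallest eigenvalue of $X$, and $\|\cdot\|$ applied to vectors is the Euclidean norm. Estimating the partition by signs means assigning vertices to the two communities according to the sign (positive or negative) of the corresponding entries of the eigenvector.
   Formalization: The formal theorem assumes a > b; for a < b the second eigenvector of the expected Laplacian is not determined (eigenvalue of multiplicity at least n-2, orthogonal to the community vector) and the claim fails, e.g. for a = 0, b = n. *)

theory Defs
  imports "HOL-Probability.Product_PMF" "Jordan_Normal_Form.Char_Poly"
begin

text \<open>
  Matrices and vectors are those of Jordan_Normal_Form, so that the number of vertices is an
  ordinary natural number and can be quantified after the absolute constant.
  The vertices are \<open>0, \<dots>, n - 1\<close>; a partition into two communities is given by one of
  them, \<open>S\<close>, the other one being \<open>{..<n} - S\<close>.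
\<close>

definition sbm_edge_prob :: "nat \<Rightarrow> nat set \<Rightarrow> real \<Rightarrow> real \<Rightarrow> nat \<Rightarrow> nat \<Rightarrow> real" where
  "sbm_edge_prob n S a b i j =
     (if i \<in> S \<longleftrightarrow> j \<in> S then a / real n else b / real n)"

definition adjacency_mat :: "nat \<Rightarrow> (nat \<times> nat \<Rightarrow> bool) \<Rightarrow> real mat" where
  "adjacency_mat n e =
     Matrix.mat n n (\<lambda>(i, j). if i \<noteq> j \<and> e (min i j, max i j) then 1 else 0)"

text \<open>
  The graph is simple: there is one independent Bernoulli variable for each pair \<open>i < j\<close> of
  distinct vertices, and no loops. The law is that of the adjacency matrix. Since
  \<^const>\<open>bernoulli_pmf\<close> truncates its parameter to the unit interval, the definition is
  meaningful only for \<open>0 \<le> a \<le> n\<close> and \<open>0 \<le> b \<le> n\<close>.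
\<close>

definition sbm :: "nat \<Rightarrow> nat set \<Rightarrow> real \<Rightarrow> real \<Rightarrow> real mat pmf" where
  "sbm n S a b =
     map_pmf (adjacency_mat n)
       (Pi_pmf {(i, j). i < j \<and> j < n} False
          (\<lambda>(i, j). bernoulli_pmf (sbm_edge_prob n S a b i j)))"

definition expected_mat :: "nat \<Rightarrow> real mat pmf \<Rightarrow> real mat" where
  "expected_mat n M =
     Matrix.mat n n (\<lambda>(i, j). measure_pmf.expectation M (\<lambda>A. A $$ (i, j)))"

definition row_sum :: "real mat \<Rightarrow> nat \<Rightarrow> real" where
  "row_sum B i = (\<Sum>j<dim_col B. B $$ (i, j))"

definition average_degree :: "real mat \<Rightarrow> real" where
  "average_degree A = (\<Sum>i<dim_row A. row_sum A i) / real (dim_row A)"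

definition regularize :: "real \<Rightarrow> real mat \<Rightarrow> real mat" where
  "regularize \<tau> A = A + Matrix.mat (dim_row A) (dim_col A) (\<lambda>_. \<tau> / real (dim_row A))"

text \<open>
  The Laplacian is intended for matrices with positive row sums. Since \<open>1 / sqrt 0 = 0\<close>, the
  Laplacian of the zero matrix is the identity; this case arises when the random graph has no edges,
  so that its average degree is \<open>0\<close>.
\<close>

definition laplacian :: "real mat \<Rightarrow> real mat" where
  "laplacian B =
     (let n = dim_row B; D = mat_diag n (\<lambda>i. 1 / sqrt (row_sum B i)) in 1\<^sub>m n - D * B * D)"

definition euclidean_norm :: "real Matrix.vec \<Rightarrow> real" where
  "euclidean_norm v = sqrt (scalar_prod v v)"

text \<open>
  Eigenvalues are counted with multiplicity, as roots of the characteristic polynomial; for a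
  symmetric real matrix of size \<open>n\<close> there are exactly \<open>n\<close> of them. List indices start at
  \<open>0\<close>.
\<close>

definition second_smallest_eigenvalue :: "real mat \<Rightarrow> real" where
  "second_smallest_eigenvalue X = sorted_list_of_multiset (proots (char_poly X)) ! 1"

text \<open>
  Such a vector is never unique (its negative is another one), so \<open>v\<^sub>2\<close> is a predicate
  rather than a function.
\<close>

definition is_v2 :: "real mat \<Rightarrow> real Matrix.vec \<Rightarrow> bool" where
  "is_v2 X v \<longleftrightarrow> eigenvector X v (second_smallest_eigenvalue X) \<and> euclidean_norm v = 1"

text \<open>
  Vertices misclassified when the positive entries of \<open>v\<close> are assigned to the community
  \<open>P\<close> and the negative ones to its complement. A vertex with entry \<open>0\<close> is assigned to
  neither community, so it counts as misclassified.
\<close>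

definition misclassified :: "nat \<Rightarrow> nat set \<Rightarrow> real Matrix.vec \<Rightarrow> nat set" where
  "misclassified n P v =
     {i. i < n \<and> \<not> (if i \<in> P then vec_index v i > 0 else vec_index v i < 0)}"

end

theory Submission
  imports Defs "Jordan_Normal_Form.Schur_Decomposition"
    "HOL-Computational_Algebra.Fundamental_Theorem_Algebra"
begin

unbundle no vec_syntax

text \<open>
  Put \<open>d = (a + b) / 2\<close>, \<open>\<delta> = (a - b) / 2\<close> and let \<open>W\<close> be the adjacency matrix minus its
  expectation. Everything rests on one inequality, valid with probability at least \<open>1 - exp (- r)\<close>
  simultaneously for all vectors \<open>x\<close> and \<open>y\<close>: \<open>\<bar>x\<^sup>T W y\<bar>\<close> is at most
  \<open>C r / sqrt d\<close> times \<open>\<parallel>x\<parallel>\<parallel>y\<parallel>\<close>, where \<open>\<parallel>x\<parallel>\<^sup>2\<close> is the sum of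
  \<open>(d\<^sub>i + d) x\<^sub>i\<^sup>2\<close>. Weighting by the degrees is exactly what the regularised Laplacian does, and it makes the
  inequality true for sparse graphs without removing vertices of high degree.

  A quadratic form without diagonal is affine in each coordinate, so it suffices to treat vectors whose entries are
  \<open>0\<close> or \<open>\<plusminus> 2^k\<close> times \<open>1 / sqrt n\<close>. Pairs with a small product of entries are handled
  by Bernstein's inequality and a union bound (following Feige and Ofek). For the other pairs the edges between two
  dyadic level sets are counted with a uniform large deviation bound; very unbalanced pairs are absorbed by the
  degree weights.

  In the coordinates \<open>v = D^(1/2) f\<close> the vector \<open>v\<^sub>2\<close> solves \<open>B f = \<lambda> D f\<close> and
  maximises the Rayleigh quotient on the complement of the constants. Testing with the signs of the communities gives
  \<open>\<lambda> \<ge> \<delta> / (8 d)\<close>, and pairing the equation with the component of \<open>f\<close> orthogonal to the signs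
  bounds that component by a multiple of \<open>r sqrt d / \<delta>\<close>, which is small by assumption.
\<close>

section \<open>Real symmetric matrices and the second eigenvector of a Laplacian\<close>

text \<open>The factor \<open>r\<close> in the inequality stems from the edge counts: the union
  bound over pairs of vertex sets is run with exponent \<open>4 * r\<close> times their entropy, so
  that it fails with probability below \<open>exp (- r)\<close> whatever the sizes. The pairs with
  small products fail with probability exponentially small in \<open>n\<close>, hence the need for
  \<open>r \<le> n\<close>. Both \<open>r \<le> d\<close> and \<open>r \<le> n\<close> follow from
  the assumption on \<open>a - b\<close> once \<epsilon> < 2; for larger \<epsilon> the claim is
  trivial for unit vectors. After that the argument is deterministic. The random \<tau> needs no
  event of its own: the inequality tested on constant vectors places it near the expected degree,
  and with one constant argument it controls the fluctuation of the degrees. No general eigenvector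
  perturbation theorem is invoked. Weighted orthogonality to the constants and to the signs makes
  the corresponding plain sums small, so both rank-one parts of the expectation contribute no more
  than the noise when the eigenvalue equation is paired with the error; a lower bound for \<lambda>
  is then enough.\<close>

lemma real_symmetric_eigenvector:
  fixes A :: "real mat"
  assumes A: "A \<in> carrier_mat n n" and sym: "A\<^sup>T = A" and n: "n > 0"
  obtains e v where "eigenvector A v e"
proof -
  let ?C = "map_mat complex_of_real A"
  have C: "?C \<in> carrier_mat n n" using A by auto
  have cp: "char_poly ?C = map_poly of_real (char_poly A)"
    using of_real_hom.char_poly_hom[OF A] by simp
  have "degree (char_poly ?C) = n" using degree_monic_char_poly[OF C] by auto
  then have "\<not> constant (poly (char_poly ?C))" using n by (simp add: constant_degree)
  then obtain z where z: "poly (char_poly ?C) z = 0"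
    using fundamental_theorem_of_algebra by blast
  then have "eigenvalue ?C z" using eigenvalue_root_char_poly[OF C] by simp
  then obtain w where "eigenvector ?C w z" unfolding eigenvalue_def by blast
  then have w: "w \<in> carrier_vec n" "w \<noteq> 0\<^sub>v n" "?C *\<^sub>v w = z \<cdot>\<^sub>v w"
    unfolding eigenvector_def using C by auto
  have row: "(\<Sum>j<n. of_real (A $$ (i,j)) * w $ j) = z * w $ i" if "i < n" for i
  proof -
    have "(?C *\<^sub>v w) $ i = z * w $ i" using w that by simp
    moreover have "(?C *\<^sub>v w) $ i = (\<Sum>j<n. of_real (A $$ (i,j)) * w $ j)"
      using that A w(1) by (auto simp: scalar_prod_def lessThan_atLeast0 intro!: sum.cong)
    ultimately show ?thesis by simp
  qed
  have symm: "A $$ (i,j) = A $$ (j,i)" if "i < n" "j < n" for i j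
    using sym A that by (metis carrier_matD index_transpose_mat(1))
  define q where "q = (\<Sum>i<n. w $ i * cnj (w $ i))"
  \<comment> \<open>The Hermitian form of \<open>w\<close> is evaluated from both sides; symmetry of
    \<open>A\<close> turns \<open>z\<close> into its conjugate.\<close>
  have "z * q = (\<Sum>i<n. (\<Sum>j<n. of_real (A $$ (i,j)) * w $ j) * cnj (w $ i))"
    unfolding q_def sum_distrib_left by (intro sum.cong) (auto simp: row)
  also have "\<dots> = (\<Sum>i<n. \<Sum>j<n. of_real (A $$ (i,j)) * w $ j * cnj (w $ i))"
    by (simp add: sum_distrib_right)
  also have "\<dots> = (\<Sum>j<n. \<Sum>i<n. of_real (A $$ (i,j)) * w $ j * cnj (w $ i))"
    by (rule sum.swap)
  also have "\<dots> = (\<Sum>j<n. w $ j * cnj (\<Sum>i<n. of_real (A $$ (j,i)) * w $ i))"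
    unfolding sum_distrib_left cnj_sum by (intro sum.cong) (auto simp: symm mult_ac)
  also have "\<dots> = (\<Sum>j<n. w $ j * cnj (z * w $ j))"
    by (intro sum.cong) (auto simp: row)
  also have "\<dots> = cnj z * q" unfolding q_def sum_distrib_left by (simp add: mult_ac)
  finally have zq: "z * q = cnj z * q" .
  have "q \<noteq> 0"
  proof
    assume "q = 0"
    moreover have "q = of_real (\<Sum>i<n. (cmod (w $ i))\<^sup>2)"
      unfolding q_def by (simp flip: complex_norm_square)
    ultimately have "(\<Sum>i<n. (cmod (w $ i))\<^sup>2) = 0" by (metis of_real_eq_0_iff)
    then have "\<forall>i<n. w $ i = 0" by (subst (asm) sum_nonneg_eq_0_iff) auto
    then have "w = 0\<^sub>v n" using w(1) by (intro eq_vecI) auto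
    then show False using w by simp
  qed
  then have "z = cnj z" using zq by simp
  then have "z = of_real (Re z)" by (simp add: complex_eq_iff)
  \<comment> \<open>The vector \<open>w\<close> may be complex, so reality passes through the
    characteristic polynomial: \<open>Re z\<close> is a root of the real one and therefore has a
    real eigenvector.\<close>
  then have "of_real (poly (char_poly A) (Re z)) = (0::complex)"
    using z unfolding cp by (metis of_real_hom.poly_map_poly)
  then have "poly (char_poly A) (Re z) = 0" by simp
  then have "eigenvalue A (Re z)" using eigenvalue_root_char_poly[OF A] by simp
  then show ?thesis using that unfolding eigenvalue_def by blast
qed

text \<open>Gram-Schmidt keeps the first vector of its input, so a basis beginning with
  \<open>v\<close> yields an orthogonal basis beginning with \<open>v\<close>. Since
  \<open>corthogonal\<close> does not normalise, the columns are scaled by \<open>g\<close>.\<close>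

lemma orthonormal_completion:
  fixes v :: "real vec"
  assumes v: "v \<in> carrier_vec n" "v \<noteq> 0\<^sub>v n" and n: "n > 0"
  obtains W c where "W \<in> carrier_mat n n" "W\<^sup>T * W = 1\<^sub>m n" "col W 0 = c \<cdot>\<^sub>v v"
proof -
  interpret cof_vec_space n "TYPE(real)" .
  define b where "b = basis_completion v"
  define ws where "ws = gram_schmidt n b"
  from basis_completion[OF v, folded b_def]
  have span_b: "span (set b) = carrier_vec n" and dist_b: "distinct b" 
    and indep: "\<not> lin_dep (set b)" and b: "set b \<subseteq> carrier_vec n" and hdb: "hd b = v" 
    and len_b: "length b = n" by auto
  from hdb len_b n obtain vs where bv: "b = v # vs" by (cases b, auto)
  from gram_schmidt_result[OF b dist_b indep refl, folded ws_def]
  have ws: "set ws \<subseteq> carrier_vec n" "corthogonal ws" "length ws = n" 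
    by (auto simp: len_b)
  from gram_schmidt_hd[OF v(1), of vs, folded bv] have hdws: "hd ws = v" unfolding ws_def .
  define g where "g = (\<lambda>w::real vec. (1 / sqrt (w \<bullet> w)) \<cdot>\<^sub>v w)"
  define W where "W = mat_of_cols n (map g ws)"
  have W: "W \<in> carrier_mat n n" unfolding W_def using ws by auto
  have wsi: "ws ! i \<in> carrier_vec n" if "i < n" for i using ws that by auto
  have colW: "col W i = g (ws ! i)" if "i < n" for i
    unfolding W_def using that ws wsi by (subst col_mat_of_cols) (auto simp: g_def)
  have orth: "ws ! i \<bullet> ws ! j = 0 \<longleftrightarrow> i \<noteq> j" if "i < n" "j < n" for i j
    using corthogonalD[OF ws(2), of i j] that ws(3) by simp
  have pos: "ws ! i \<bullet> ws ! i > 0" if "i < n" for i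
  proof -
    have "ws ! i \<bullet> ws ! i \<ge> 0" unfolding scalar_prod_def by (intro sum_nonneg) auto
    moreover have "ws ! i \<bullet> ws ! i \<noteq> 0" using orth[OF that that] by auto
    ultimately show ?thesis by simp
  qed
  have "W\<^sup>T * W = 1\<^sub>m n"
  proof (rule eq_matI)
    fix i j assume "i < dim_row (1\<^sub>m n :: real mat)" "j < dim_col (1\<^sub>m n :: real mat)"
    then have ij: "i < n" "j < n" by auto
    have "(W\<^sup>T * W) $$ (i,j) = g (ws ! i) \<bullet> g (ws ! j)"
      using ij W by (simp add: colW)
    also have "\<dots> = 1 / sqrt (ws!i \<bullet> ws!i) * (1 / sqrt (ws!j \<bullet> ws!j)) * (ws ! i \<bullet> ws ! j)"
      unfolding g_def using wsi[OF ij(1)] wsi[OF ij(2)]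
      by (simp add: smult_scalar_prod_distrib[of _ n] scalar_prod_smult_distrib[of _ n])
    also have "\<dots> = 1\<^sub>m n $$ (i,j)"
      using orth[OF ij] pos[of i] ij by (cases "i = j") auto
    finally show "(W\<^sup>T * W) $$ (i,j) = 1\<^sub>m n $$ (i,j)" .
  qed (use W in auto)
  moreover have "col W 0 = (1 / sqrt (v \<bullet> v)) \<cdot>\<^sub>v v"
    using colW[OF n] hdws ws(3) n unfolding g_def by (metis hd_conv_nth length_greater_0_conv)
  ultimately show ?thesis using that W by blast
qed

text \<open>Deflation: conjugation by an orthogonal \<open>W\<close> whose first column is an
  eigenvector clears the rest of the first column, symmetry clears the first row as well, and the
  remaining block is again symmetric.\<close>

theorem real_symmetric_spectral:
  fixes A :: "real mat"
  assumes "A \<in> carrier_mat n n" and "A\<^sup>T = A"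
  shows "\<exists>U e. U \<in> carrier_mat n n \<and> U\<^sup>T * U = 1\<^sub>m n \<and> A * U = U * mat_diag n e"
  using assms
proof (induction n arbitrary: A)
  case 0
  then show ?case by (intro exI[of _ "1\<^sub>m 0"] exI[of _ "\<lambda>_. 0"]) (auto intro!: eq_matI simp: mat_diag_def)
next
  case (Suc n A)
  let ?n = "Suc n"
  note A = Suc.prems(1) and sym = Suc.prems(2)
  obtain e v where ev: "eigenvector A v e"
    using real_symmetric_eigenvector[OF A sym] by blast
  then have v: "v \<in> carrier_vec ?n" "v \<noteq> 0\<^sub>v ?n" "A *\<^sub>v v = e \<cdot>\<^sub>v v"
    unfolding eigenvector_def using A by auto
  obtain W c where W: "W \<in> carrier_mat ?n ?n" "W\<^sup>T * W = 1\<^sub>m ?n" "col W 0 = c \<cdot>\<^sub>v v"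
    using orthonormal_completion[OF v(1,2)] by blast
  have WW: "W * W\<^sup>T = 1\<^sub>m ?n" using mat_mult_left_right_inverse[of "W\<^sup>T" ?n W] W by auto
  define A' where "A' = W\<^sup>T * A * W"
  have A': "A' \<in> carrier_mat ?n ?n" unfolding A'_def using A W by auto
  have symA': "A'\<^sup>T = A'"
    unfolding A'_def using A W sym by (simp add: transpose_mult[of _ ?n ?n _ ?n] assoc_mult_mat[of _ ?n ?n _ ?n _ ?n])
  have AW0: "A *\<^sub>v col W 0 = e \<cdot>\<^sub>v col W 0"
    unfolding W(3) using A v by (simp add: mult_mat_vec smult_smult_assoc mult.commute)
  have col0: "A' $$ (i, 0) = (if i = 0 then e else 0)" if "i < ?n" for i
  proof -
    have "A' $$ (i,0) = (W\<^sup>T * (A * W)) $$ (i,0)"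
      unfolding A'_def using A W by (simp add: assoc_mult_mat[of _ ?n ?n _ ?n _ ?n])
    also have "\<dots> = col W i \<bullet> col (A * W) 0" using that A W by simp
    also have "col (A * W) 0 = A *\<^sub>v col W 0" using A W by (intro eq_vecI) auto
    also have "\<dots> = e \<cdot>\<^sub>v col W 0" by (rule AW0)
    also have "col W i \<bullet> (e \<cdot>\<^sub>v col W 0) = e * (W\<^sup>T * W) $$ (i,0)"
      using that W(1) by (simp add: scalar_prod_smult_distrib[of _ ?n])
    also have "\<dots> = (if i = 0 then e else 0)" unfolding W(2) using that by simp
    finally show ?thesis .
  qed
  have row0: "A' $$ (0, i) = (if i = 0 then e else 0)" if "i < ?n" for i
    using col0[OF that] symA' A' that by (metis carrier_matD index_transpose_mat(1) zero_less_Suc)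
  define A3 where "A3 = mat n n (\<lambda>(i,j). A' $$ (Suc i, Suc j))"
  have A3: "A3 \<in> carrier_mat n n" unfolding A3_def by auto
  have A'symij: "A' $$ (i,j) = A' $$ (j,i)" if "i < ?n" "j < ?n" for i j
    using symA' A' that by (metis carrier_matD index_transpose_mat(1))
  have "A3\<^sup>T = A3" unfolding A3_def by (rule eq_matI) (auto intro: A'symij)
  from Suc.IH[OF A3 this] obtain U3 f where U3: "U3 \<in> carrier_mat n n" "U3\<^sup>T * U3 = 1\<^sub>m n"
    "A3 * U3 = U3 * mat_diag n f" by blast
  have block: "A' = four_block_mat (mat_diag 1 (\<lambda>_. e)) (0\<^sub>m 1 n) (0\<^sub>m n 1) A3"
    unfolding A3_def using A' col0 row0
    by (intro eq_matI) (auto simp: mat_diag_def)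
  define V where "V = four_block_mat (1\<^sub>m 1) (0\<^sub>m 1 n) (0\<^sub>m n 1) U3"
  have V: "V \<in> carrier_mat ?n ?n" unfolding V_def using U3 by auto
  define h where "h = case_nat e f"
  have diag: "mat_diag ?n h = four_block_mat (mat_diag 1 (\<lambda>_. e)) (0\<^sub>m 1 n) (0\<^sub>m n 1) (mat_diag n f)"
    unfolding h_def by (intro eq_matI) (auto simp: mat_diag_def split: nat.splits)
  have VT: "V\<^sup>T = four_block_mat (1\<^sub>m 1) (0\<^sub>m 1 n) (0\<^sub>m n 1) (U3\<^sup>T)"
    unfolding V_def using U3 by (subst transpose_four_block_mat[of _ 1 1 _ n _ n]) auto
  have VV: "V\<^sup>T * V = 1\<^sub>m ?n"
    apply (subst VT)
    unfolding V_def using U3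
    by (subst mult_four_block_mat[of _ 1 1 _ n _ n _ _ 1 _ n]) (auto simp: four_block_one_mat)
  have AV: "A' * V = V * mat_diag ?n h"
    unfolding V_def block diag using U3 A3
    apply (subst mult_four_block_mat[of _ 1 1 _ n _ n _ _ 1 _ n]; (simp add: mat_diag_def)?)
    apply (subst mult_four_block_mat[of _ 1 1 _ n _ n _ _ 1 _ n]; (simp add: mat_diag_def)?)
    done
  define U where "U = W * V"
  have U: "U \<in> carrier_mat ?n ?n" unfolding U_def using W V by auto
  have "U\<^sup>T * U = V\<^sup>T * (W\<^sup>T * W) * V"
    unfolding U_def using W(1) V by (simp add: transpose_mult[of _ ?n ?n _ ?n] assoc_mult_mat[of _ ?n ?n _ ?n _ ?n])
  then have UU: "U\<^sup>T * U = 1\<^sub>m ?n" using W V VV by simp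
  have "A * U = (W * W\<^sup>T) * A * (W * V)" unfolding U_def WW using A W V by simp
  also have "\<dots> = W * (A' * V)" unfolding A'_def using A W(1) V by (simp add: assoc_mult_mat[of _ ?n ?n _ ?n _ ?n])
  also have "\<dots> = U * mat_diag ?n h" unfolding AV U_def using W(1) V
    by (simp add: assoc_mult_mat[of _ ?n ?n _ ?n _ ?n] mat_diag_def)
  finally show ?case using U UU by blast
qed


text \<open>The diagonalisation in entries, \<open>u k\<close> being the \<open>k\<close>-th column.
  The clause on \<open>proots\<close>, a consequence of similarity, ties the sorted list in
  \<open>second_smallest_eigenvalue\<close> to the family \<open>e\<close>, multiplicities
  included.\<close>

lemma real_symmetric_eigenbasis:
  fixes A :: "real mat"
  assumes A: "A \<in> carrier_mat n n" and sym: "\<And>i j. i < n \<Longrightarrow> j < n \<Longrightarrow> A $$ (i,j) = A $$ (j,i)"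
  obtains u :: "nat \<Rightarrow> nat \<Rightarrow> real" and e :: "nat \<Rightarrow> real" where
    "\<And>k l. k < n \<Longrightarrow> l < n \<Longrightarrow> (\<Sum>i<n. u k i * u l i) = (if k = l then 1 else 0)"
    "\<And>i j. i < n \<Longrightarrow> j < n \<Longrightarrow> (\<Sum>k<n. u k i * u k j) = (if i = j then 1 else 0)"
    "\<And>i j. i < n \<Longrightarrow> j < n \<Longrightarrow> A $$ (i,j) = (\<Sum>k<n. e k * u k i * u k j)"
    "proots (char_poly A) = mset (map e [0..<n])"
proof -
  have "A\<^sup>T = A" using A sym by (intro eq_matI) auto
  then obtain U e where U: "U \<in> carrier_mat n n" "U\<^sup>T * U = 1\<^sub>m n" "A * U = U * mat_diag n e"
    using real_symmetric_spectral[OF A] by blast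
  have UUT: "U * U\<^sup>T = 1\<^sub>m n" using mat_mult_left_right_inverse[of "U\<^sup>T" n U] U by auto
  have dc: "mat_diag n e \<in> carrier_mat n n" by (simp add: mat_diag_def)
  have "A = A * (U * U\<^sup>T)" unfolding UUT using A by simp
  also have "\<dots> = (A * U) * U\<^sup>T" using A U(1) by (simp add: assoc_mult_mat[of _ n n _ n _ n])
  also have "\<dots> = U * mat_diag n e * U\<^sup>T" unfolding U(3) ..
  finally have Aeq: "A = U * mat_diag n e * U\<^sup>T" .
  have 1: "(\<Sum>i<n. U $$ (i,k) * U $$ (i,l)) = (if k = l then 1 else 0)" if "k < n" "l < n" for k l
  proof -
    have "(U\<^sup>T * U) $$ (k,l) = (\<Sum>i<n. U $$ (i,k) * U $$ (i,l))"
      using that U(1) by (auto simp: scalar_prod_def lessThan_atLeast0 intro!: sum.cong)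
    then show ?thesis unfolding U(2) using that by simp
  qed
  have 2: "(\<Sum>k<n. U $$ (i,k) * U $$ (j,k)) = (if i = j then 1 else 0)" if "i < n" "j < n" for i j
  proof -
    have "(U * U\<^sup>T) $$ (i,j) = (\<Sum>k<n. U $$ (i,k) * U $$ (j,k))"
      using that U(1) by (auto simp: scalar_prod_def lessThan_atLeast0 intro!: sum.cong)
    then show ?thesis unfolding UUT using that by simp
  qed
  have 3: "A $$ (i,j) = (\<Sum>k<n. e k * U $$ (i,k) * U $$ (j,k))" if "i < n" "j < n" for i j
  proof -
    have "A $$ (i,j) = (U * mat_diag n e * U\<^sup>T) $$ (i,j)" using Aeq by simp
    also have "U * mat_diag n e = mat n n (\<lambda>(i,k). U $$ (i,k) * e k)"
      using U(1) by (simp add: mat_diag_mult_right)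
    also have "(mat n n (\<lambda>(i,k). U $$ (i,k) * e k) * U\<^sup>T) $$ (i,j) = (\<Sum>k<n. e k * U $$ (i,k) * U $$ (j,k))"
      using that U(1) by (auto simp: scalar_prod_def lessThan_atLeast0 mult_ac intro!: sum.cong)
    finally show ?thesis .
  qed
  have "similar_mat_wit A (mat_diag n e) U (U\<^sup>T)"
    using A U(1) dc by (intro similar_mat_witI[OF UUT U(2) Aeq]) auto
  then have "char_poly A = char_poly (mat_diag n e)"
    by (intro char_poly_similar) (auto simp: similar_mat_def)
  also have "\<dots> = (\<Prod>a\<leftarrow>diag_mat (mat_diag n e). [:- a, 1:])"
    by (rule char_poly_upper_triangular[OF dc]) (auto simp: mat_diag_def)
  also have "diag_mat (mat_diag n e) = map e [0..<n]"
    by (auto simp: diag_mat_def mat_diag_def)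
  finally have cp: "char_poly A = (\<Prod>a\<leftarrow>map e [0..<n]. [:- a, 1:])" .
  have "proots (\<Prod>a\<leftarrow>xs. [:- a, 1:]) = mset xs" for xs :: "real list"
  proof (induction xs)
    case (Cons a xs)
    have "(\<Prod>a\<leftarrow>xs. [:- a, 1:]) \<noteq> 0" by (auto simp: prod_list_zero_iff)
    then have "proots ([:- a, 1:] * (\<Prod>a\<leftarrow>xs. [:- a, 1:])) = proots [:- a, 1:] + mset xs"
      by (subst proots_mult) (auto simp: Cons)
    also have "proots [:- a, 1:] = {#a#}" using proots_linear_factor[of a] by simp
    finally show ?case by simp
  qed simp
  then have 4: "proots (char_poly A) = mset (map e [0..<n])" unfolding cp .
  show ?thesis using that[of "\<lambda>k i. U $$ (i,k)" e] 1 2 3 4 by blast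
qed

lemma quadratic_form_eigenbasis:
  fixes u :: "nat \<Rightarrow> nat \<Rightarrow> real"
  assumes "\<And>i j. i < n \<Longrightarrow> j < n \<Longrightarrow> a i j = (\<Sum>k<n. e k * u k i * u k j)"
  shows "(\<Sum>i<n. \<Sum>j<n. a i j * y i * y j) = (\<Sum>k<n. e k * (\<Sum>i<n. u k i * y i)\<^sup>2)"
proof -
  have "(\<Sum>i<n. \<Sum>j<n. a i j * y i * y j)
      = (\<Sum>i<n. \<Sum>j<n. \<Sum>k<n. e k * ((u k i * y i) * (u k j * y j)))"
    by (intro sum.cong) (auto simp: assms sum_distrib_left sum_distrib_right mult_ac)
  also have "\<dots> = (\<Sum>i<n. \<Sum>k<n. \<Sum>j<n. e k * ((u k i * y i) * (u k j * y j)))"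
    by (intro sum.cong refl sum.swap)
  also have "\<dots> = (\<Sum>k<n. \<Sum>i<n. \<Sum>j<n. e k * ((u k i * y i) * (u k j * y j)))"
    by (rule sum.swap)
  also have "\<dots> = (\<Sum>k<n. e k * (\<Sum>i<n. u k i * y i)\<^sup>2)"
    unfolding power2_eq_square sum_product by (simp only: sum_distrib_left)
  finally show ?thesis .
qed

section \<open>The second smallest eigenvalue of a Laplacian with positive weights\<close>

text \<open>Serves to remove one index with eigenvalue \<open>0\<close>: position \<open>1\<close>
  of the sorted list is then the minimum over the remaining indices.\<close>

lemma sort_nth_1:
  fixes xs :: "'a::linorder list"
  assumes "\<forall>y\<in>set xs. x \<le> y" and "xs \<noteq> []" and "mset ys = add_mset x (mset xs)"
  shows "sort ys ! 1 \<in> set xs" "\<forall>y\<in>set xs. sort ys ! 1 \<le> y"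
proof -
  have "sort ys = x # sort xs" using assms by (intro properties_for_sort) auto
  then have *: "sort ys ! 1 = sort xs ! 0" by simp
  have "sort xs ! 0 \<in> set (sort xs)" using assms(2) by (intro nth_mem) auto
  then show "sort ys ! 1 \<in> set xs" unfolding * by simp
  show "\<forall>y\<in>set xs. sort ys ! 1 \<le> y"
  proof
    fix y assume "y \<in> set xs"
    then obtain i where "i < length (sort xs)" "y = sort xs ! i" by (metis in_set_conv_nth set_sort)
    then show "sort ys ! 1 \<le> y" unfolding * using sorted_nth_mono[OF sorted_sort] by blast
  qed
qed

lemma laplacian_index:
  assumes "B \<in> carrier_mat n n" "i < n" "j < n"
  shows "laplacian B $$ (i,j) = (if i = j then 1 else 0) - B $$ (i,j) / (sqrt (row_sum B i) * sqrt (row_sum B j))"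
  using assms unfolding laplacian_def Let_def
  by (simp add: mat_diag_mult_right[of _ n n] mat_diag_mult_left[of _ n n])

text \<open>
  In the coordinates \<open>v = D^(1/2) f\<close> the Laplacian becomes the generalised eigenvalue problem
  \<open>B f = \<lambda> D f\<close>, and positivity of the entries makes the eigenvalue belonging to the constant
  \<open>f\<close> simple.
\<close>

lemma is_v2_laplacianE:
  fixes B :: "real mat"
  assumes B: "B \<in> carrier_mat n n" and n: "n \<ge> 2"
    and sym: "\<And>i j. i < n \<Longrightarrow> j < n \<Longrightarrow> B $$ (i,j) = B $$ (j,i)"
    and pos: "\<And>i j. i < n \<Longrightarrow> j < n \<Longrightarrow> B $$ (i,j) > 0"
    and D: "\<And>i. i < n \<Longrightarrow> D i = row_sum B i"
    and v2: "is_v2 (laplacian B) v"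
  obtains f l where "dim_vec v = n" "\<And>i. i < n \<Longrightarrow> v $ i = sqrt (D i) * f i"
    "(\<Sum>i<n. D i * f i) = 0" "(\<Sum>i<n. D i * (f i)\<^sup>2) = 1"
    "\<And>i. i < n \<Longrightarrow> (\<Sum>j<n. B $$ (i,j) * f j) = l * (D i * f i)"
    "\<And>g. (\<Sum>i<n. D i * g i) = 0 \<Longrightarrow>
       (\<Sum>i<n. \<Sum>j<n. B $$ (i,j) * g i * g j) \<le> l * (\<Sum>i<n. D i * (g i)\<^sup>2)"
proof -
  define L where "L = laplacian B"
  define p where "p = (\<lambda>i. sqrt (D i))"
  have Drow: "D i = (\<Sum>j<n. B $$ (i,j))" if "i < n" for i
    using D[OF that] B by (simp add: row_sum_def)
  have Dpos: "D i > 0" if "i < n" for i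
    unfolding Drow[OF that] using n pos[OF that] by (intro sum_pos) (auto simp: lessThan_empty_iff)
  have ppos: "p i > 0" if "i < n" for i using Dpos[OF that] by (simp add: p_def)
  have p2: "p i * p i = D i" if "i < n" for i using Dpos[OF that] by (simp add: p_def)
  have L: "L \<in> carrier_mat n n" unfolding L_def laplacian_def Let_def using B by (auto simp: mat_diag_def)
  have Lij: "L $$ (i,j) = (if i = j then 1 else 0) - B $$ (i,j) / (p i * p j)" if "i < n" "j < n" for i j
    unfolding L_def using laplacian_index[OF B that] that D by (simp add: p_def)
  have Lsym: "L $$ (i,j) = L $$ (j,i)" if "i < n" "j < n" for i j
    using that sym by (simp add: Lij mult.commute)
  have Lap: "(\<Sum>j<n. L $$ (i,j) * (p j * g j)) = (D i * g i - (\<Sum>j<n. B $$ (i,j) * g j)) / p i" if i: "i < n" for g i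
  proof -
    have "(\<Sum>j<n. L $$ (i,j) * (p j * g j)) = (\<Sum>j<n. (if j = i then p i * g i else 0) - B $$ (i,j) * g j / p i)"
    proof (rule sum.cong[OF refl])
      fix j assume "j \<in> {..<n}"
      then have "j < n" by simp
      then show "L $$ (i,j) * (p j * g j) = (if j = i then p i * g i else 0) - B $$ (i,j) * g j / p i"
        using ppos[of j] ppos[OF i] i by (auto simp: Lij field_simps)
    qed
    also have "\<dots> = p i * g i - (\<Sum>j<n. B $$ (i,j) * g j) / p i"
      using i by (simp add: sum_subtractf sum_divide_distrib)
    also have "p i * g i = D i * g i / p i" using ppos[OF i] by (simp flip: p2[OF i])
    finally show ?thesis by (simp add: diff_divide_distrib)
  qed
  have Lquad: "(\<Sum>i<n. \<Sum>j<n. L $$ (i,j) * (p i * g i) * (p j * g j))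
      = (\<Sum>i<n. D i * (g i)\<^sup>2) - (\<Sum>i<n. \<Sum>j<n. B $$ (i,j) * g i * g j)" for g
  proof -
    have "(\<Sum>i<n. \<Sum>j<n. L $$ (i,j) * (p i * g i) * (p j * g j))
       = (\<Sum>i<n. (p i * g i) * (\<Sum>j<n. L $$ (i,j) * (p j * g j)))"
      by (simp add: sum_distrib_left mult_ac)
    also have "\<dots> = (\<Sum>i<n. D i * (g i)\<^sup>2 - g i * (\<Sum>j<n. B $$ (i,j) * g j))"
    proof (rule sum.cong[OF refl])
      fix i assume "i \<in> {..<n}"
      then have i: "i < n" by simp
      show "(p i * g i) * (\<Sum>j<n. L $$ (i,j) * (p j * g j)) = D i * (g i)\<^sup>2 - g i * (\<Sum>j<n. B $$ (i,j) * g j)"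
        unfolding Lap[OF i] using ppos[OF i] by (simp add: field_simps power2_eq_square)
    qed
    finally show ?thesis by (simp add: sum_subtractf sum_distrib_left mult_ac)
  qed
  \<comment> \<open>The Dirichlet form of the weighted graph \<open>B\<close>. It gives
    nonnegativity of all eigenvalues and decides which eigenvectors can belong to
    \<open>0\<close>.\<close>
  have dirichlet: "(\<Sum>i<n. \<Sum>j<n. L $$ (i,j) * (p i * g i) * (p j * g j))
      = (\<Sum>i<n. \<Sum>j<n. B $$ (i,j) * (g i - g j)\<^sup>2) / 2" for g
  proof -
    have a: "(\<Sum>i<n. \<Sum>j<n. B $$ (i,j) * (g i)\<^sup>2) = (\<Sum>i<n. D i * (g i)\<^sup>2)"
      by (intro sum.cong refl) (simp add: Drow sum_distrib_right)
    have "(\<Sum>i<n. \<Sum>j<n. B $$ (i,j) * (g j)\<^sup>2) = (\<Sum>j<n. \<Sum>i<n. B $$ (i,j) * (g j)\<^sup>2)"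
      by (rule sum.swap)
    also have "\<dots> = (\<Sum>j<n. D j * (g j)\<^sup>2)"
      by (intro sum.cong refl) (simp add: Drow sum_distrib_right sym)
    finally have b: "(\<Sum>i<n. \<Sum>j<n. B $$ (i,j) * (g j)\<^sup>2) = (\<Sum>i<n. D i * (g i)\<^sup>2)" .
    have "(\<Sum>i<n. \<Sum>j<n. B $$ (i,j) * (g i - g j)\<^sup>2)
      = (\<Sum>i<n. \<Sum>j<n. B $$ (i,j) * (g i)\<^sup>2 + B $$ (i,j) * (g j)\<^sup>2 - 2 * (B $$ (i,j) * g i * g j))"
      by (simp add: power2_eq_square algebra_simps)
    also have "\<dots> = (\<Sum>i<n. \<Sum>j<n. B $$ (i,j) * (g i)\<^sup>2) + (\<Sum>i<n. \<Sum>j<n. B $$ (i,j) * (g j)\<^sup>2)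
       - 2 * (\<Sum>i<n. \<Sum>j<n. B $$ (i,j) * g i * g j)"
      by (simp add: sum.distrib sum_subtractf sum_distrib_left)
    finally show ?thesis unfolding Lquad a b by simp
  qed
  obtain u e where orth: "\<And>k l. k < n \<Longrightarrow> l < n \<Longrightarrow> (\<Sum>i<n. u k i * u l i) = (if k = l then 1 else (0::real))"
    and compl: "\<And>i j. i < n \<Longrightarrow> j < n \<Longrightarrow> (\<Sum>k<n. u k i * u k j) = (if i = j then 1 else (0::real))"
    and Le: "\<And>i j. i < n \<Longrightarrow> j < n \<Longrightarrow> L $$ (i,j) = (\<Sum>k<n. e k * u k i * u k j)"
    and roots: "proots (char_poly L) = mset (map e [0..<n])"
    using real_symmetric_eigenbasis[OF L Lsym] by blast
  have quad: "(\<Sum>i<n. \<Sum>j<n. L $$ (i,j) * y i * y j) = (\<Sum>k<n. e k * (\<Sum>i<n. u k i * y i)\<^sup>2)" for y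
    using Le by (rule quadratic_form_eigenbasis)
  have quad1: "(\<Sum>i<n. \<Sum>j<n. (if i = j then 1 else 0) * y i * y j) = (\<Sum>k<n. (\<Sum>i<n. u k i * y i)\<^sup>2)" for y :: "nat \<Rightarrow> real"
    using quadratic_form_eigenbasis[of n "\<lambda>i j. if i = j then 1 else 0" "\<lambda>_. 1" u y] compl by simp
  have parseval: "(\<Sum>k<n. (\<Sum>i<n. u k i * y i)\<^sup>2) = (\<Sum>i<n. (y i)\<^sup>2)" for y
  proof -
    have "(\<Sum>i<n. \<Sum>j<n. (if i = j then 1 else 0) * y i * y j) = (\<Sum>i<n. \<Sum>j<n. if j = i then (y i)\<^sup>2 else 0)"
      by (intro sum.cong refl) (auto simp: power2_eq_square)
    also have "\<dots> = (\<Sum>i<n. (y i)\<^sup>2)" by simp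
    finally show ?thesis unfolding quad1 .
  qed
  have ek: "e k = (\<Sum>i<n. \<Sum>j<n. B $$ (i,j) * (u k i / p i - u k j / p j)\<^sup>2) / 2" if k: "k < n" for k
  proof -
    have "(\<Sum>i<n. \<Sum>j<n. L $$ (i,j) * u k i * u k j) = (\<Sum>l<n. e l * (if l = k then 1 else 0)\<^sup>2)"
      unfolding quad[where y = "u k"] using k by (intro sum.cong refl) (auto simp: orth)
    also have "\<dots> = (\<Sum>l<n. if l = k then e k else 0)" by (intro sum.cong refl) auto
    also have "\<dots> = e k" using k by simp
    finally have *: "(\<Sum>i<n. \<Sum>j<n. L $$ (i,j) * u k i * u k j) = e k" .
    have c: "p i * (u k i / p i) = u k i" if "i < n" for i using ppos[OF that] by simp
    have "e k = (\<Sum>i<n. \<Sum>j<n. L $$ (i,j) * (p i * (u k i / p i)) * (p j * (u k j / p j)))"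
      unfolding *[symmetric] by (intro sum.cong refl) (simp only: c lessThan_iff)
    then show ?thesis unfolding dirichlet .
  qed
  have enn: "e k \<ge> 0" if "k < n" for k
    unfolding ek[OF that] using pos by (intro divide_nonneg_pos sum_nonneg) (auto intro!: mult_nonneg_nonneg intro: less_imp_le)
  \<comment> \<open>All entries of \<open>B\<close> are positive, so a vanishing sum of squares
    equates \<open>u k i / p i\<close> for all indices \<open>i\<close>.\<close>
  have ezero: "\<exists>c. \<forall>i<n. u k i = c * p i" if k: "k < n" and "e k = 0" for k
  proof -
    have "(\<Sum>i<n. \<Sum>j<n. B $$ (i,j) * (u k i / p i - u k j / p j)\<^sup>2) = 0"
      using ek[OF k] that by simp
    then have "\<forall>i<n. (\<Sum>j<n. B $$ (i,j) * (u k i / p i - u k j / p j)\<^sup>2) = 0"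
      using pos by (subst (asm) sum_nonneg_eq_0_iff) (auto intro!: sum_nonneg mult_nonneg_nonneg intro: less_imp_le)
    then have "B $$ (i,j) * (u k i / p i - u k j / p j)\<^sup>2 = 0" if ij: "i < n" "j < n" for i j
      using sum_nonneg_eq_0_iff[of "{..<n}" "\<lambda>j. B $$ (i,j) * (u k i / p i - u k j / p j)\<^sup>2"] pos[OF ij(1)] ij
      by (auto simp: less_imp_le)
    then have "\<forall>i<n. u k i / p i = u k 0 / p 0" using pos n
      by (metis mult_eq_0_iff less_irrefl eq_iff_diff_eq_0 power_eq_0_iff gr0I not_numeral_le_zero)
    then have "\<forall>i<n. u k i = (u k 0 / p 0) * p i" using ppos by (metis nonzero_eq_divide_eq less_irrefl)
    then show ?thesis by blast
  qed
  have p2pos: "(\<Sum>i<n. (p i)\<^sup>2) > 0" using ppos n by (intro sum_pos) (auto simp: less_imp_neq[symmetric] lessThan_empty_iff)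
  have "(\<Sum>i<n. \<Sum>j<n. L $$ (i,j) * (p i * 1) * (p j * 1)) = 0" unfolding dirichlet by simp
  then have "(\<Sum>k<n. e k * (\<Sum>i<n. u k i * p i)\<^sup>2) = 0" using quad[where y = p] by simp
  then have "\<forall>k<n. e k * (\<Sum>i<n. u k i * p i)\<^sup>2 = 0"
    using enn by (subst (asm) sum_nonneg_eq_0_iff) auto
  \<comment> \<open>By Parseval \<open>p\<close> is not orthogonal to the whole eigenbasis, while
    its quadratic form is zero; so some eigenvalue vanishes.\<close>
  moreover have "\<exists>k<n. (\<Sum>i<n. u k i * p i)\<^sup>2 \<noteq> 0"
  proof (rule ccontr)
    assume "\<not> ?thesis"
    then have "(\<Sum>i<n. (p i)\<^sup>2) = 0" by (subst parseval[symmetric]) auto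
    then show False using p2pos by simp
  qed
  ultimately obtain k0 where k0: "k0 < n" "e k0 = 0" by (metis mult_eq_0_iff)
  obtain c0 where c0: "\<And>i. i < n \<Longrightarrow> u k0 i = c0 * p i" using ezero[OF k0] by blast
  have epos: "e k > 0" if k: "k < n" "k \<noteq> k0" for k
  proof (rule ccontr)
    assume "\<not> e k > 0"
    then have "e k = 0" using enn[OF k(1)] by simp
    then obtain c where c: "\<And>i. i < n \<Longrightarrow> u k i = c * p i" using ezero[OF k(1)] by blast
    have "0 = (\<Sum>i<n. u k i * u k0 i)" using orth[OF k(1) k0(1)] k by simp
    also have "\<dots> = c * c0 * (\<Sum>i<n. (p i)\<^sup>2)"
      unfolding sum_distrib_left by (intro sum.cong) (auto simp: c c0 power2_eq_square)
    finally have "c = 0 \<or> c0 = 0" using p2pos by auto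
    then show False using orth[OF k(1) k(1)] orth[OF k0(1) k0(1)] c c0 by auto
  qed
  define m where "m = second_smallest_eigenvalue L"
  define rest where "rest = map e (filter (\<lambda>k. k \<noteq> k0) [0..<n])"
  have rest: "set rest = e ` ({..<n} - {k0})" unfolding rest_def by auto
  have m_sort: "m = sort (map e [0..<n]) ! 1"
    unfolding m_def second_smallest_eigenvalue_def roots by (simp only: sorted_list_of_multiset_mset)
  have "mset (map e [0..<n]) = add_mset 0 (mset rest)"
  proof -
    have "mset [0..<n] = add_mset k0 (mset (filter (\<lambda>k. k \<noteq> k0) [0..<n]))"
      using k0(1) by (intro multiset_eqI) (auto simp: count_mset_set')
    then show ?thesis unfolding rest_def using k0(2) by (simp only: mset_map image_mset_add_mset)
  qed
  moreover have "rest \<noteq> []"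
  proof -
    have "{..<n} - {k0} \<noteq> {}"
    proof -
      have "(if k0 = 0 then 1 else 0) \<in> {..<n} - {k0}" using n by auto
      then show ?thesis by blast
    qed
    then show ?thesis using rest by (metis image_is_empty list.set(1))
  qed
  moreover have "\<forall>y\<in>set rest. 0 \<le> y" unfolding rest using epos by force
  ultimately have m: "m \<in> set rest" "\<forall>y\<in>set rest. m \<le> y"
    using sort_nth_1[of rest 0 "map e [0..<n]"] m_sort by auto
  have mpos: "m > 0" using m(1) epos unfolding rest by auto
  have mle: "m \<le> e k" if "k < n" "k \<noteq> k0" for k using m(2) that unfolding rest by auto
  have "eigenvector L v m" and nv: "euclidean_norm v = 1"
    using v2 unfolding is_v2_def L_def m_def by auto
  then have v: "v \<in> carrier_vec n" "L *\<^sub>v v = m \<cdot>\<^sub>v v" unfolding eigenvector_def using L by auto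
  define f where "f = (\<lambda>i. v $ i / p i)"
  have vf: "v $ i = p i * f i" if "i < n" for i unfolding f_def using ppos[OF that] by simp
  have Lv: "(\<Sum>j<n. L $$ (i,j) * v $ j) = m * v $ i" if "i < n" for i
  proof -
    have "(L *\<^sub>v v) $ i = m * v $ i" using v that by simp
    moreover have "(L *\<^sub>v v) $ i = (\<Sum>j<n. L $$ (i,j) * v $ j)"
      using that L v(1) by (auto simp: scalar_prod_def lessThan_atLeast0 intro!: sum.cong)
    ultimately show ?thesis by simp
  qed
  have Bf: "(\<Sum>j<n. B $$ (i,j) * f j) = (1 - m) * (D i * f i)" if i: "i < n" for i
  proof -
    have "(\<Sum>j<n. L $$ (i,j) * (p j * f j)) = (\<Sum>j<n. L $$ (i,j) * v $ j)"
      by (intro sum.cong refl) (simp add: vf)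
    also have "\<dots> = m * (p i * f i)" using Lv[OF i] vf[OF i] by simp
    finally have "(\<Sum>j<n. L $$ (i,j) * (p j * f j)) = m * (p i * f i)" .
    then have "D i * f i - (\<Sum>j<n. B $$ (i,j) * f j) = m * (p i * f i) * p i"
      unfolding Lap[OF i] using ppos[OF i] by (simp add: field_simps)
    then show ?thesis by (simp add: p2[OF i, symmetric] algebra_simps)
  qed
  \<comment> \<open>Orthogonality to the constants is read off the equation itself: summed over all
    rows it multiplies the weighted sum of \<open>f\<close> by \<open>1 - m\<close> without changing
    it, and \<open>m > 0\<close>. Thus \<open>v\<close> need not be one of the basis vectors
    \<open>u k\<close>.\<close>
  have "(\<Sum>i<n. \<Sum>j<n. B $$ (i,j) * f j) = (\<Sum>j<n. \<Sum>i<n. B $$ (i,j) * f j)" by (rule sum.swap)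
  also have "\<dots> = (\<Sum>j<n. D j * f j)"
    by (intro sum.cong refl) (simp add: Drow sum_distrib_right sym)
  finally have "(1 - m) * (\<Sum>i<n. D i * f i) = (\<Sum>i<n. D i * f i)" by (simp add: Bf sum_distrib_left)
  then have s0: "(\<Sum>i<n. D i * f i) = 0" using mpos by (simp add: algebra_simps)
  have s1: "(\<Sum>i<n. D i * (f i)\<^sup>2) = 1"
  proof -
    have "(\<Sum>i<n. D i * (f i)\<^sup>2) = (\<Sum>i<n. v $ i * v $ i)"
      by (intro sum.cong refl) (simp add: vf power2_eq_square p2[symmetric] mult_ac)
    also have "\<dots> = v \<bullet> v" using v(1) by (simp add: scalar_prod_def lessThan_atLeast0)
    also have "\<dots> = 1" using nv unfolding euclidean_norm_def by simp
    finally show ?thesis .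
  qed
  have var: "(\<Sum>i<n. \<Sum>j<n. B $$ (i,j) * g i * g j) \<le> (1 - m) * (\<Sum>i<n. D i * (g i)\<^sup>2)"
    if g: "(\<Sum>i<n. D i * g i) = 0" for g
  proof -
    define y where "y = (\<lambda>i. p i * g i)"
    have y2: "(\<Sum>i<n. (y i)\<^sup>2) = (\<Sum>i<n. D i * (g i)\<^sup>2)"
      by (intro sum.cong refl) (simp add: y_def power2_eq_square p2[symmetric] mult_ac)
    have "(\<Sum>i<n. u k0 i * y i) = c0 * (\<Sum>i<n. D i * g i)"
      unfolding sum_distrib_left by (intro sum.cong refl) (simp add: c0 y_def p2[symmetric] mult_ac)
    then have y0: "(\<Sum>i<n. u k0 i * y i) = 0" using g by simp
    have "m * (\<Sum>i<n. (y i)\<^sup>2) = (\<Sum>k<n. m * (\<Sum>i<n. u k i * y i)\<^sup>2)"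
      by (simp add: parseval sum_distrib_left[symmetric])
    also have "\<dots> \<le> (\<Sum>k<n. e k * (\<Sum>i<n. u k i * y i)\<^sup>2)"
    proof (rule sum_mono)
      fix k assume "k \<in> {..<n}"
      then show "m * (\<Sum>i<n. u k i * y i)\<^sup>2 \<le> e k * (\<Sum>i<n. u k i * y i)\<^sup>2"
        using mle[of k] y0 by (cases "k = k0") (auto intro: mult_right_mono)
    qed
    also have "\<dots> = (\<Sum>i<n. D i * (g i)\<^sup>2) - (\<Sum>i<n. \<Sum>j<n. B $$ (i,j) * g i * g j)"
      unfolding quad[symmetric] y_def Lquad ..
    finally show ?thesis unfolding y2 by (simp add: algebra_simps)
  qed
  show ?thesis
    using that[of f "1 - m"] v(1) vf s0 s1 Bf var unfolding p_def by auto
qed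

section \<open>Concentration for independent edges\<close>

lemma exp_quadratic_upper:
  fixes x :: real
  assumes "x \<le> 1"
  shows "exp x \<le> 1 + x + x\<^sup>2"
proof (cases "x \<ge> 0")
  case True
  then show ?thesis using exp_bound assms by blast
next
  case False
  define y where "y = - x"
  have y: "y > 0" using False by (simp add: y_def)
  \<comment> \<open>For negative arguments the claim is multiplied by \<open>exp y\<close>, which is
    then replaced by its quadratic Taylor polynomial; the cross terms of the product leave only
    nonnegative powers of \<open>y\<close> beyond \<open>1\<close>.\<close>
  have "1 \<le> (1 - y + y\<^sup>2) * (1 + y + y\<^sup>2 / 2)"
  proof -
    have "(1 - y + y\<^sup>2) * (1 + y + y\<^sup>2 / 2) = 1 + (y\<^sup>2 + y ^ 3 + y ^ 4) / 2"
      by (simp add: field_simps power2_eq_square power3_eq_cube power4_eq_xxxx)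
    then show ?thesis using y by simp
  qed
  also have "\<dots> \<le> (1 - y + y\<^sup>2) * exp y"
  proof (rule mult_left_mono)
    show "1 + y + y\<^sup>2 / 2 \<le> exp y" using exp_lower_Taylor_quadratic y by simp
    have "1 - y + y\<^sup>2 = (y - 1/2)\<^sup>2 + 3/4" by (simp add: power2_eq_square field_simps)
    then show "0 \<le> 1 - y + y\<^sup>2" by simp
  qed
  finally have "exp (- y) \<le> 1 - y + y\<^sup>2" by (simp add: exp_minus field_simps)
  then show ?thesis by (simp add: y_def)
qed

lemma int_abs_le_square: "\<bar>k\<bar> \<le> (k :: int)\<^sup>2"
proof (cases "k = 0")
  case False
  then have "\<bar>k\<bar> * 1 \<le> \<bar>k\<bar> * \<bar>k\<bar>" by (intro mult_left_mono) auto
  then show ?thesis by (simp add: power2_eq_square abs_mult_self_eq)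
qed simp

text \<open>The exponential Markov inequality. The Chernoff parameter is absorbed into
  \<open>g\<close>, so that the statement serves both the Bernstein estimate and the edge counts;
  finiteness of \<open>'b\<close> makes all expectations exist.\<close>

lemma Pi_pmf_chernoff:
  fixes g :: "'a \<Rightarrow> 'b :: finite \<Rightarrow> real"
  assumes "finite E" and "\<And>e. e \<in> E \<Longrightarrow> measure_pmf.expectation (p e) (\<lambda>y. exp (g e y)) \<le> exp (k e)"
  shows "measure_pmf.prob (Pi_pmf E d p) {x. (\<Sum>e\<in>E. g e (x e)) \<ge> t} \<le> exp ((\<Sum>e\<in>E. k e) - t)"
proof -
  let ?M = "Pi_pmf E d p" and ?u = "\<lambda>x. \<Prod>e\<in>E. exp (g e (x e))"
  have "measure_pmf.prob ?M {x. (\<Sum>e\<in>E. g e (x e)) \<ge> t}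
      = measure_pmf.prob ?M {x \<in> space ?M. ?u x \<ge> exp t}"
    using assms(1) by (simp flip: exp_sum)
  also have "\<dots> \<le> measure_pmf.expectation ?M ?u / exp t"
  proof (intro integral_Markov_inequality_measure[where A = "{}"])
    show "integrable (measure_pmf ?M) ?u"
      using assms(1) by (intro integrable_prod_Pi_pmf) (auto intro: integrable_measure_pmf_finite)
  qed (auto intro!: prod_nonneg)
  also have "measure_pmf.expectation ?M ?u = (\<Prod>e\<in>E. measure_pmf.expectation (p e) (\<lambda>y. exp (g e y)))"
    using assms(1) by (intro expectation_prod_Pi_pmf) (auto intro: integrable_measure_pmf_finite)
  also have "\<dots> \<le> (\<Prod>e\<in>E. exp (k e))"
    using assms(2) by (intro prod_mono) (auto intro: integral_nonneg)
  also have "\<dots> = exp (\<Sum>e\<in>E. k e)" using assms(1) by (simp add: exp_sum)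
  finally show ?thesis by (simp add: exp_diff divide_right_mono)
qed

text \<open>With \<open>\<bar>c\<bar> \<le> 1\<close> both exponents lie in the range of the
  quadratic bound; the linear terms cancel by centring, and the variance \<open>p * (1 - p)\<close>
  is at most \<open>p\<close>.\<close>

lemma bernoulli_bernstein:
  assumes p: "0 \<le> p" "p \<le> 1" and c: "\<bar>c\<bar> \<le> 1"
  shows "measure_pmf.expectation (bernoulli_pmf p) (\<lambda>y. exp (c * (of_bool y - p))) \<le> exp (c\<^sup>2 * p)"
proof -
  have "\<bar>c * (1 - p)\<bar> \<le> 1" using mult_mono[of "\<bar>c\<bar>" 1 "\<bar>1 - p\<bar>" 1] p c by (simp add: abs_mult)
  then have 1: "exp (c * (1 - p)) \<le> 1 + c * (1 - p) + (c * (1 - p))\<^sup>2" by (intro exp_quadratic_upper) auto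
  have "\<bar>c * (- p)\<bar> \<le> 1" using mult_mono[of "\<bar>c\<bar>" 1 "\<bar>p\<bar>" 1] p c by (simp add: abs_mult)
  then have 2: "exp (c * (- p)) \<le> 1 + c * (- p) + (c * (- p))\<^sup>2" by (intro exp_quadratic_upper) auto
  have "measure_pmf.expectation (bernoulli_pmf p) (\<lambda>y. exp (c * (of_bool y - p)))
      = exp (c * (1 - p)) * p + exp (c * (- p)) * (1 - p)" using p by simp
  also have "\<dots> \<le> (1 + c * (1 - p) + (c * (1 - p))\<^sup>2) * p + (1 + c * (- p) + (c * (- p))\<^sup>2) * (1 - p)"
    using p 1 2 by (intro add_mono mult_right_mono) auto
  also have "\<dots> = 1 + c\<^sup>2 * (p * (1 - p))" by (simp add: power2_eq_square field_simps)
  also have "\<dots> \<le> 1 + c\<^sup>2 * p"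
    using p mult_left_mono[of "p * (1 - p)" p "c\<^sup>2"] mult_left_le[of "1 - p" p] by simp
  also have "\<dots> \<le> exp (c\<^sup>2 * p)" by (rule exp_ge_add_one_self)
  finally show ?thesis .
qed

text \<open>Here \<open>s\<close> is the exponential of the Chernoff parameter. It stays free
  because every pair of level sets will use its own value.\<close>

lemma bernoulli_exp_count:
  assumes p: "0 \<le> p" "p \<le> 1" and s: "1 \<le> s"
  shows "measure_pmf.expectation (bernoulli_pmf p) (\<lambda>y. exp (of_bool y * ln s)) \<le> exp (p * s)"
proof -
  have "measure_pmf.expectation (bernoulli_pmf p) (\<lambda>y. exp (of_bool y * ln s)) = s * p + (1 - p)"
    using p s by simp
  also have "\<dots> \<le> 1 + p * s" using p by (simp add: mult.commute)
  also have "\<dots> \<le> exp (p * s)" by (rule exp_ge_add_one_self)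
  finally show ?thesis .
qed

section \<open>Unordered pairs, edges between vertex sets, and the entropy of subsets\<close>

definition pairs :: "nat \<Rightarrow> (nat \<times> nat) set" where
  "pairs n = {(i, j). i < j \<and> j < n}"

lemma finite_pairs [simp]: "finite (pairs n)"
  by (rule finite_subset[of _ "{..<n} \<times> {..<n}"]) (auto simp: pairs_def)

lemma sum_pairs_le_sum_prod:
  fixes f :: "nat \<Rightarrow> real"
  assumes "\<And>i. f i \<ge> 0"
  shows "(\<Sum>(i,j)\<in>pairs n. f i * f j) \<le> (\<Sum>i<n. f i)\<^sup>2"
proof -
  have "(\<Sum>(i,j)\<in>pairs n. f i * f j) \<le> (\<Sum>(i,j)\<in>{..<n} \<times> {..<n}. f i * f j)"
    using assms by (intro sum_mono2) (auto simp: pairs_def)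
  also have "\<dots> = (\<Sum>i<n. f i)\<^sup>2" by (simp add: power2_eq_square sum_product sum.cartesian_product)
  finally show ?thesis .
qed

text \<open>The sets may overlap; an unordered pair is counted once, whichever of its ends lies in
  which set.\<close>

definition cross :: "nat \<Rightarrow> nat set \<Rightarrow> nat set \<Rightarrow> (nat \<times> nat) set" where
  "cross n I J = {(i, j) \<in> pairs n. (i \<in> I \<and> j \<in> J) \<or> (i \<in> J \<and> j \<in> I)}"

text \<open>Each pair is oriented so as to lie in \<open>I \<times> J\<close>. This is injective
  because the members of \<open>pairs n\<close> are increasing, so a pair and its reversal never
  both occur.\<close>

lemma card_cross_le:
  assumes "finite I" "finite J"
  shows "card (cross n I J) \<le> card I * card J"
proof -
  let ?f = "\<lambda>(i,j). if i \<in> I \<and> j \<in> J then (i, j) else (j, i)"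
  have "card (cross n I J) \<le> card (I \<times> J)"
  proof (rule card_inj_on_le[of ?f])
    show "inj_on ?f (cross n I J)"
      by (auto simp: inj_on_def cross_def pairs_def split: if_splits)
    show "?f ` cross n I J \<subseteq> I \<times> J" by (auto simp: cross_def split: if_splits)
  qed (use assms in auto)
  then show ?thesis by (simp add: card_cartesian_product)
qed

text \<open>The binomial coefficient is compared with a single term in the expansion of
  \<open>(p / n + 1) ^ n\<close>, which is at most \<open>exp p\<close>.\<close>

lemma card_subsets_le_exp:
  assumes p: "1 \<le> p" "p \<le> n"
  shows "real (n choose p) \<le> exp (real p * ln (exp 1 * n / p))"
proof -
  have n: "0 < n" using p by simp
  let ?x = "real p / real n"
  have "real (n choose p) * ?x ^ p * 1 ^ (n - p) \<le> (\<Sum>k\<le>n. real (n choose k) * ?x ^ k * 1 ^ (n - k))"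
    using p by (intro member_le_sum[of p "{..n}" "\<lambda>k. real (n choose k) * ?x ^ k * 1 ^ (n - k)"]) auto
  also have "\<dots> = (?x + 1) ^ n" by (rule binomial_ring[symmetric])
  also have "\<dots> \<le> exp ?x ^ n" by (intro power_mono) (auto intro: exp_ge_add_one_self simp: add.commute)
  also have "\<dots> = exp (real p)" using n by (simp flip: exp_of_nat_mult)
  finally have "real (n choose p) * ?x ^ p \<le> exp (real p)" by simp
  then have "real (n choose p) \<le> exp (real p) / ?x ^ p" using p n by (simp add: field_simps)
  also have "\<dots> = (exp 1 * n / p) ^ p" by (simp add: power_divide power_mult_distrib flip: exp_of_nat_mult)
  also have "\<dots> = exp (real p * ln (exp 1 * n / p))" using p n by (simp add: exp_of_nat_mult)
  finally show ?thesis .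
qed

text \<open>\<open>subset_entropy n p\<close> bounds the logarithm of the number of \<open>p\<close>-element subsets of an \<open>n\<close>-set.\<close>

definition subset_entropy :: "nat \<Rightarrow> nat \<Rightarrow> real" where
  "subset_entropy n p = real p * ln (exp 1 * n / p)"

text \<open>The value at \<open>p = 1\<close> is the smallest. Each copy of the entropy therefore
  supplies a factor \<open>exp (- 1) / n\<close>, which later pays for the sums over sizes.\<close>

lemma subset_entropy_ge:
  assumes p: "1 \<le> p" "p \<le> n"
  shows "subset_entropy n p \<ge> 1 + ln n"
proof -
  have n: "0 < n" using p by simp
  have eq: "subset_entropy n p = p * (1 + ln n - ln p)"
    unfolding subset_entropy_def using p n by (simp add: ln_div ln_mult)
  have "ln (real p) \<le> real p - 1" using p by (intro ln_le_minus_one) auto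
  moreover have "(real p - 1) * ln p \<le> (real p - 1) * ln n" using p by (intro mult_left_mono) auto
  ultimately show ?thesis unfolding eq by (simp add: algebra_simps)
qed

text \<open>One copy of the entropy pays for the number of sets of a given size; since
  \<open>r \<ge> 1\<close>, at least \<open>3 * r\<close> of the \<open>4 * r\<close> copies
  remain.\<close>

lemma sum_subsets_exp_entropy:
  assumes r: "r \<ge> 1" and n: "n > 0"
  shows "(\<Sum>I\<in>{I. I \<subseteq> {..<n} \<and> I \<noteq> {}}. exp (- 4 * r * subset_entropy n (card I))) \<le> n * exp (- 3 * r * (1 + ln n))"
proof -
  let ?S = "{I. I \<subseteq> {..<n} \<and> I \<noteq> {}}" and ?h = "\<lambda>p. exp (- 4 * r * subset_entropy n p)"
  have fin: "finite ?S" by (rule finite_subset[of _ "Pow {..<n}"]) auto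
  have card: "card ` ?S \<subseteq> {1..n}"
  proof
    fix p assume "p \<in> card ` ?S"
    then obtain I where I: "p = card I" "I \<subseteq> {..<n}" "I \<noteq> {}" by blast
    then have "finite I" using finite_subset by blast
    then show "p \<in> {1..n}" using I card_mono[of "{..<n}" I] card_gt_0_iff[of I] by (simp add: Suc_le_eq)
  qed
  have "(\<Sum>I\<in>?S. ?h (card I)) = (\<Sum>p\<in>{1..n}. \<Sum>I\<in>{I\<in>?S. card I = p}. ?h (card I))"
    by (rule sum.group[symmetric]) (use fin card in auto)
  also have "\<dots> \<le> (\<Sum>p\<in>{1..n}. exp (- 3 * r * (1 + ln n)))"
  proof (rule sum_mono)
    fix p assume "p \<in> {1..n}"
    then have p: "1 \<le> p" "p \<le> n" by auto
    have "{I\<in>?S. card I = p} = {I. I \<subseteq> {..<n} \<and> card I = p}" using p by auto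
    then have "card {I\<in>?S. card I = p} = n choose p" by (simp add: n_subsets)
    then have "(\<Sum>I\<in>{I\<in>?S. card I = p}. ?h (card I)) = real (n choose p) * ?h p"
      by simp
    also have "\<dots> \<le> exp (subset_entropy n p) * ?h p"
      using card_subsets_le_exp[OF p] unfolding subset_entropy_def by (intro mult_right_mono) auto
    also have "\<dots> = exp (- (4 * r - 1) * subset_entropy n p)" by (simp add: algebra_simps flip: exp_add)
    also have "\<dots> \<le> exp (- 3 * r * (1 + ln n))"
    proof -
      have "3 * r * (1 + ln n) \<le> (4 * r - 1) * subset_entropy n p"
        using subset_entropy_ge[OF p] r n by (intro mult_mono) auto
      then show ?thesis by (simp add: algebra_simps)
    qed
    finally show "(\<Sum>I\<in>{I\<in>?S. card I = p}. ?h (card I)) \<le> exp (- 3 * r * (1 + ln n))" .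
  qed
  finally show ?thesis by simp
qed

text \<open>A Chernoff bound with parameter \<open>ln s\<close>, before any choice of
  \<open>s\<close>: the first term on the right majorises the logarithm of the moment generating
  function, the second is the allowance for the union bound.\<close>

definition few_edges :: "nat \<Rightarrow> real \<Rightarrow> real \<Rightarrow> (nat \<times> nat \<Rightarrow> bool) \<Rightarrow> real \<Rightarrow> nat set \<Rightarrow> nat set \<Rightarrow> bool" where
  "few_edges n d r G s I J \<longleftrightarrow> (\<Sum>e\<in>cross n I J. of_bool (G e)) * ln s
     \<le> 2 * d * card I * card J / n * s + 4 * r * (subset_entropy n (card I) + subset_entropy n (card J))"

text \<open>The vectors are scaled by \<open>sqrt n\<close> and rounded to integers, so the cutoff
  \<open>sqrt d\<close> means \<open>sqrt d / n\<close> for the entries of a unit vector. Cutting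
  off pair by pair keeps the summands bounded, as Bernstein's inequality requires.\<close>

definition light_form ::
    "nat \<Rightarrow> real \<Rightarrow> (nat \<times> nat \<Rightarrow> real) \<Rightarrow> (nat \<times> nat \<Rightarrow> bool) \<Rightarrow> (nat \<Rightarrow> int) \<Rightarrow> real" where
  "light_form n d p G m = (\<Sum>(i,j)\<in>pairs n. if \<bar>real_of_int (m i) * real_of_int (m j)\<bar> \<le> sqrt d
     then (of_bool (G (i,j)) - p (i,j)) * (real_of_int (m i) * real_of_int (m j)) else 0)"

section \<open>The two exceptional events, each of probability at most
  \<open>exp (- r) / 2\<close>\<close>

context
  fixes n :: nat and d :: real and p :: "nat \<times> nat \<Rightarrow> real"
  assumes n: "n > 0" and d: "d > 0"
    and p: "\<And>e. e \<in> pairs n \<Longrightarrow> 0 \<le> p e \<and> p e \<le> 1 \<and> p e \<le> 2 * d / n"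
begin

abbreviation "random_graph \<equiv> Pi_pmf (pairs n) False (\<lambda>e. bernoulli_pmf (p e))"

lemma prob_cross_edges:
  assumes "finite I" "finite J" and s: "s \<ge> 1"
  shows "measure_pmf.prob random_graph
     {x. (\<Sum>e\<in>cross n I J. of_bool (x e)) * ln s \<ge> 2 * d * card I * card J / n * s + y} \<le> exp (- y)"
proof -
  let ?C = "cross n I J" and ?mu = "2 * d * card I * card J / n"
  let ?g = "\<lambda>e y. if e \<in> ?C then of_bool y * ln s else 0"
  have C: "?C \<subseteq> pairs n" by (auto simp: cross_def)
  have eq: "(\<Sum>e\<in>?C. of_bool (x e)) * ln s = (\<Sum>e\<in>pairs n. ?g e (x e))" for x
    using C by (simp add: sum.If_cases Int_absorb1 sum_distrib_right)
  have "measure_pmf.prob random_graph {x. (\<Sum>e\<in>?C. of_bool (x e)) * ln s \<ge> ?mu * s + y}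
     \<le> exp ((\<Sum>e\<in>pairs n. if e \<in> ?C then p e * s else 0) - (?mu * s + y))"
    unfolding eq
    by (rule Pi_pmf_chernoff) (use bernoulli_exp_count[OF _ _ s] p in auto)
  also have "\<dots> \<le> exp (- y)"
  proof -
    have "(\<Sum>e\<in>pairs n. if e \<in> ?C then p e * s else 0) = (\<Sum>e\<in>?C. p e * s)"
      using C by (simp add: sum.If_cases Int_absorb1)
    also have "\<dots> \<le> (\<Sum>e\<in>?C. 2 * d / n * s)"
      using p C s by (intro sum_mono mult_right_mono) auto
    also have "\<dots> = real (card ?C) * (2 * d / n * s)" by simp
    also have "\<dots> \<le> real (card I * card J) * (2 * d / n * s)"
      using card_cross_le[OF assms(1,2)] d s by (intro mult_right_mono) (auto simp del: of_nat_mult)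
    also have "\<dots> = ?mu * s" by simp
    finally show ?thesis by simp
  qed
  finally show ?thesis .
qed

lemma prob_discrepancy:
  assumes r: "r \<ge> 1" and Z: "finite Z" "card Z \<le> 4 * n" "\<And>s. s \<in> Z \<Longrightarrow> s \<ge> 1"
  shows "measure_pmf.prob random_graph
     {x. \<exists>I J s. I \<subseteq> {..<n} \<and> I \<noteq> {} \<and> J \<subseteq> {..<n} \<and> J \<noteq> {} \<and> s \<in> Z \<and> \<not> few_edges n d r x s I J}
    \<le> exp (- r) / 2" (is "measure_pmf.prob _ ?B \<le> _")
proof -
  let ?S = "{I. I \<subseteq> {..<n} \<and> I \<noteq> {}}" and ?h = "\<lambda>I. exp (- 4 * r * subset_entropy n (card I))"
  have fin: "finite ?S" by (rule finite_subset[of _ "Pow {..<n}"]) auto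
  define F where "F = (\<lambda>(I,J,s). {x. (\<Sum>e\<in>cross n I J. of_bool (x e)) * ln s
          \<ge> 2 * d * card I * card J / n * s + 4 * r * (subset_entropy n (card I) + subset_entropy n (card J))})"
  have "?B \<subseteq> (\<Union>z\<in>?S \<times> ?S \<times> Z. F z)"
  proof
    fix x assume "x \<in> ?B"
    then obtain I J s where "I \<in> ?S" "J \<in> ?S" "s \<in> Z" and few: "\<not> few_edges n d r x s I J" by blast
    moreover have "x \<in> F (I,J,s)" using few unfolding F_def few_edges_def by auto
    ultimately show "x \<in> (\<Union>z\<in>?S \<times> ?S \<times> Z. F z)" by blast
  qed
  then have "measure_pmf.prob random_graph ?B \<le> measure_pmf.prob random_graph (\<Union>z\<in>?S \<times> ?S \<times> Z. F z)"
    by (intro measure_pmf.finite_measure_mono) auto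
  also have "\<dots> \<le> (\<Sum>z\<in>?S \<times> ?S \<times> Z. measure_pmf.prob random_graph (F z))"
    using fin Z(1) by (intro measure_UNION_le) auto
  also have "\<dots> \<le> (\<Sum>(I,J,s)\<in>?S \<times> ?S \<times> Z. ?h I * ?h J)"
  proof (rule sum_mono)
    fix z assume "z \<in> ?S \<times> ?S \<times> Z"
    then obtain I J s where z: "z = (I,J,s)" "I \<subseteq> {..<n}" "J \<subseteq> {..<n}" "s \<in> Z" by auto
    have "measure_pmf.prob random_graph (F z) \<le> exp (- (4 * r * (subset_entropy n (card I) + subset_entropy n (card J))))"
      unfolding F_def z split using z Z finite_subset by (intro prob_cross_edges) blast+
    also have "\<dots> = ?h I * ?h J" by (simp add: algebra_simps flip: exp_add)
    finally show "measure_pmf.prob random_graph (F z) \<le> (case z of (I,J,s) \<Rightarrow> ?h I * ?h J)" by (simp add: z)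
  qed
  also have "\<dots> = (\<Sum>I\<in>?S. ?h I) * (\<Sum>J\<in>?S. ?h J) * card Z"
    unfolding sum_product
    by (simp only: sum.cartesian_product[symmetric] sum_distrib_right sum_constant mult.commute[of "real (card Z)"])
  also have "\<dots> \<le> (n * exp (- 3 * r * (1 + ln n))) * (n * exp (- 3 * r * (1 + ln n))) * (4 * n)"
    using sum_subsets_exp_entropy[OF r n] Z(2)
    by (intro mult_mono) (auto intro!: sum_nonneg mult_nonneg_nonneg)
  \<comment> \<open>The cubic factor comes from the two sums over sizes and from
    \<open>card Z \<le> 4 * n\<close>. The power \<open>- 6 * r\<close> of \<open>n\<close> absorbs
    it, because \<open>r \<ge> 1\<close>.\<close>
  also have "\<dots> = 4 * exp (3 * ln n) * exp (- 6 * r * (1 + ln n))"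
    using n by (simp add: exp_of_nat_mult[of 3, simplified] power3_eq_cube algebra_simps flip: exp_add)
  also have "\<dots> \<le> 4 * exp (- 6 * r)"
  proof -
    have "3 * ln (real n) \<le> 6 * r * ln n" using r n by (intro mult_right_mono) auto
    then have "3 * ln (real n) + - 6 * r * (1 + ln n) \<le> - 6 * r" by (simp add: algebra_simps)
    then show ?thesis by (simp flip: exp_add)
  qed
  also have "\<dots> \<le> exp (- r) / 2"
  proof -
    have "(8::real) \<le> 2 ^ 5" by simp
    also have "\<dots> \<le> exp 1 ^ 5" using exp_ge_add_one_self[of 1] by (intro power_mono) auto
    also have "\<dots> = exp 5" by (simp flip: exp_of_nat_mult)
    also have "\<dots> \<le> exp (5 * r)" using r by simp
    finally have "8 * exp (- 6 * r) \<le> exp (5 * r) * exp (- 6 * r)" by (intro mult_right_mono) auto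
    also have "\<dots> = exp (- r)" by (simp flip: exp_add)
    finally show ?thesis by simp
  qed
  finally show ?thesis .
qed

text \<open>After division by \<open>sqrt d\<close> the coefficients lie in \<open>[-1, 1]\<close>.
  Their squares weighted by \<open>p\<close> sum to at most
  \<open>(2 / n) * (5 * n)\<^sup>2 = 50 * n\<close>, so the threshold \<open>60 * n\<close> leaves
  \<open>10 * n\<close> in the exponent. The sign \<open>g\<close> covers both tails.\<close>

lemma light_pairs_tail:
  fixes m :: "nat \<Rightarrow> int" and g :: real
  assumes m: "(\<Sum>i<n. (m i)\<^sup>2) \<le> 5 * int n" and g: "\<bar>g\<bar> = 1"
  shows "measure_pmf.prob random_graph
     {x. g * light_form n d p x m \<ge> 60 * sqrt d * n} \<le> exp (- 10 * n)"
proof -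
  let ?c = "\<lambda>(i,j). if \<bar>real_of_int (m i) * real_of_int (m j)\<bar> \<le> sqrt d then g * (real_of_int (m i) * real_of_int (m j)) / sqrt d else 0"
  have sd: "sqrt d > 0" using d by simp
  have eq: "g * light_form n d p x m
     = sqrt d * (\<Sum>e\<in>pairs n. ?c e * (of_bool (x e) - p e))" for x
    unfolding light_form_def sum_distrib_left using sd by (intro sum.cong) auto
  have ev: "{x. g * light_form n d p x m \<ge> 60 * sqrt d * n} = {x. (\<Sum>e\<in>pairs n. ?c e * (of_bool (x e) - p e)) \<ge> 60 * n}"
    unfolding eq using sd by (auto simp: mult.assoc mult.left_commute[of 60])
  have "measure_pmf.prob random_graph {x. (\<Sum>e\<in>pairs n. ?c e * (of_bool (x e) - p e)) \<ge> 60 * n}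
     \<le> exp ((\<Sum>e\<in>pairs n. (?c e)\<^sup>2 * p e) - 60 * n)"
  proof (rule Pi_pmf_chernoff)
    fix e assume e: "e \<in> pairs n"
    have "\<bar>?c e\<bar> \<le> 1" using sd g by (auto simp: abs_mult split: prod.splits)
    then show "measure_pmf.expectation (bernoulli_pmf (p e)) (\<lambda>y. exp (?c e * (of_bool y - p e))) \<le> exp ((?c e)\<^sup>2 * p e)"
      using p[OF e] by (intro bernoulli_bernstein) auto
  qed simp
  also have "\<dots> \<le> exp (- 10 * n)"
  proof -
    let ?q = "\<lambda>i. (real_of_int (m i))\<^sup>2"
    have "(\<Sum>e\<in>pairs n. (?c e)\<^sup>2 * p e) \<le> (\<Sum>e\<in>pairs n. (2 / n) * (case e of (i,j) \<Rightarrow> ?q i * ?q j))"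
    proof (rule sum_mono)
      fix e assume e: "e \<in> pairs n"
      obtain i j where ij: "e = (i,j)" by fastforce
      have g2: "g\<^sup>2 = 1" using g by (simp add: abs_square_eq_1)
      have "(?c e)\<^sup>2 \<le> ?q i * ?q j / d"
        using d g2 by (auto simp: ij power_mult_distrib power_divide)
      then have "(?c e)\<^sup>2 * p e \<le> (?q i * ?q j / d) * (2 * d / n)"
        using p[OF e] d by (intro mult_mono) auto
      also have "\<dots> = (2 / n) * (?q i * ?q j)" using d by simp
      finally show "(?c e)\<^sup>2 * p e \<le> (2 / n) * (case e of (i,j) \<Rightarrow> ?q i * ?q j)" by (simp add: ij)
    qed
    also have "\<dots> = (2 / n) * (\<Sum>(i,j)\<in>pairs n. ?q i * ?q j)" by (simp add: sum_distrib_left)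
    also have "\<dots> \<le> (2 / n) * (\<Sum>i<n. ?q i)\<^sup>2"
      using n by (intro mult_left_mono sum_pairs_le_sum_prod) auto
    also have "\<dots> \<le> (2 / n) * (5 * n)\<^sup>2"
    proof -
      have "(\<Sum>i<n. ?q i) = real_of_int (\<Sum>i<n. (m i)\<^sup>2)" by simp
      also have "\<dots> \<le> real_of_int (5 * int n)" using m by (simp only: of_int_le_iff)
      finally have "(\<Sum>i<n. ?q i) \<le> 5 * real n" by simp
      then have "(\<Sum>i<n. ?q i)\<^sup>2 \<le> (5 * real n)\<^sup>2" by (intro power_mono) (auto intro: sum_nonneg)
      then show ?thesis using n by (intro mult_left_mono) auto
    qed
    also have "\<dots> = 50 * n" using n by (simp add: power2_eq_square)
    finally show ?thesis by simp
  qed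
  finally show ?thesis unfolding ev .
qed

text \<open>An exponential weight replaces a volume argument:
  \<open>\<bar>m i\<bar> \<le> (m i)\<^sup>2\<close> shows that each admissible vector has weight at
  least \<open>1\<close> once multiplied by \<open>exp (5 * n)\<close>, and the total weight
  factorises over coordinates, each contributing at most \<open>3 \<le> exp 2\<close>.\<close>

lemma card_int_vectors_le:
  "finite {m \<in> {..<n} \<rightarrow>\<^sub>E (UNIV :: int set). (\<Sum>i<n. (m i)\<^sup>2) \<le> 5 * int n}" (is "finite ?A")
  "real (card {m \<in> {..<n} \<rightarrow>\<^sub>E (UNIV :: int set). (\<Sum>i<n. (m i)\<^sup>2) \<le> 5 * int n}) \<le> exp (7 * n)"
proof -
  define V where "V = {- 5 * int n .. 5 * int n}"
  have sub: "?A \<subseteq> {..<n} \<rightarrow>\<^sub>E V"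
  proof
    fix m assume m: "m \<in> ?A"
    have "m i \<in> V" if i: "i < n" for i
    proof -
      have "\<bar>m i\<bar> \<le> (m i)\<^sup>2" by (rule int_abs_le_square)
      also have "\<dots> \<le> (\<Sum>i<n. (m i)\<^sup>2)" using i by (intro member_le_sum) auto
      also have "\<dots> \<le> 5 * int n" using m by simp
      finally show ?thesis unfolding V_def by auto
    qed
    then show "m \<in> {..<n} \<rightarrow>\<^sub>E V" using m by (auto simp: PiE_iff)
  qed
  have finV: "finite ({..<n} \<rightarrow>\<^sub>E V)" by (intro finite_PiE) (auto simp: V_def)
  then show fin: "finite ?A" using sub finite_subset by blast
  \<comment> \<open>The correction \<open>2 * exp (- real k)\<close> strengthens the bound
    \<open>3\<close> so that the induction closes; the step needs only
    \<open>exp 1 \<ge> 2\<close>.\<close>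
  have sumV: "(\<Sum>v\<in>{- int k..int k}. exp (- \<bar>real_of_int v\<bar>)) \<le> 3 - 2 * exp (- real k)" for k
  proof (induction k)
    case (Suc k)
    have "{- int (Suc k)..int (Suc k)} = insert (int (Suc k)) (insert (- int (Suc k)) {- int k..int k})" by auto
    then have "(\<Sum>v\<in>{- int (Suc k)..int (Suc k)}. exp (- \<bar>real_of_int v\<bar>))
       = 2 * exp (- real (Suc k)) + (\<Sum>v\<in>{- int k..int k}. exp (- \<bar>real_of_int v\<bar>))"
      by simp
    also have "\<dots> \<le> 2 * exp (- real (Suc k)) + (3 - 2 * exp (- real k))" using Suc by simp
    also have "\<dots> \<le> 3 - 2 * exp (- real (Suc k))"
    proof -
      have "2 * exp (- real (Suc k)) \<le> exp 1 * exp (- real (Suc k))"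
        using exp_ge_add_one_self[of 1] by (intro mult_right_mono) auto
      also have "\<dots> = exp (- real k)" by (simp flip: exp_add)
      finally show ?thesis by simp
    qed
    finally show ?case .
  qed simp
  have "real (card ?A) = (\<Sum>m\<in>?A. 1)" by simp
  also have "\<dots> \<le> (\<Sum>m\<in>?A. exp (5 * n) * (\<Prod>i<n. exp (- \<bar>real_of_int (m i)\<bar>)))"
  proof (rule sum_mono)
    fix m assume m: "m \<in> ?A"
    have "(\<Sum>i<n. \<bar>m i\<bar>) \<le> (\<Sum>i<n. (m i)\<^sup>2)"
      by (intro sum_mono int_abs_le_square)
    also have "\<dots> \<le> 5 * int n" using m by simp
    finally have "real_of_int (\<Sum>i<n. \<bar>m i\<bar>) \<le> real_of_int (5 * int n)" by (simp only: of_int_le_iff)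
    then have "0 \<le> 5 * n + (\<Sum>i<n. - \<bar>real_of_int (m i)\<bar>)" by (simp add: sum_negf)
    then have "1 \<le> exp (5 * n + (\<Sum>i<n. - \<bar>real_of_int (m i)\<bar>))" by simp
    then show "1 \<le> exp (5 * n) * (\<Prod>i<n. exp (- \<bar>real_of_int (m i)\<bar>))"
      by (simp add: exp_add exp_sum)
  qed
  also have "\<dots> \<le> (\<Sum>m\<in>{..<n} \<rightarrow>\<^sub>E V. exp (5 * n) * (\<Prod>i<n. exp (- \<bar>real_of_int (m i)\<bar>)))"
    using sub finV by (intro sum_mono2) (auto intro!: mult_nonneg_nonneg prod_nonneg)
  also have "\<dots> = exp (5 * n) * (\<Sum>v\<in>V. exp (- \<bar>real_of_int v\<bar>)) ^ n"
    unfolding sum_distrib_left[symmetric]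
    by (subst prod_sum_PiE[symmetric]) (auto simp: V_def)
  also have "\<dots> \<le> exp (5 * n) * exp 2 ^ n"
  proof (intro mult_left_mono power_mono)
    have "(\<Sum>v\<in>V. exp (- \<bar>real_of_int v\<bar>)) \<le> 3 - 2 * exp (- real (5 * n))"
      using sumV[of "5 * n"] by (simp add: V_def)
    also have "\<dots> \<le> 3" by simp
    also have "\<dots> \<le> exp (2::real)" using exp_ge_add_one_self[of 2] by simp
    finally show "(\<Sum>v\<in>V. exp (- \<bar>real_of_int v\<bar>)) \<le> exp 2" .
  qed (auto intro: sum_nonneg)
  also have "\<dots> = exp (7 * n)" by (simp flip: exp_of_nat_mult exp_add)
  finally show "real (card ?A) \<le> exp (7 * n)" .
qed

lemma prob_light_pairs:
  fixes r :: real
  assumes r: "r \<ge> 1" "r \<le> n"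
  shows "measure_pmf.prob random_graph
     {x. \<exists>m :: nat \<Rightarrow> int. (\<Sum>i<n. (m i)\<^sup>2) \<le> 5 * int n \<and>
       \<bar>light_form n d p x m\<bar> \<ge> 60 * sqrt d * n} \<le> exp (- r) / 2" (is "measure_pmf.prob _ ?B \<le> _")
proof -
  let ?A = "{m \<in> {..<n} \<rightarrow>\<^sub>E (UNIV :: int set). (\<Sum>i<n. (m i)\<^sup>2) \<le> 5 * int n}"
  define F where "F = (\<lambda>(m,g). {x. g * light_form n d p x m \<ge> 60 * sqrt d * n})"
  have "?B \<subseteq> (\<Union>z\<in>?A \<times> {1,-1}. F z)"
  proof
    fix x assume "x \<in> ?B"
    then have "\<exists>m. (\<Sum>i<n. (m i)\<^sup>2) \<le> 5 * int n \<and> \<bar>light_form n d p x m\<bar> \<ge> 60 * sqrt d * n"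
      unfolding mem_Collect_eq .
    then obtain m where m: "(\<Sum>i<n. (m i)\<^sup>2) \<le> 5 * int n" "\<bar>light_form n d p x m\<bar> \<ge> 60 * sqrt d * n" by blast
    \<comment> \<open>The form sees only indices below \<open>n\<close>. Restricting
      \<open>m\<close> brings it into the finite set over which the union bound runs.\<close>
    define m' where "m' = restrict m {..<n}"
    have "light_form n d p x m' = light_form n d p x m" unfolding light_form_def by (intro sum.cong) (auto simp: m'_def pairs_def)
    moreover have "m' \<in> ?A" using m by (auto simp: m'_def)
    moreover have "x \<in> F (m', 1) \<or> x \<in> F (m', -1)"
      using m(2) calculation(1) unfolding F_def by (simp add: abs_if split: if_splits)
    ultimately show "x \<in> (\<Union>z\<in>?A \<times> {1,-1}. F z)" by blast
  qed
  then have "measure_pmf.prob random_graph ?B \<le> measure_pmf.prob random_graph (\<Union>z\<in>?A \<times> {1,-1}. F z)"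
    by (intro measure_pmf.finite_measure_mono) auto
  also have "\<dots> \<le> (\<Sum>z\<in>?A \<times> {1,-1}. measure_pmf.prob random_graph (F z))"
    using card_int_vectors_le(1) by (intro measure_UNION_le) auto
  also have "\<dots> \<le> (\<Sum>z\<in>?A \<times> {1,-1::real}. exp (- 10 * n))"
  proof (rule sum_mono)
    fix z assume "z \<in> ?A \<times> {1,-1::real}"
    then obtain m g where "z = (m,g)" "(\<Sum>i<n. (m i)\<^sup>2) \<le> 5 * int n" "\<bar>g\<bar> = 1" by auto
    then show "measure_pmf.prob random_graph (F z) \<le> exp (- 10 * n)"
      using light_pairs_tail[of m g] unfolding F_def by simp
  qed
  also have "\<dots> = 2 * card ?A * exp (- 10 * n)" by (simp add: card_cartesian_product)
  also have "\<dots> \<le> 2 * exp (7 * n) * exp (- 10 * n)"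
    using card_int_vectors_le(2) by (intro mult_right_mono mult_left_mono) auto
  \<comment> \<open>Of the surplus \<open>3 * n\<close>, one \<open>n\<close> yields
    \<open>exp (- r)\<close> by \<open>r \<le> n\<close>; the remaining \<open>2 * n \<ge> 2\<close>
    beats the constants because \<open>exp 2 \<ge> 4\<close>.\<close>
  also have "\<dots> = 2 * exp (- 2 * n) * exp (- real n)" by (simp flip: exp_add)
  also have "\<dots> \<le> 2 * exp (- 2) * exp (- r)" using r n by (intro mult_mono) auto
  also have "\<dots> \<le> exp (- r) / 2"
  proof -
    have "(4::real) = 2 ^ 2" by simp
    also have "\<dots> \<le> exp 1 ^ 2" using exp_ge_add_one_self[of 1] by (intro power_mono) auto
    also have "\<dots> = exp (2::real)" by (simp flip: exp_of_nat_mult)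
    finally show ?thesis by (simp add: exp_minus field_simps)
  qed
  finally show ?thesis .
qed

end

section \<open>Edges between dyadic level sets\<close>

lemma pairs_Suc: "pairs (Suc n) = pairs n \<union> (\<lambda>i. (i, n)) ` {..<n}"
  by (auto simp: pairs_def less_Suc_eq)

lemma sum_off_diagonal:
  fixes h :: "nat \<Rightarrow> nat \<Rightarrow> real"
  shows "(\<Sum>i<n. \<Sum>j<n. if i = j then 0 else h i j) = (\<Sum>(i,j)\<in>pairs n. h i j + h j i)"
proof (induction n)
  case (Suc n)
  have "pairs n \<inter> (\<lambda>i. (i, n)) ` {..<n} = {}" by (auto simp: pairs_def)
  then have "(\<Sum>(i,j)\<in>pairs (Suc n). h i j + h j i)
     = (\<Sum>(i,j)\<in>pairs n. h i j + h j i) + (\<Sum>i<n. h i n + h n i)"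
    unfolding pairs_Suc by (subst sum.union_disjoint) (auto simp: sum.reindex inj_on_def)
  also have "(\<Sum>i<n. h i n + h n i) = (\<Sum>i<n. if i = n then 0 else h i n) + (\<Sum>j<n. if n = j then 0 else h n j)"
    unfolding sum.distrib[symmetric] by (intro sum.cong) auto
  finally show ?case using Suc by (simp add: sum.distrib)
qed (simp add: pairs_def)

definition adj :: "(nat \<times> nat \<Rightarrow> bool) \<Rightarrow> nat \<Rightarrow> nat \<Rightarrow> real" where
  "adj G i j = (if i = j then 0 else of_bool (G (min i j, max i j)))"

definition vertex_degree :: "nat \<Rightarrow> (nat \<times> nat \<Rightarrow> bool) \<Rightarrow> nat \<Rightarrow> real" where
  "vertex_degree n G i = (\<Sum>j<n. adj G i j)"

lemma vertex_degree_nonneg: "vertex_degree n G i \<ge> 0"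
  unfolding vertex_degree_def adj_def by (intro sum_nonneg) auto

lemma sum_degree_mult: "(\<Sum>i<n. vertex_degree n G i * f i) = (\<Sum>(i,j)\<in>pairs n. of_bool (G (i,j)) * (f i + f j))"
proof -
  have "(\<Sum>i<n. vertex_degree n G i * f i) = (\<Sum>i<n. \<Sum>j<n. if i = j then 0 else of_bool (G (min i j, max i j)) * f i)"
    unfolding vertex_degree_def adj_def sum_distrib_right by (intro sum.cong) auto
  also have "\<dots> = (\<Sum>(i,j)\<in>pairs n. of_bool (G (i,j)) * (f i + f j))"
    unfolding sum_off_diagonal by (intro sum.cong) (auto simp: pairs_def algebra_simps min_def max_def)
  finally show ?thesis .
qed

section \<open>Summation over dyadic levels\<close>

lemma sum_geometric_le_4:
  assumes "finite F"
  shows "(\<Sum>j\<in>F. sqrt (1/2) ^ j) \<le> 4"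
proof -
  have c: "sqrt (1/2) \<le> 3/4" by (rule real_le_lsqrt) (auto simp: power2_eq_square)
  have "(\<Sum>j\<in>F. sqrt (1/2) ^ j) \<le> (\<Sum>j. sqrt (1/2) ^ j)"
    using assms c by (intro sum_le_suminf summable_geometric) auto
  also have "\<dots> = 1 / (1 - sqrt (1/2))" using c by (intro suminf_geometric) auto
  also have "\<dots> \<le> 4" using c by (simp add: field_simps)
  finally show ?thesis .
qed

lemma sqrt_half_power: "sqrt (1/2) ^ k = 1 / sqrt (2 ^ k)"
  by (simp add: real_sqrt_divide power_divide real_sqrt_power)

text \<open>Comparison with the least power of two above \<open>X\<close> leaves a geometric series
  of ratio \<open>sqrt (1/2)\<close>, whatever \<open>X\<close> and \<open>F\<close> are.\<close>

lemma sum_dyadic_above: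
  fixes X :: real
  assumes "finite F" "X > 0"
  shows "(\<Sum>k\<in>{k\<in>F. X \<le> 2 ^ k}. sqrt (X / 2 ^ k)) \<le> 4"
proof (cases "{k\<in>F. X \<le> 2 ^ k} = {}")
  case False
  let ?F = "{k\<in>F. X \<le> 2 ^ k}"
  define m where "m = (LEAST k. X \<le> 2 ^ k)"
  obtain k where "X \<le> 2 ^ k" using False by auto
  then have m: "X \<le> 2 ^ m" unfolding m_def by (rule LeastI)
  have mk: "m \<le> k" if "k \<in> ?F" for k using that unfolding m_def by (auto intro: Least_le)
  have X: "X \<le> 2 ^ m" using m by simp
  have "sqrt (X / 2 ^ k) \<le> sqrt (1/2) ^ (k - m)" if "k \<in> ?F" for k
  proof -
    have "X / 2 ^ k \<le> 2 ^ m / 2 ^ k" using X by (intro divide_right_mono) auto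
    also have "\<dots> = 1 / 2 ^ (k - m)" using mk[OF that] by (simp add: power_diff)
    finally show ?thesis unfolding sqrt_half_power using real_sqrt_le_mono by (fastforce simp: real_sqrt_divide)
  qed
  then have "(\<Sum>k\<in>?F. sqrt (X / 2 ^ k)) \<le> (\<Sum>k\<in>?F. sqrt (1/2) ^ (k - m))" by (rule sum_mono)
  also have "\<dots> = (\<Sum>j\<in>(\<lambda>k. k - m) ` ?F. sqrt (1/2) ^ j)"
    using mk by (subst sum.reindex) (auto simp: inj_on_def, metis eq_diff_iff)
  also have "\<dots> \<le> 4" using assms(1) by (intro sum_geometric_le_4) auto
  finally show ?thesis .
next
  case True
  show ?thesis unfolding True by simp
qed

lemma sum_dyadic_below:
  fixes X :: real
  assumes "finite F" "X > 0"
  shows "(\<Sum>k\<in>{k\<in>F. 2 ^ k \<le> X}. sqrt (2 ^ k / X)) \<le> 4"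
proof (cases "{k\<in>F. 2 ^ k \<le> X} = {}")
  case False
  let ?F = "{k\<in>F. 2 ^ k \<le> X}"
  define m where "m = Max ?F"
  have fin: "finite ?F" using assms(1) by auto
  have "m \<in> ?F" unfolding m_def using fin False by (rule Max_in)
  then have X: "2 ^ m \<le> X" by simp
  have mk: "k \<le> m" if "k \<in> ?F" for k using fin that unfolding m_def by (rule Max_ge)
  have "sqrt (2 ^ k / X) \<le> sqrt (1/2) ^ (m - k)" if "k \<in> ?F" for k
  proof -
    have "2 ^ k / X \<le> 2 ^ k / 2 ^ m" using X assms(2) by (intro divide_left_mono) auto
    also have "\<dots> = 1 / 2 ^ (m - k)" using mk[OF that] by (simp add: power_diff)
    finally show ?thesis unfolding sqrt_half_power using real_sqrt_le_mono by (fastforce simp: real_sqrt_divide)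
  qed
  then have "(\<Sum>k\<in>?F. sqrt (2 ^ k / X)) \<le> (\<Sum>k\<in>?F. sqrt (1/2) ^ (m - k))" by (rule sum_mono)
  also have "\<dots> = (\<Sum>j\<in>(\<lambda>k. m - k) ` ?F. sqrt (1/2) ^ j)"
    using mk by (subst sum.reindex) (auto simp: inj_on_def, metis diff_diff_cancel)
  also have "\<dots> \<le> 4" using assms(1) by (intro sum_geometric_le_4) auto
  finally show ?thesis .
next
  case True
  show ?thesis unfolding True by simp
qed

lemma ln_2_ge_half: "ln (2::real) \<ge> 1/2"
proof -
  have "exp (1/2::real) ^ 2 = exp 1" by (simp flip: exp_of_nat_mult)
  also have "\<dots> \<le> 3" by (rule exp_le)
  also have "\<dots> \<le> (2::real) ^ 2" by simp
  finally have "exp (1/2::real) \<le> 2" by (rule power2_le_imp_le) simp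
  then show ?thesis by (subst ln_ge_iff) auto
qed

text \<open>
  The entropy of a level set of relative mass \<open>al = 4^k p / n\<close>. Masses below \<open>2^-k\<close> would
  contribute a logarithm; they are replaced by \<open>2^-k\<close>, which is summable in \<open>k\<close>.
\<close>

lemma subset_entropy_level:
  fixes k n p :: nat
  assumes n: "n > 0" and p: "p \<ge> 1"
  defines "al \<equiv> 4 ^ k * real p / n"
  shows "subset_entropy n p \<le> n / 4 ^ k * (1 + 3 * k) * (al + 1 / 2 ^ k)"
proof -
  have al: "al > 0" unfolding al_def using n p by simp
  have pe: "real p = n / 4 ^ k * al" unfolding al_def using n by simp
  have "exp 1 * real n / p = exp 1 * 4 ^ k * (1 / al)" unfolding al_def using n p by simp
  also have "ln \<dots> = 1 + k * ln 4 - ln al" using al by (simp add: ln_mult ln_div ln_realpow)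
  finally have H: "subset_entropy n p = n / 4 ^ k * (al * (1 + k * ln 4 - ln al))"
    unfolding subset_entropy_def by (subst pe) simp
  have "ln (1 / (2 ^ k * al)) \<le> 1 / (2 ^ k * al) - 1" using al by (intro ln_le_minus_one) auto
  also have "\<dots> \<le> 1 / (2 ^ k * al)" by simp
  finally have "- k * ln 2 - ln al \<le> 1 / (2 ^ k * al)" using al by (simp add: ln_div ln_mult ln_realpow)
  then have "al * (- k * ln 2 - ln al) \<le> al * (1 / (2 ^ k * al))" using al by (intro mult_left_mono) auto
  then have *: "al * (- ln al) \<le> 1 / 2 ^ k + al * k * ln 2" using al by (simp add: algebra_simps)
  have ln4: "ln (4::real) = 2 * ln 2" using ln_realpow[of 2 2] by simp
  have ln2: "ln (2::real) \<le> 1" using ln_le_minus_one[of 2] by simp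
  have "al * (1 + k * ln 4 - ln al) \<le> al * (1 + 3 * k * ln 2) + 1 / 2 ^ k"
    using * unfolding ln4 by (simp add: algebra_simps)
  also have "\<dots> \<le> al * (1 + 3 * k) + (1 + 3 * k) * (1 / 2 ^ k)"
    using al ln2 mult_left_mono[OF ln2, of "3 * real k"] by (intro add_mono mult_left_mono) (auto simp: field_simps)
  also have "\<dots> = (1 + 3 * k) * (al + 1 / 2 ^ k)" by (simp add: distrib_left mult.commute)
  finally have "n / 4 ^ k * (al * (1 + k * ln 4 - ln al)) \<le> n / 4 ^ k * ((1 + 3 * k) * (al + 1 / 2 ^ k))"
    by (intro mult_left_mono) auto
  then show ?thesis unfolding H by (simp only: mult.assoc)
qed

text \<open>Carries the entropy of the higher of two levels over to the factor belonging to the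
  lower one, so that both entropies share a prefactor.\<close>

lemma inverse_four_power_antimono:
  assumes "l \<le> k"
  shows "(1 + 3 * real k) / 4 ^ k \<le> (1 + 3 * real l) / 4 ^ l"
  using assms
proof (induction k rule: dec_induct)
  case (step m)
  have "(1 + 3 * real (Suc m)) / 4 ^ Suc m \<le> (4 * (1 + 3 * real m)) / 4 ^ Suc m"
    by (intro divide_right_mono) auto
  also have "\<dots> = (1 + 3 * real m) / 4 ^ m" by (simp add: field_simps)
  finally show ?case using step by simp
qed simp

text \<open>
  The levels \<open>2^k\<close> and \<open>2^l\<close> form heavy pairs if \<open>h \<ge> 1\<close> and have a ratio below \<open>sqrt d\<close>
  if \<open>q \<ge> 1\<close>. Both are geometric in \<open>k\<close> and in \<open>l\<close>, so the bound is summable over all pairs of levels.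
\<close>

lemma level_edges_bound:
  fixes d r X :: real and k l pk pl n :: nat
  assumes n: "n > 0" and d: "d > 0" and r: "r \<ge> 1" and lk: "l \<le> k" and pk: "pk \<ge> 1" and pl: "pl \<ge> 1"
  defines "h \<equiv> 2 ^ (k + l) / sqrt d" and "q \<equiv> sqrt d * 2 ^ l / 2 ^ k"
    and "ak \<equiv> 4 ^ k * real pk / n" and "al \<equiv> 4 ^ l * real pl / n"
  assumes ak5: "ak \<le> 5" and h1: "h \<ge> 1" and q1: "q \<ge> 1"
    and X: "X * ln (2 * sqrt h) \<le> 2 * d * pk * pl / n * (2 * sqrt h) + 4 * r * (subset_entropy n pk + subset_entropy n pl)"
  shows "2 ^ (k + l) * X \<le> 48 * r * sqrt d * n * ((ak + 1 / 2 ^ k) + (al + 1 / 2 ^ l)) * (1 / sqrt h + 1 / sqrt q)"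
proof -
  define T where "T = sqrt d * n / 2 ^ (k + l)"
  define M where "M = (ak + 1 / 2 ^ k) + (al + 1 / 2 ^ l)"
  define u where "u = 1 + ln h"
  have sd: "sqrt d > 0" "sqrt d * sqrt d = d" using d by auto
  have T: "T > 0" unfolding T_def using sd n by simp
  have a0: "ak \<ge> 0" "al \<ge> 0" unfolding ak_def al_def by auto
  have M: "M \<ge> 0" "al \<le> M" unfolding M_def using a0 by auto
  have u: "u \<ge> 1" unfolding u_def using h1 by simp
  \<comment> \<open>This identity removes the logarithmic factor of the entropy: \<open>l\<close> is
    at most \<open>ln h + ln q\<close>. The part with \<open>ln h\<close> goes into
    \<open>u\<close>, which is divided out at the end; the part with \<open>ln q\<close> is absorbed
    by \<open>sqrt q\<close>.\<close>
  have hq: "h * q = 4 ^ l" unfolding h_def q_def using sd by (simp add: power_add power_mult_distrib[symmetric])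
  \<comment> \<open>The factor \<open>2\<close> in the choice \<open>s = 2 * sqrt h\<close> keeps
    \<open>ln s\<close> away from zero even when \<open>h = 1\<close>.\<close>
  have lns: "ln (2 * sqrt h) \<ge> u / 2"
    unfolding u_def using h1 ln_2_ge_half by (simp add: ln_mult ln_sqrt)
  have "real l \<le> l * ln 4" using ln_2_ge_half ln_realpow[of 2 2] by (simp add: mult_le_cancel_left1)
  also have "\<dots> = ln (h * q)" unfolding hq by (simp add: ln_realpow)
  also have "\<dots> = ln h + ln q" using h1 q1 by (simp add: ln_mult)
  finally have "1 + 3 * real l \<le> 3 * (1 + ln h + ln q)" by simp
  also have "\<dots> \<le> 3 * (u * (1 + ln q))" unfolding u_def using h1 q1 by (simp add: algebra_simps)
  also have "\<dots> \<le> 3 * (u * (2 * sqrt q))"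
  proof -
    have "ln (sqrt q) \<le> sqrt q - 1" using q1 by (intro ln_le_minus_one) auto
    then have "1 + ln q \<le> 2 * sqrt q" using q1 by (simp add: ln_sqrt)
    then show ?thesis using u by (intro mult_left_mono) auto
  qed
  finally have l6: "1 + 3 * real l \<le> 6 * u * sqrt q" by simp
  have nl: "real n / 4 ^ l = T / q"
    unfolding T_def q_def using sd n by (simp add: field_simps power_add power_mult_distrib[symmetric])
  have Hk: "subset_entropy n pk \<le> n * ((1 + 3 * real l) / 4 ^ l) * (ak + 1 / 2 ^ k)"
  proof -
    have "subset_entropy n pk \<le> n * ((1 + 3 * real k) / 4 ^ k) * (ak + 1 / 2 ^ k)"
      using subset_entropy_level[OF n pk, of k] unfolding ak_def by simp
    also have "\<dots> \<le> n * ((1 + 3 * real l) / 4 ^ l) * (ak + 1 / 2 ^ k)"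
      using inverse_four_power_antimono[OF lk] a0 by (intro mult_right_mono mult_left_mono) auto
    finally show ?thesis .
  qed
  have Hl: "subset_entropy n pl \<le> n * ((1 + 3 * real l) / 4 ^ l) * (al + 1 / 2 ^ l)"
    using subset_entropy_level[OF n pl, of l] unfolding al_def by simp
  have "subset_entropy n pk + subset_entropy n pl \<le> (n / 4 ^ l) * (1 + 3 * real l) * M"
  proof -
    have c: "real n * ((1 + 3 * real l) / 4 ^ l) = (n / 4 ^ l) * (1 + 3 * real l)" by simp
    show ?thesis using add_mono[OF Hk[unfolded c] Hl[unfolded c]] unfolding M_def distrib_left[symmetric] .
  qed
  also have "\<dots> \<le> (T / q) * (6 * u * sqrt q) * M"
    unfolding nl using l6 M T q1 by (intro mult_right_mono mult_left_mono) auto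
  also have "\<dots> = 6 * u * T * M * (sqrt q / q)" by simp
  also have "sqrt q / q = 1 / sqrt q" using q1 real_div_sqrt[of q] by (simp add: field_simps)
  finally have "4 * r * (subset_entropy n pk + subset_entropy n pl) \<le> 4 * r * (6 * u * T * M * (1 / sqrt q))"
    using r by (intro mult_left_mono) auto
  then have y: "4 * r * (subset_entropy n pk + subset_entropy n pl) \<le> u * (24 * r * T * M * (1 / sqrt q))"
    by (simp add: mult_ac)
  have Th: "d * n / (4 ^ k * 4 ^ l) = T / h"
    unfolding T_def h_def using sd by (simp add: field_simps power_add power_mult_distrib[symmetric])
  have "2 * d * pk * pl / n * (2 * sqrt h) = 4 * (d * n / (4 ^ k * 4 ^ l)) * ak * al * sqrt h"
    unfolding ak_def al_def using n by (simp add: field_simps)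
  also have "\<dots> = 4 * T * ak * al * (sqrt h / h)" unfolding Th by simp
  also have "sqrt h / h = 1 / sqrt h" using h1 real_div_sqrt[of h] by (simp add: field_simps)
  \<comment> \<open>The bound \<open>ak \<le> 5\<close> makes the product of the two masses linear,
    which is what can be summed over levels.\<close>
  also have "4 * T * ak * al * (1 / sqrt h) \<le> 4 * T * 5 * M * (1 / sqrt h)"
    using T ak5 a0 M h1 by (intro mult_right_mono mult_mono mult_left_mono) auto
  also have "\<dots> \<le> u * (24 * r * T * M * (1 / sqrt h))"
  proof -
    have "1 * 20 \<le> u * (24 * r)" using u r by (intro mult_mono) auto
    then have "20 * (T * M * (1 / sqrt h)) \<le> (u * (24 * r)) * (T * M * (1 / sqrt h))"
      using T M h1 by (intro mult_right_mono) auto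
    then show ?thesis by (simp add: mult_ac)
  qed
  finally have x: "2 * d * pk * pl / n * (2 * sqrt h) \<le> u * (24 * r * T * M * (1 / sqrt h))" .
  define Y where "Y = 24 * r * T * M * (1 / sqrt h + 1 / sqrt q)"
  have Y: "Y \<ge> 0" unfolding Y_def using r T M h1 q1 by simp
  have XY: "X * ln (2 * sqrt h) \<le> u * Y" using X x y unfolding Y_def by (simp add: algebra_simps)
  have "X \<le> 2 * Y"
  proof (cases "X \<le> 0")
    case False
    then have "X * (u / 2) \<le> X * ln (2 * sqrt h)" using lns by (intro mult_left_mono) auto
    then have "X * (u / 2) \<le> u * Y" using XY by linarith
    then have "u * X \<le> u * (2 * Y)" by (simp add: mult_ac)
    then show ?thesis using u by simp
  qed (use Y in simp)
  then have "2 ^ (k + l) * X \<le> 2 ^ (k + l) * (2 * Y)" by simp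
  also have "\<dots> = 48 * r * (2 ^ (k + l) * T) * M * (1 / sqrt h + 1 / sqrt q)" unfolding Y_def by simp
  also have "2 ^ (k + l) * T = sqrt d * n" unfolding T_def by simp
  finally show ?thesis unfolding M_def by (simp add: mult_ac)
qed

lemma two_power_squared: "((2::real) ^ k)\<^sup>2 = 4 ^ k"
  by (simp add: power2_eq_square power_mult_distrib[symmetric])

text \<open>The constant is \<open>52 + 48 * 112\<close>. Very unbalanced pairs contribute
  \<open>52\<close> through \<open>dega\<close>; the level pairs in \<open>R\<close> contribute
  \<open>48\<close> from \<open>level_edges_bound\<close> times \<open>112 = 2 * 8 * 7\<close>,
  where \<open>7\<close> bounds the sum of \<open>b\<close> and \<open>8\<close> the sum of
  \<open>\<phi>\<close> in either index.\<close>

lemma heavy_edges_bound: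
  fixes a :: "nat \<Rightarrow> real" and d r :: real
  assumes n: "n > 0" and d: "d > 0" and r: "r \<ge> 1"
    and a: "\<And>i. i < n \<Longrightarrow> a i = 0 \<or> (\<exists>k. a i = 2 ^ k)"
    and a2: "(\<Sum>i<n. (a i)\<^sup>2) \<le> 5 * real n"
    and dega: "(\<Sum>i<n. vertex_degree n G i * (a i)\<^sup>2) \<le> 52 * real n * d"
    and disc: "\<And>I J t. I \<subseteq> {..<n} \<Longrightarrow> I \<noteq> {} \<Longrightarrow> J \<subseteq> {..<n} \<Longrightarrow> J \<noteq> {} \<Longrightarrow> t \<le> 2 * n \<Longrightarrow> sqrt d \<le> 2 ^ t \<Longrightarrow>
      few_edges n d r G (2 * sqrt (2 ^ t / sqrt d)) I J"
  shows "(\<Sum>(i,j)\<in>pairs n. if a i * a j > sqrt d then of_bool (G (i,j)) * (a i * a j) else 0) \<le> 5428 * r * sqrt d * n"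
proof -
  have sd: "sqrt d > 0" "sqrt d * sqrt d = d" using d by auto
  have a0: "a i \<ge> 0" if "i < n" for i using a[OF that] by auto
  define Lv where "Lv = (\<lambda>k::nat. {i. i < n \<and> a i = 2 ^ k})"
  define ak where "ak = (\<lambda>k. 4 ^ k * real (card (Lv k)) / n)"
  define b where "b = (\<lambda>k. ak k + 1 / 2 ^ k)"
  define \<phi> where "\<phi> = (\<lambda>k l :: nat. 1 / sqrt (2 ^ (k + l) / sqrt d) + 1 / sqrt (sqrt d * 2 ^ l / 2 ^ k))"
  define X where "X = (\<lambda>k l. \<Sum>e\<in>cross n (Lv k) (Lv l). of_bool (G e) :: real)"
  define R where "R = {(k,l). k \<le> n \<and> l \<le> k \<and> Lv k \<noteq> {} \<and> Lv l \<noteq> {} \<and> sqrt d \<le> 2 ^ (k + l) \<and> 2 ^ k \<le> sqrt d * 2 ^ l}"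
  have Rsub: "R \<subseteq> {..n} \<times> {..n}" unfolding R_def by auto
  have finR: "finite R" using Rsub by (rule finite_subset) auto
  have Lvsub: "Lv k \<subseteq> {..<n}" for k unfolding Lv_def by auto
  have finLv: "finite (Lv k)" for k using Lvsub finite_subset by blast
  have ak0: "ak k \<ge> 0" for k unfolding ak_def by simp
  have b0: "b k \<ge> 0" for k unfolding b_def using ak0[of k] by simp
  have phi0: "\<phi> k l \<ge> 0" for k l unfolding \<phi>_def using sd by simp
  have sum_ak: "(\<Sum>k\<le>n. ak k) \<le> 5"
  proof -
    have "(\<Sum>k\<le>n. 4 ^ k * real (card (Lv k))) = (\<Sum>k\<le>n. \<Sum>i<n. if a i = 2 ^ k then (a i)\<^sup>2 else 0)"
    proof (rule sum.cong[OF refl])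
      fix k
      have "(\<Sum>i<n. if a i = 2 ^ k then (a i)\<^sup>2 else 0) = (\<Sum>i\<in>Lv k. (a i)\<^sup>2)"
        unfolding Lv_def by (subst sum.inter_filter[symmetric]) (auto intro!: sum.cong)
      also have "\<dots> = (\<Sum>i\<in>Lv k. 4 ^ k)"
        by (intro sum.cong) (auto simp: Lv_def two_power_squared)
      finally show "4 ^ k * real (card (Lv k)) = (\<Sum>i<n. if a i = 2 ^ k then (a i)\<^sup>2 else 0)" by simp
    qed
    also have "\<dots> = (\<Sum>i<n. \<Sum>k\<le>n. if a i = 2 ^ k then (a i)\<^sup>2 else 0)" by (rule sum.swap)
    also have "\<dots> \<le> (\<Sum>i<n. (a i)\<^sup>2)"
    proof (rule sum_mono)
      fix i
      show "(\<Sum>k\<le>n. if a i = 2 ^ k then (a i)\<^sup>2 else 0) \<le> (a i)\<^sup>2"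
      proof (cases "\<exists>k. a i = 2 ^ k")
        case True
        then obtain k where k: "a i = 2 ^ k" by blast
        have "(\<Sum>k'\<le>n. if a i = 2 ^ k' then (a i)\<^sup>2 else 0) = (\<Sum>k'\<le>n. if k' = k then (a i)\<^sup>2 else 0)"
          unfolding k by (intro sum.cong) auto
        then show ?thesis by simp
      qed simp
    qed
    finally show ?thesis using a2 n unfolding ak_def by (simp flip: sum_divide_distrib add: field_simps)
  qed
  have ak5: "ak k \<le> 5" if "k \<le> n" for k
    using member_le_sum[of k "{..n}" ak] that ak0 sum_ak by auto
  have sum_b: "(\<Sum>k\<le>n. b k) \<le> 7"
  proof -
    have "(\<Sum>k\<le>n. 1 / 2 ^ k) = (\<Sum>k\<le>n. (1/2::real) ^ k)" by (simp add: power_divide)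
    also have "\<dots> \<le> (\<Sum>k. (1/2::real) ^ k)" by (intro sum_le_suminf summable_geometric) auto
    also have "\<dots> = 2" by (subst suminf_geometric) auto
    finally show ?thesis unfolding b_def sum.distrib using sum_ak by simp
  qed
  \<comment> \<open>By \<open>a2\<close> a level that occurs satisfies
    \<open>4 ^ k \<le> 5 * n\<close>, which forces \<open>k \<le> n\<close>; hence
    \<open>k + l \<le> 2 * n\<close>, the range of \<open>t\<close> in \<open>disc\<close>.\<close>
  have kn: "k \<le> n" if ne: "Lv k \<noteq> {}" for k
  proof (rule ccontr)
    assume "\<not> k \<le> n"
    obtain i where i: "i < n" "a i = 2 ^ k" using ne unfolding Lv_def by auto
    have pow: "5 * real m < 4 ^ Suc m" for m
    proof (induction m)
      case (Suc m)
      have "(1::real) \<le> 4 ^ m" by simp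
      then have "(5::real) \<le> 12 * 4 ^ m" by linarith
      then show ?case using Suc by simp
    qed simp
    have "5 * real n < 4 ^ Suc n" by (rule pow)
    also have "\<dots> \<le> 4 ^ k" using \<open>\<not> k \<le> n\<close> by (intro power_increasing) auto
    also have "\<dots> = (a i)\<^sup>2" unfolding i by (simp add: two_power_squared)
    also have "\<dots> \<le> (\<Sum>i<n. (a i)\<^sup>2)" using i by (intro member_le_sum) auto
    finally show False using a2 by simp
  qed
  have pointwise: "(if a i * a j > sqrt d then of_bool (G (i,j)) * (a i * a j) else 0)
     \<le> of_bool (G (i,j)) * ((a i)\<^sup>2 + (a j)\<^sup>2) / sqrt d
       + (\<Sum>(k,l)\<in>R. if (i,j) \<in> cross n (Lv k) (Lv l) then of_bool (G (i,j)) * 2 ^ (k + l) else 0)"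
    if ij: "(i,j) \<in> pairs n" for i j
  proof -
    let ?s = "\<Sum>(k,l)\<in>R. if (i,j) \<in> cross n (Lv k) (Lv l) then of_bool (G (i,j)) * 2 ^ (k + l) else (0::real)"
    have s0: "?s \<ge> 0" by (intro sum_nonneg) auto
    have u0: "of_bool (G (i,j)) * ((a i)\<^sup>2 + (a j)\<^sup>2) / sqrt d \<ge> 0" using sd by simp
    have lt: "i < n" "j < n" using ij by (auto simp: pairs_def)
    show ?thesis
    proof (cases "a i * a j > sqrt d \<and> G (i,j)")
      case False
      then show ?thesis using s0 u0 by auto
    next
      case True
      then have hv: "a i * a j > sqrt d" and G: "G (i,j)" by auto
      then have "a i \<noteq> 0" "a j \<noteq> 0" using sd by auto
      then obtain k l where kl: "a i = 2 ^ k" "a j = 2 ^ l" using a lt by metis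
      show ?thesis
      proof (cases "a i \<le> sqrt d * a j \<and> a j \<le> sqrt d * a i")
        case False
        \<comment> \<open>A ratio above \<open>sqrt d\<close> makes the product small compared with
          the larger square, so these pairs can be charged to the vertex degrees.\<close>
        have "sqrt d * (a i * a j) \<le> (a i)\<^sup>2 + (a j)\<^sup>2"
        proof (cases "a i \<le> sqrt d * a j")
          case True
          then have "sqrt d * a i \<le> a j" using False by auto
          then have "a j * (sqrt d * a i) \<le> a j * a j" using a0 lt by (intro mult_left_mono) auto
          then have "sqrt d * (a i * a j) \<le> (a j)\<^sup>2" by (simp add: power2_eq_square mult_ac)
          also have "\<dots> \<le> (a i)\<^sup>2 + (a j)\<^sup>2" by simp
          finally show ?thesis .
        next
          case False
          then have "a i * (sqrt d * a j) \<le> a i * a i" using a0 lt by (intro mult_left_mono) auto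
          then have "sqrt d * (a i * a j) \<le> (a i)\<^sup>2" by (simp add: power2_eq_square mult_ac)
          also have "\<dots> \<le> (a i)\<^sup>2 + (a j)\<^sup>2" by simp
          finally show ?thesis .
        qed
        then have "a i * a j \<le> ((a i)\<^sup>2 + (a j)\<^sup>2) / sqrt d" using sd by (simp add: field_simps)
        then show ?thesis using s0 hv G by simp
      next
        case True
        \<comment> \<open>The indices \<open>i < j\<close> need not order the levels, while
          \<open>R\<close> lists only pairs with \<open>l \<le> k\<close>; \<open>cross\<close> is
          symmetric in its two sets.\<close>
        define K L where "K = max k l" and "L = min k l"
        have KL: "K + L = k + l" unfolding K_def L_def by simp
        have i: "i \<in> Lv k" "j \<in> Lv l" using lt kl unfolding Lv_def by auto
        have "(K,L) \<in> R"
        proof -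
          have "sqrt d \<le> 2 ^ (K + L)" using hv kl unfolding KL by (simp add: power_add)
          moreover have "2 ^ K \<le> sqrt d * 2 ^ L" using True kl unfolding K_def L_def by (simp add: max_def min_def)
          moreover have "Lv K \<noteq> {}" "Lv L \<noteq> {}" using i unfolding K_def L_def max_def min_def by auto
          moreover have "K \<le> n" using kn \<open>Lv K \<noteq> {}\<close> by blast
          moreover have "L \<le> K" unfolding K_def L_def by simp
          ultimately show ?thesis unfolding R_def by simp
        qed
        moreover have "(i,j) \<in> cross n (Lv K) (Lv L)"
          using i ij unfolding cross_def K_def L_def max_def min_def by auto
        moreover have "(case (K,L) of (k,l) \<Rightarrow> if (i,j) \<in> cross n (Lv k) (Lv l) then of_bool (G (i,j)) * 2 ^ (k + l) else 0) \<le> ?s"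
          using \<open>(K,L) \<in> R\<close> finR by (intro member_le_sum) (auto simp del: of_bool_eq_1_iff split: if_splits)
        ultimately have "a i * a j \<le> ?s" using G kl KL by (simp add: power_add)
        then show ?thesis using hv G u0 by (simp del: of_bool_eq_1_iff)
      qed
    qed
  qed
  have level: "2 ^ (k + l) * X k l \<le> 48 * r * sqrt d * n * ((b k + b l) * \<phi> k l)" if "(k,l) \<in> R" for k l
  proof -
    have kl: "k \<le> n" "l \<le> k" "Lv k \<noteq> {}" "Lv l \<noteq> {}" "sqrt d \<le> 2 ^ (k + l)" "2 ^ k \<le> sqrt d * 2 ^ l"
      using that unfolding R_def by auto
    have c: "card (Lv k) \<ge> 1" "card (Lv l) \<ge> 1" using kl(3,4) finLv by (auto simp: Suc_le_eq card_gt_0_iff)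
    have "2 ^ (k + l) * X k l \<le> 48 * r * sqrt d * n * ((ak k + 1 / 2 ^ k) + (ak l + 1 / 2 ^ l)) * \<phi> k l"
      unfolding ak_def \<phi>_def
    proof (rule level_edges_bound[OF n d r kl(2) c])
      show "4 ^ k * real (card (Lv k)) / n \<le> 5" using ak5[OF kl(1)] unfolding ak_def .
      show "1 \<le> 2 ^ (k + l) / sqrt d" using kl(5) sd by simp
      show "1 \<le> sqrt d * 2 ^ l / 2 ^ k" using kl(6) by simp
      show "X k l * ln (2 * sqrt (2 ^ (k + l) / sqrt d))
         \<le> 2 * d * card (Lv k) * card (Lv l) / n * (2 * sqrt (2 ^ (k + l) / sqrt d)) +
            4 * r * (subset_entropy n (card (Lv k)) + subset_entropy n (card (Lv l)))"
        unfolding X_def using kl by (intro disc[unfolded few_edges_def] Lvsub) auto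
    qed
    then show ?thesis unfolding b_def by (simp add: mult.assoc)
  qed
  let ?cond = "\<lambda>k l :: nat. sqrt d \<le> 2 ^ (k + l) \<and> 2 ^ k \<le> sqrt d * 2 ^ l"
  \<comment> \<open>For fixed \<open>k\<close> both parts of \<open>\<phi>\<close> decay
    geometrically in \<open>l\<close> beyond a threshold. In \<open>inner2\<close> the second part
    grows in \<open>k\<close> up to its threshold instead, hence the sum from below.\<close>
  have inner1: "(\<Sum>l\<le>n. if ?cond k l then \<phi> k l else 0) \<le> 8" for k
  proof -
    let ?A = "{l\<in>{..n}. sqrt d / 2 ^ k \<le> 2 ^ l}" and ?B = "{l\<in>{..n}. 2 ^ k / sqrt d \<le> 2 ^ l}"
    have "(\<Sum>l\<le>n. if ?cond k l then \<phi> k l else 0)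
       \<le> (\<Sum>l\<le>n. (if sqrt d / 2 ^ k \<le> 2 ^ l then sqrt (sqrt d / 2 ^ k / 2 ^ l) else 0) + (if 2 ^ k / sqrt d \<le> 2 ^ l then sqrt (2 ^ k / sqrt d / 2 ^ l) else 0))"
      using sd by (intro sum_mono) (auto simp: \<phi>_def power_add field_simps real_sqrt_divide real_sqrt_mult)
    also have "\<dots> = (\<Sum>l\<in>?A. sqrt (sqrt d / 2 ^ k / 2 ^ l)) + (\<Sum>l\<in>?B. sqrt (2 ^ k / sqrt d / 2 ^ l))"
      by (simp only: sum.distrib sum.inter_filter[OF finite_atMost])
    also have "\<dots> \<le> 4 + 4" using sd by (intro add_mono sum_dyadic_above) auto
    finally show ?thesis by simp
  qed
  have inner2: "(\<Sum>k\<le>n. if ?cond k l then \<phi> k l else 0) \<le> 8" for l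
  proof -
    let ?A = "{k\<in>{..n}. sqrt d / 2 ^ l \<le> 2 ^ k}" and ?B = "{k\<in>{..n}. 2 ^ k \<le> sqrt d * 2 ^ l}"
    have "(\<Sum>k\<le>n. if ?cond k l then \<phi> k l else 0)
       \<le> (\<Sum>k\<le>n. (if sqrt d / 2 ^ l \<le> 2 ^ k then sqrt (sqrt d / 2 ^ l / 2 ^ k) else 0) + (if 2 ^ k \<le> sqrt d * 2 ^ l then sqrt (2 ^ k / (sqrt d * 2 ^ l)) else 0))"
      using sd by (intro sum_mono) (auto simp: \<phi>_def power_add field_simps real_sqrt_divide real_sqrt_mult)
    also have "\<dots> = (\<Sum>k\<in>?A. sqrt (sqrt d / 2 ^ l / 2 ^ k)) + (\<Sum>k\<in>?B. sqrt (2 ^ k / (sqrt d * 2 ^ l)))"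
      by (simp only: sum.distrib sum.inter_filter[OF finite_atMost])
    also have "\<dots> \<le> 4 + 4" using sd by (intro add_mono sum_dyadic_above sum_dyadic_below) auto
    finally show ?thesis by simp
  qed
  have sumR: "(\<Sum>(k,l)\<in>R. (b k + b l) * \<phi> k l) \<le> 112"
  proof -
    have "(\<Sum>(k,l)\<in>R. (b k + b l) * \<phi> k l) = (\<Sum>(k,l)\<in>R. if ?cond k l then (b k + b l) * \<phi> k l else 0)"
      by (intro sum.cong) (auto simp: R_def)
    also have "\<dots> \<le> (\<Sum>(k,l)\<in>{..n} \<times> {..n}. if ?cond k l then (b k + b l) * \<phi> k l else 0)"
      using Rsub b0 phi0 by (intro sum_mono2) (auto intro!: mult_nonneg_nonneg add_nonneg_nonneg)
    also have "\<dots> = (\<Sum>k\<le>n. \<Sum>l\<le>n. if ?cond k l then (b k + b l) * \<phi> k l else 0)"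
      by (simp add: sum.cartesian_product)
    also have "\<dots> = (\<Sum>k\<le>n. \<Sum>l\<le>n. b k * (if ?cond k l then \<phi> k l else 0)) + (\<Sum>k\<le>n. \<Sum>l\<le>n. b l * (if ?cond k l then \<phi> k l else 0))"
      unfolding sum.distrib[symmetric] by (intro sum.cong) (auto simp: algebra_simps)
    also have "(\<Sum>k\<le>n. \<Sum>l\<le>n. b l * (if ?cond k l then \<phi> k l else 0)) = (\<Sum>l\<le>n. \<Sum>k\<le>n. b l * (if ?cond k l then \<phi> k l else 0))"
      by (rule sum.swap)
    also have "(\<Sum>k\<le>n. \<Sum>l\<le>n. b k * (if ?cond k l then \<phi> k l else 0)) + \<dots> \<le> (\<Sum>k\<le>n. b k * 8) + (\<Sum>l\<le>n. b l * 8)"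
      unfolding sum_distrib_left[symmetric] using inner1 inner2 b0
      by (intro add_mono sum_mono mult_left_mono) auto
    also have "\<dots> \<le> 112" using sum_b by (simp flip: sum_distrib_right)
    finally show ?thesis .
  qed
  have "(\<Sum>(i,j)\<in>pairs n. if a i * a j > sqrt d then of_bool (G (i,j)) * (a i * a j) else 0)
     \<le> (\<Sum>(i,j)\<in>pairs n. of_bool (G (i,j)) * ((a i)\<^sup>2 + (a j)\<^sup>2) / sqrt d
       + (\<Sum>(k,l)\<in>R. if (i,j) \<in> cross n (Lv k) (Lv l) then of_bool (G (i,j)) * 2 ^ (k + l) else 0))"
    using pointwise by (intro sum_mono) auto
  also have "\<dots> = (\<Sum>(i,j)\<in>pairs n. of_bool (G (i,j)) * ((a i)\<^sup>2 + (a j)\<^sup>2) / sqrt d)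
       + (\<Sum>e\<in>pairs n. \<Sum>z\<in>R. case z of (k,l) \<Rightarrow> if e \<in> cross n (Lv k) (Lv l) then of_bool (G e) * 2 ^ (k + l) else 0)"
    unfolding sum.distrib[symmetric] by (intro sum.cong) auto
  also have "(\<Sum>(i,j)\<in>pairs n. of_bool (G (i,j)) * ((a i)\<^sup>2 + (a j)\<^sup>2) / sqrt d) = (\<Sum>i<n. vertex_degree n G i * (a i)\<^sup>2) / sqrt d"
    unfolding sum_degree_mult sum_divide_distrib by (intro sum.cong) auto
  also have "\<dots> \<le> 52 * n * d / sqrt d" using dega sd by (intro divide_right_mono) auto
  also have "\<dots> = 52 * n * sqrt d" using sd d by (simp add: field_simps)
  also have "(\<Sum>e\<in>pairs n. \<Sum>z\<in>R. case z of (k,l) \<Rightarrow> if e \<in> cross n (Lv k) (Lv l) then of_bool (G e) * 2 ^ (k + l) else 0)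
     = (\<Sum>z\<in>R. \<Sum>e\<in>pairs n. case z of (k,l) \<Rightarrow> if e \<in> cross n (Lv k) (Lv l) then of_bool (G e) * 2 ^ (k + l) else 0)"
    by (rule sum.swap)
  also have "\<dots> \<le> (\<Sum>(k,l)\<in>R. 48 * r * sqrt d * n * ((b k + b l) * \<phi> k l))"
  proof (rule sum_mono)
    fix z assume z: "z \<in> R"
    obtain k l where zkl: "z = (k,l)" by fastforce
    have "cross n (Lv k) (Lv l) \<subseteq> pairs n" by (auto simp: cross_def)
    then have "(\<Sum>e\<in>pairs n. case z of (k,l) \<Rightarrow> if e \<in> cross n (Lv k) (Lv l) then of_bool (G e) * 2 ^ (k + l) else 0) = 2 ^ (k + l) * X k l"
      unfolding zkl X_def by (simp add: sum.If_cases Int_absorb1 sum_distrib_left mult.commute)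
    then show "(\<Sum>e\<in>pairs n. case z of (k,l) \<Rightarrow> if e \<in> cross n (Lv k) (Lv l) then of_bool (G e) * 2 ^ (k + l) else 0)
      \<le> (case z of (k,l) \<Rightarrow> 48 * r * sqrt d * n * ((b k + b l) * \<phi> k l))"
      using level z zkl by simp
  qed
  also have "\<dots> = 48 * r * sqrt d * n * (\<Sum>(k,l)\<in>R. (b k + b l) * \<phi> k l)"
    unfolding sum_distrib_left by (intro sum.cong) auto
  also have "\<dots> \<le> 48 * r * sqrt d * n * 112"
    using sumR r sd by (intro mult_left_mono) auto
  finally have "(\<Sum>(i,j)\<in>pairs n. if a i * a j > sqrt d then of_bool (G (i,j)) * (a i * a j) else 0)
     \<le> 52 * (1 * (n * sqrt d)) + 5376 * (r * (n * sqrt d))" by (simp add: mult_ac)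
  also have "\<dots> \<le> 52 * (r * (n * sqrt d)) + 5376 * (r * (n * sqrt d))"
    using r sd by (intro add_mono mult_left_mono mult_right_mono) auto
  finally show ?thesis by (simp add: mult_ac)
qed

section \<open>The degree-weighted bilinear inequality\<close>

text \<open>
  A quadratic form without diagonal terms is affine in each coordinate, so on a box it is largest at
  a corner. This replaces the usual net argument.
\<close>

lemma pairs_form_corner:
  fixes w :: "nat \<times> nat \<Rightarrow> real"
  assumes x: "\<And>i. i < n \<Longrightarrow> lo i \<le> x i \<and> x i \<le> hi i"
  shows "\<exists>m. (\<forall>i<n. m i = lo i \<or> m i = hi i) \<and>
     (\<Sum>(i,j)\<in>pairs n. w (i,j) * (x i * x j)) \<le> (\<Sum>(i,j)\<in>pairs n. w (i,j) * (m i * m j))"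
proof -
  let ?Q = "\<lambda>x. \<Sum>(i,j)\<in>pairs n. w (i,j) * (x i * x j)"
  have affine: "\<exists>A B. \<forall>t. ?Q (y(k := t)) = A + B * t" for y k
  proof -
    let ?A = "\<Sum>(i,j)\<in>pairs n. if i = k \<or> j = k then 0 else w (i,j) * (y i * y j)"
    let ?B = "\<Sum>(i,j)\<in>pairs n. if i = k then w (i,j) * y j else if j = k then w (i,j) * y i else 0"
    have "?Q (y(k := t)) = ?A + ?B * t" for t
      unfolding sum_distrib_right sum.distrib[symmetric] by (intro sum.cong) (auto simp: pairs_def)
    then show ?thesis by blast
  qed
  have "\<exists>m. (\<forall>i<k. m i = lo i \<or> m i = hi i) \<and> (\<forall>i\<ge>k. m i = x i) \<and> ?Q x \<le> ?Q m" if "k \<le> n" for k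
    using that
  proof (induction k)
    case 0
    then show ?case by (intro exI[of _ x]) auto
  next
    case (Suc k)
    then obtain m where m: "\<forall>i<k. m i = lo i \<or> m i = hi i" "\<forall>i\<ge>k. m i = x i" "?Q x \<le> ?Q m" by auto
    obtain A B where AB: "\<And>t. ?Q (m(k := t)) = A + B * t" using affine by blast
    have mk: "lo k \<le> m k" "m k \<le> hi k" using m(2) x[of k] Suc.prems by auto
    have Qm: "?Q m = A + B * m k" using AB[of "m k"] by simp
    have "\<exists>t. (t = lo k \<or> t = hi k) \<and> ?Q m \<le> ?Q (m(k := t))"
    proof (cases "B \<ge> 0")
      case True
      then show ?thesis unfolding AB Qm using mk by (intro exI[of _ "hi k"]) (auto intro: mult_left_mono)
    next
      case False
      then show ?thesis unfolding AB Qm using mk by (intro exI[of _ "lo k"]) (auto intro: mult_left_mono_neg)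
    qed
    then obtain t where "t = lo k \<or> t = hi k" "?Q m \<le> ?Q (m(k := t))" by blast
    then show ?case using m by (intro exI[of _ "m(k := t)"]) (auto simp: less_Suc_eq)
  qed
  then show ?thesis by blast
qed

definition dyadic :: "int set" where
  "dyadic = {v. v = 0 \<or> (\<exists>k. \<bar>v\<bar> = 2 ^ k)}"

text \<open>The bracket is \<open>[0, 1]\<close> for small nonnegative \<open>t\<close> and
  otherwise a pair of consecutive powers of two, up to sign. The summand \<open>1\<close> covers the
  former and the factor \<open>4\<close> the doubling in the latter; summed over coordinates this is
  the bound \<open>5 * n\<close> on the rounded vectors.\<close>

lemma dyadic_rounding:
  fixes t :: real
  shows "\<exists>lo\<in>dyadic. \<exists>hi\<in>dyadic. of_int lo \<le> t \<and> t \<le> of_int hi \<and> (of_int lo)\<^sup>2 \<le> 1 + 4 * t\<^sup>2 \<and> (of_int hi)\<^sup>2 \<le> 1 + 4 * t\<^sup>2"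
proof -
  have nonneg: "\<exists>lo\<in>dyadic. \<exists>hi\<in>dyadic. of_int lo \<le> t \<and> t \<le> of_int hi \<and> (of_int lo)\<^sup>2 \<le> 1 + 4 * t\<^sup>2 \<and> (of_int hi)\<^sup>2 \<le> 1 + 4 * t\<^sup>2"
    if t: "t \<ge> 0" for t :: real
  proof (cases "t < 1")
    case True
    have "(0::int) \<in> dyadic" "(1::int) \<in> dyadic" unfolding dyadic_def by (auto intro: exI[of _ 0])
    then show ?thesis using t True by (intro bexI[of _ 0] bexI[of _ 1]) auto
  next
    case False
    define k where "k = (LEAST k. t < 2 ^ k)"
    obtain k' where "t < 2 ^ k'" using real_arch_pow[of 2 t] by auto
    then have k: "t < 2 ^ k" unfolding k_def by (rule LeastI)
    have "k \<noteq> 0" using k False by (cases k) auto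
    then obtain l where l: "k = Suc l" using not0_implies_Suc by blast
    have "\<not> t < 2 ^ l" using not_less_Least[of l "\<lambda>k. t < 2 ^ k"] l unfolding k_def[symmetric] by auto
    then have tl: "2 ^ l \<le> t" by simp
    have "(2 ^ l)\<^sup>2 \<le> t\<^sup>2" using tl by (intro power_mono) auto
    moreover have "(2 ^ k)\<^sup>2 = 4 * (2 ^ l :: real)\<^sup>2" unfolding l by (simp add: power2_eq_square)
    moreover have "(2 ^ l :: int) \<in> dyadic" "(2 ^ k :: int) \<in> dyadic" unfolding dyadic_def by auto
    moreover have "t\<^sup>2 \<le> 1 + 4 * t\<^sup>2" using zero_le_power2[of t] by linarith
    ultimately have "(2 ^ l)\<^sup>2 \<le> 1 + 4 * t\<^sup>2" "(2 ^ k)\<^sup>2 \<le> 1 + 4 * t\<^sup>2" by linarith+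
    moreover have "(2 ^ l :: int) \<in> dyadic" "(2 ^ k :: int) \<in> dyadic" unfolding dyadic_def by auto
    ultimately have "real_of_int (2 ^ l) \<le> t \<and> t \<le> real_of_int (2 ^ k) \<and> (real_of_int (2 ^ l))\<^sup>2 \<le> 1 + 4 * t\<^sup>2 \<and> (real_of_int (2 ^ k))\<^sup>2 \<le> 1 + 4 * t\<^sup>2"
      "(2 ^ l :: int) \<in> dyadic" "(2 ^ k :: int) \<in> dyadic"
      using k tl by auto
    then show ?thesis by blast
  qed
  show ?thesis
  proof (cases "t \<ge> 0")
    case False
    then obtain lo hi where *: "lo \<in> dyadic" "hi \<in> dyadic" "of_int lo \<le> - t" "- t \<le> of_int hi"
      "(of_int lo)\<^sup>2 \<le> 1 + 4 * (- t)\<^sup>2" "(of_int hi)\<^sup>2 \<le> 1 + 4 * (- t)\<^sup>2" using nonneg[of "- t"] by auto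
    then have "- lo \<in> dyadic" "- hi \<in> dyadic" unfolding dyadic_def by auto
    then show ?thesis using * by (intro bexI[of _ "- hi"] bexI[of _ "- lo"]) auto
  qed (use nonneg in blast)
qed

definition weight :: "nat \<Rightarrow> real \<Rightarrow> (nat \<times> nat \<Rightarrow> bool) \<Rightarrow> (nat \<Rightarrow> real) \<Rightarrow> real" where
  "weight n d G x = (\<Sum>i<n. (vertex_degree n G i + d) * (x i)\<^sup>2)"

definition centred :: "(nat \<times> nat \<Rightarrow> real) \<Rightarrow> (nat \<times> nat \<Rightarrow> bool) \<Rightarrow> nat \<Rightarrow> nat \<Rightarrow> real" where
  "centred p G i j = (if i = j then 0 else of_bool (G (min i j, max i j)) - p (min i j, max i j))"

section \<open>Deterministic passage from the two events to the bilinear inequality\<close>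

context
  fixes n :: nat and d r :: real and p :: "nat \<times> nat \<Rightarrow> real" and G :: "nat \<times> nat \<Rightarrow> bool"
  assumes n: "n > 0" and d: "d > 0" and r: "r \<ge> 1" "r \<le> d"
    and p: "\<And>e. e \<in> pairs n \<Longrightarrow> 0 \<le> p e \<and> p e \<le> 2 * d / n"
    and light: "\<And>m :: nat \<Rightarrow> int. (\<Sum>i<n. (m i)\<^sup>2) \<le> 5 * int n \<Longrightarrow>
       \<bar>light_form n d p G m\<bar> \<le> 60 * sqrt d * n"
    and disc: "\<And>I J s. I \<subseteq> {..<n} \<Longrightarrow> I \<noteq> {} \<Longrightarrow> J \<subseteq> {..<n} \<Longrightarrow> J \<noteq> {} \<Longrightarrow>
      s = 2 \<or> (\<exists>t. t \<le> 2 * n \<and> sqrt d \<le> 2 ^ t \<and> s = 2 * sqrt (2 ^ t / sqrt d)) \<Longrightarrow>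
      few_edges n d r G s I J"
begin

text \<open>The edge count for \<open>I = J = {..<n}\<close> with \<open>s = 2\<close>. The entropy
  of the full set is \<open>n\<close>, so \<open>r \<le> d\<close> bounds the number of edges by
  \<open>24 * n * d\<close>.\<close>

lemma sum_degree_le: "(\<Sum>i<n. vertex_degree n G i) \<le> 48 * n * d"
proof -
  let ?X = "\<Sum>e\<in>pairs n. of_bool (G e) :: real"
  have "cross n {..<n} {..<n} = pairs n" by (auto simp: cross_def pairs_def)
  moreover have "subset_entropy n n = n" unfolding subset_entropy_def using n by simp
  ultimately have "?X * ln 2 \<le> 4 * n * d + 8 * r * n"
    using disc[of "{..<n}" "{..<n}" 2] n unfolding few_edges_def by (simp add: lessThan_empty_iff mult_ac)
  also have "\<dots> \<le> 4 * n * d + 8 * d * n" using r by (intro add_left_mono mult_right_mono) auto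
  finally have X: "?X * ln 2 \<le> 12 * n * d" by (simp add: mult_ac)
  have "?X * (1/2) \<le> ?X * ln 2" using ln_2_ge_half by (intro mult_left_mono) (auto intro: sum_nonneg)
  then have "2 * ?X \<le> 48 * n * d" using X by linarith
  moreover have "(\<Sum>i<n. vertex_degree n G i) = 2 * ?X"
    using sum_degree_mult[of n G "\<lambda>_. 1"] by (simp add: sum_distrib_left case_prod_unfold mult.commute)
  ultimately show ?thesis by simp
qed

text \<open>Three contributions: the light pairs, the edges on heavy pairs, and the expectation on
  heavy pairs. The last uses that a heavy product exceeds \<open>sqrt d\<close>, so it may be traded
  for its square; this gives
  \<open>(2 * sqrt d / n) * (5 * n)\<^sup>2 = 50 * sqrt d * n\<close>.\<close>

lemma centred_form_dyadic:
  assumes m: "\<And>i. i < n \<Longrightarrow> m i \<in> dyadic" and m2: "(\<Sum>i<n. (real_of_int (m i))\<^sup>2) \<le> 5 * real n"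
    and degm: "(\<Sum>i<n. vertex_degree n G i * (real_of_int (m i))\<^sup>2) \<le> 52 * real n * d" and g: "\<bar>g\<bar> = 1"
  shows "(\<Sum>(i,j)\<in>pairs n. (g * (of_bool (G (i,j)) - p (i,j))) * (real_of_int (m i) * real_of_int (m j))) \<le> 6000 * r * sqrt d * n"
proof -
  have sd: "sqrt d > 0" "sqrt d * sqrt d = d" using d by auto
  define a where "a = (\<lambda>i. \<bar>real_of_int (m i)\<bar>)"
  let ?mm = "\<lambda>i j. real_of_int (m i) * real_of_int (m j)"
  let ?light = "light_form n d p G m"
  let ?heavy = "\<Sum>(i,j)\<in>pairs n. if a i * a j > sqrt d then of_bool (G (i,j)) * (a i * a j) else 0"
  have "(\<Sum>i<n. (m i)\<^sup>2) \<le> 5 * int n"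
  proof -
    have "real_of_int (\<Sum>i<n. (m i)\<^sup>2) \<le> real_of_int (5 * int n)" using m2 by simp
    then show ?thesis by (simp only: of_int_le_iff)
  qed
  then have L: "\<bar>?light\<bar> \<le> 60 * sqrt d * n" by (rule light)
  have H: "?heavy \<le> 5428 * r * sqrt d * n"
  proof (rule heavy_edges_bound[OF n d r(1)])
    show "a i = 0 \<or> (\<exists>k. a i = 2 ^ k)" if "i < n" for i
    proof -
      have "m i = 0 \<or> (\<exists>k. \<bar>m i\<bar> = 2 ^ k)" using m[OF that] unfolding dyadic_def by simp
      then show ?thesis unfolding a_def by (metis abs_zero of_int_0 of_int_abs of_int_numeral of_int_power)
    qed
    show "(\<Sum>i<n. (a i)\<^sup>2) \<le> 5 * real n" "(\<Sum>i<n. vertex_degree n G i * (a i)\<^sup>2) \<le> 52 * real n * d"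
      using m2 degm unfolding a_def by auto
  qed (rule disc, auto)
  have pt: "(g * (of_bool (G (i,j)) - p (i,j))) * ?mm i j
     \<le> g * (if \<bar>?mm i j\<bar> \<le> sqrt d then (of_bool (G (i,j)) - p (i,j)) * ?mm i j else 0)
       + (if a i * a j > sqrt d then of_bool (G (i,j)) * (a i * a j) else 0)
       + 2 * sqrt d / n * ((a i)\<^sup>2 * (a j)\<^sup>2)" if ij: "(i,j) \<in> pairs n" for i j
  proof -
    have aa: "\<bar>?mm i j\<bar> = a i * a j" unfolding a_def by (simp add: abs_mult)
    have q0: "2 * sqrt d / n * ((a i)\<^sup>2 * (a j)\<^sup>2) \<ge> 0" using sd by simp
    show ?thesis
    proof (cases "\<bar>?mm i j\<bar> \<le> sqrt d")
      case True
      then show ?thesis using q0 unfolding aa by (simp add: mult.assoc)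
    next
      case False
      then have hv: "a i * a j > sqrt d" unfolding aa by simp
      have p0: "p (i,j) \<ge> 0" "p (i,j) \<le> 2 * d / n" using p[OF ij] by auto
      have "(g * (of_bool (G (i,j)) - p (i,j))) * ?mm i j \<le> \<bar>(g * (of_bool (G (i,j)) - p (i,j))) * ?mm i j\<bar>"
        by (rule abs_ge_self)
      also have "\<dots> = \<bar>of_bool (G (i,j)) - p (i,j)\<bar> * (a i * a j)" using g aa by (simp add: abs_mult)
      also have "\<dots> \<le> (of_bool (G (i,j)) + p (i,j)) * (a i * a j)"
        using p0 by (intro mult_right_mono) (auto simp: a_def)
      also have "p (i,j) * (a i * a j) \<le> (2 * d / n) * (a i * a j)"
        using p0 by (intro mult_right_mono) (auto simp: a_def)
      then have "(of_bool (G (i,j)) + p (i,j)) * (a i * a j) \<le> of_bool (G (i,j)) * (a i * a j) + (2 * d / n) * (a i * a j)"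
        by (simp add: distrib_right)
      also have "(2 * d / n) * (a i * a j) = (2 * sqrt d / n) * (sqrt d * (a i * a j))" using sd by simp
      also have "\<dots> \<le> (2 * sqrt d / n) * ((a i * a j) * (a i * a j))"
        using hv sd by (intro mult_left_mono mult_right_mono) (auto simp: a_def)
      finally show ?thesis using hv False unfolding aa by (simp add: power2_eq_square mult_ac)
    qed
  qed
  have "(\<Sum>(i,j)\<in>pairs n. (g * (of_bool (G (i,j)) - p (i,j))) * ?mm i j)
     \<le> (\<Sum>(i,j)\<in>pairs n. g * (if \<bar>?mm i j\<bar> \<le> sqrt d then (of_bool (G (i,j)) - p (i,j)) * ?mm i j else 0)
       + (if a i * a j > sqrt d then of_bool (G (i,j)) * (a i * a j) else 0)
       + 2 * sqrt d / n * ((a i)\<^sup>2 * (a j)\<^sup>2))"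
    using pt by (intro sum_mono) auto
  also have "\<dots> = g * ?light + ?heavy + 2 * sqrt d / n * (\<Sum>(i,j)\<in>pairs n. (a i)\<^sup>2 * (a j)\<^sup>2)"
    unfolding light_form_def sum_distrib_left sum.distrib[symmetric] by (intro sum.cong) auto
  also have "\<dots> \<le> 60 * sqrt d * n + 5428 * r * sqrt d * n + 2 * sqrt d / n * (5 * real n)\<^sup>2"
  proof (intro add_mono H mult_left_mono)
    have "g * ?light \<le> \<bar>g * ?light\<bar>" by (rule abs_ge_self)
    also have "\<dots> = \<bar>?light\<bar>" using g by (simp add: abs_mult)
    finally show "g * ?light \<le> 60 * sqrt d * n" using L by simp
    have "(\<Sum>(i,j)\<in>pairs n. (a i)\<^sup>2 * (a j)\<^sup>2) \<le> (\<Sum>i<n. (a i)\<^sup>2)\<^sup>2"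
      using sum_pairs_le_sum_prod[of "\<lambda>i. (a i)\<^sup>2"] by simp
    also have "\<dots> \<le> (5 * real n)\<^sup>2" using m2 unfolding a_def by (intro power_mono) (auto intro: sum_nonneg)
    finally show "(\<Sum>(i,j)\<in>pairs n. (a i)\<^sup>2 * (a j)\<^sup>2) \<le> (5 * real n)\<^sup>2" by simp
  qed (use sd in auto)
  also have "\<dots> = 110 * (1 * (sqrt d * n)) + 5428 * (r * (sqrt d * n))" using n by (simp add: power2_eq_square)
  also have "\<dots> \<le> 110 * (r * (sqrt d * n)) + 5428 * (r * (sqrt d * n))"
    using r sd by (intro add_mono mult_left_mono mult_right_mono) auto
  also have "\<dots> \<le> 6000 * (r * (sqrt d * n))" using r sd by simp
  finally show ?thesis by (simp add: mult_ac)
qed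

text \<open>Passing to a corner of the dyadic box can only increase the form. The price is
  \<open>n + 4 * n\<close> for the squares and \<open>48 * n * d + 4 * n * d\<close> for the
  degree-weighted squares, the additive \<open>1\<close> of the rounding being paid by
  \<open>sum_degree_le\<close>.\<close>

lemma centred_form_bounded:
  fixes x :: "nat \<Rightarrow> real"
  assumes x2: "(\<Sum>i<n. (x i)\<^sup>2) \<le> n" and degx: "(\<Sum>i<n. vertex_degree n G i * (x i)\<^sup>2) \<le> n * d" and g: "\<bar>g\<bar> = 1"
  shows "(\<Sum>(i,j)\<in>pairs n. (g * (of_bool (G (i,j)) - p (i,j))) * (x i * x j)) \<le> 6000 * r * sqrt d * n"
proof -
  obtain lo hi where lh: "\<And>i. lo i \<in> dyadic \<and> hi i \<in> dyadic \<and> of_int (lo i) \<le> x i \<and> x i \<le> of_int (hi i) \<and>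
     (of_int (lo i))\<^sup>2 \<le> 1 + 4 * (x i)\<^sup>2 \<and> (of_int (hi i))\<^sup>2 \<le> 1 + 4 * (x i)\<^sup>2"
    using dyadic_rounding[of "x _"] by metis
  obtain m0 where m0: "\<forall>i<n. m0 i = of_int (lo i) \<or> m0 i = of_int (hi i)"
     "(\<Sum>(i,j)\<in>pairs n. (g * (of_bool (G (i,j)) - p (i,j))) * (x i * x j))
        \<le> (\<Sum>(i,j)\<in>pairs n. (g * (of_bool (G (i,j)) - p (i,j))) * (m0 i * m0 j))"
    using pairs_form_corner[of n "\<lambda>i. of_int (lo i)" x "\<lambda>i. of_int (hi i)" "\<lambda>(i,j). g * (of_bool (G (i,j)) - p (i,j))"] lh
    by auto
  define m where "m = (\<lambda>i. if m0 i = of_int (lo i) then lo i else hi i)"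
  have mm0: "real_of_int (m i) = m0 i" if "i < n" for i using m0(1) that unfolding m_def by auto
  have dy: "m i \<in> dyadic" and m2: "(real_of_int (m i))\<^sup>2 \<le> 1 + 4 * (x i)\<^sup>2" for i
    using lh[of i] unfolding m_def by auto
  note m0(2)
  also have "(\<Sum>(i,j)\<in>pairs n. (g * (of_bool (G (i,j)) - p (i,j))) * (m0 i * m0 j))
     = (\<Sum>(i,j)\<in>pairs n. (g * (of_bool (G (i,j)) - p (i,j))) * (real_of_int (m i) * real_of_int (m j)))"
    by (intro sum.cong) (auto simp: pairs_def mm0)
  also have "\<dots> \<le> 6000 * r * sqrt d * n"
  proof (rule centred_form_dyadic[OF dy _ _ g])
    have "(\<Sum>i<n. (real_of_int (m i))\<^sup>2) \<le> (\<Sum>i<n. 1 + 4 * (x i)\<^sup>2)" by (intro sum_mono m2)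
    also have "\<dots> \<le> 5 * real n" using x2 by (simp add: sum.distrib flip: sum_distrib_left)
    finally show "(\<Sum>i<n. (real_of_int (m i))\<^sup>2) \<le> 5 * real n" .
    have "(\<Sum>i<n. vertex_degree n G i * (real_of_int (m i))\<^sup>2) \<le> (\<Sum>i<n. vertex_degree n G i * (1 + 4 * (x i)\<^sup>2))"
      by (intro sum_mono mult_left_mono m2 vertex_degree_nonneg)
    also have "\<dots> = (\<Sum>i<n. vertex_degree n G i) + 4 * (\<Sum>i<n. vertex_degree n G i * (x i)\<^sup>2)"
      unfolding sum_distrib_left sum.distrib[symmetric] by (intro sum.cong) (auto simp: algebra_simps)
    also have "\<dots> \<le> 48 * n * d + 4 * (n * d)" using sum_degree_le degx by (intro add_mono) auto
    finally show "(\<Sum>i<n. vertex_degree n G i * (real_of_int (m i))\<^sup>2) \<le> 52 * real n * d" by (simp add: mult_ac)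
  qed
  finally show ?thesis .
qed

lemma weight_nonneg: "weight n d G x \<ge> 0"
  unfolding weight_def using vertex_degree_nonneg[of n G] d by (intro sum_nonneg mult_nonneg_nonneg) (auto simp: add_nonneg_nonneg less_imp_le)

lemma weight_scale: "weight n d G (\<lambda>i. c * x i) = c\<^sup>2 * weight n d G x"
  unfolding weight_def sum_distrib_left by (intro sum.cong) (auto simp: power_mult_distrib)

lemma weight_eq_0: "weight n d G x = 0 \<Longrightarrow> i < n \<Longrightarrow> x i = 0"
proof -
  assume "weight n d G x = 0" "i < n"
  then have "(vertex_degree n G i + d) * (x i)\<^sup>2 = 0"
    unfolding weight_def using vertex_degree_nonneg[of n G] d by (subst (asm) sum_nonneg_eq_0_iff) (auto simp: add_nonneg_nonneg less_imp_le)
  moreover have "vertex_degree n G i + d > 0" using vertex_degree_nonneg[of n G i] d by simp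
  ultimately show "x i = 0" by simp
qed

text \<open>By homogeneity \<open>x\<close> may be scaled to weight \<open>n * d\<close>, which
  gives both hypotheses of \<open>centred_form_bounded\<close>. Unordered pairs account for the
  doubled constant.\<close>

lemma centred_quadratic:
  "\<bar>\<Sum>i<n. \<Sum>j<n. centred p G i j * x i * x j\<bar> \<le> 12000 * r / sqrt d * weight n d G x"
proof (cases "weight n d G x = 0")
  case True
  then show ?thesis using weight_eq_0[OF True] by simp
next
  case False
  then have w: "weight n d G x > 0" using weight_nonneg[of x] by simp
  define B where "B = (\<Sum>i<n. \<Sum>j<n. centred p G i j * x i * x j)"
  have sd: "sqrt d > 0" "sqrt d * sqrt d = d" using d by auto
  define c where "c = sqrt (n * d / weight n d G x)"
  have c2: "c\<^sup>2 = n * d / weight n d G x" unfolding c_def using n d w by simp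
  let ?y = "\<lambda>i. c * x i"
  have wy: "weight n d G ?y = n * d" unfolding weight_scale c2 using w by simp
  have split: "weight n d G ?y = (\<Sum>i<n. vertex_degree n G i * (?y i)\<^sup>2) + d * (\<Sum>i<n. (?y i)\<^sup>2)"
    unfolding weight_def sum_distrib_left sum.distrib[symmetric] by (intro sum.cong) (auto simp: algebra_simps)
  have nn: "(\<Sum>i<n. vertex_degree n G i * (?y i)\<^sup>2) \<ge> 0" "(\<Sum>i<n. (?y i)\<^sup>2) \<ge> 0"
    using vertex_degree_nonneg[of n G] by (auto intro!: sum_nonneg)
  have "d * (\<Sum>i<n. (?y i)\<^sup>2) \<le> d * n" using wy split nn by (simp add: mult.commute)
  then have y2: "(\<Sum>i<n. (?y i)\<^sup>2) \<le> n" using d by simp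
  have dy: "(\<Sum>i<n. vertex_degree n G i * (?y i)\<^sup>2) \<le> n * d" using wy split mult_nonneg_nonneg[OF less_imp_le[OF d] nn(2)] by linarith
  let ?q = "\<Sum>(i,j)\<in>pairs n. (of_bool (G (i,j)) - p (i,j)) * (?y i * ?y j)"
  have "g * ?q \<le> 6000 * r * sqrt d * n" if g: "\<bar>g\<bar> = 1" for g
    using centred_form_bounded[OF y2 dy g] by (simp only: sum_distrib_left case_prod_unfold mult.assoc)
  from this[of 1] this[of "-1"] have q: "\<bar>?q\<bar> \<le> 6000 * r * sqrt d * n" by simp
  have "B
     = (\<Sum>i<n. \<Sum>j<n. if i = j then 0 else (of_bool (G (min i j, max i j)) - p (min i j, max i j)) * x i * x j)"
    unfolding B_def centred_def by (intro sum.cong) auto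
  also have "\<dots> = 2 * (\<Sum>(i,j)\<in>pairs n. (of_bool (G (i,j)) - p (i,j)) * (x i * x j))"
    unfolding sum_off_diagonal sum_distrib_left by (intro sum.cong) (auto simp: pairs_def min_def max_def)
  finally have e: "c\<^sup>2 * B = 2 * ?q"
    by (simp add: sum_distrib_left power2_eq_square case_prod_unfold mult_ac)
  have "c\<^sup>2 * \<bar>B\<bar> = 2 * \<bar>?q\<bar>"
    using arg_cong[OF e, of abs] by (simp only: abs_mult abs_power2 abs_numeral)
  also have "\<dots> \<le> 12000 * r * sqrt d * n" using q by (simp add: mult_ac)
  finally have "n * d * \<bar>B\<bar> \<le> 12000 * r * sqrt d * n * weight n d G x"
    unfolding c2 using w by (simp add: field_simps)
  moreover have "(n * sqrt d) * (sqrt d * \<bar>B\<bar>)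
     = n * (sqrt d * sqrt d) * \<bar>B\<bar>" by (simp only: mult_ac)
  ultimately have "(n * sqrt d) * (sqrt d * \<bar>B\<bar>) \<le> (n * sqrt d) * (12000 * r * weight n d G x)"
    unfolding sd(2) by (simp only: mult_ac)
  then have "sqrt d * \<bar>B\<bar> \<le> 12000 * r * weight n d G x"
    using n sd by (simp only: mult_le_cancel_left) auto
  then show ?thesis unfolding B_def using sd by (simp add: field_simps)
qed

text \<open>Polarisation together with the parallelogram law for \<open>weight\<close> gives a bound
  by the sum of the weights; scaling both vectors to weight \<open>1\<close> turns it into one by
  the product of the norms.\<close>

lemma centred_bilinear:
  "\<bar>\<Sum>i<n. \<Sum>j<n. centred p G i j * x i * y j\<bar> \<le> 24000 * r / sqrt d * (sqrt (weight n d G x) * sqrt (weight n d G y))"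
proof -
  let ?K = "12000 * r / sqrt d"
  define B where "B = (\<lambda>x y. \<Sum>i<n. \<Sum>j<n. centred p G i j * x i * y j)"
  have K: "?K \<ge> 0" using r d by simp
  have comm: "B x y = B y x" for x y
  proof -
    have "B x y = (\<Sum>j<n. \<Sum>i<n. centred p G i j * x i * y j)" unfolding B_def by (rule sum.swap)
    also have "\<dots> = B y x" unfolding B_def
      by (intro sum.cong refl) (auto simp: centred_def min.commute max.commute mult_ac)
    finally show ?thesis .
  qed
  have pol: "\<bar>B x y\<bar> \<le> ?K * (weight n d G x + weight n d G y)" for x y
  proof -
    have "B (\<lambda>i. x i + y i) (\<lambda>i. x i + y i) - B (\<lambda>i. x i - y i) (\<lambda>i. x i - y i) = 2 * (B x y + B y x)"
      unfolding B_def sum_distrib_left sum.distrib[symmetric] sum_subtractf[symmetric]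
      by (intro sum.cong refl) (auto simp: algebra_simps)
    then have four: "4 * B x y = B (\<lambda>i. x i + y i) (\<lambda>i. x i + y i) - B (\<lambda>i. x i - y i) (\<lambda>i. x i - y i)"
      using comm[of x y] by simp
    have w: "weight n d G (\<lambda>i. x i + y i) + weight n d G (\<lambda>i. x i - y i) = 2 * weight n d G x + 2 * weight n d G y"
      unfolding weight_def sum_distrib_left sum.distrib[symmetric]
      by (intro sum.cong) (auto simp: power2_eq_square algebra_simps)
    have "4 * \<bar>B x y\<bar> \<le> \<bar>B (\<lambda>i. x i + y i) (\<lambda>i. x i + y i)\<bar> + \<bar>B (\<lambda>i. x i - y i) (\<lambda>i. x i - y i)\<bar>"
      using four by linarith
    also have "\<dots> \<le> ?K * weight n d G (\<lambda>i. x i + y i) + ?K * weight n d G (\<lambda>i. x i - y i)"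
      unfolding B_def by (intro add_mono centred_quadratic)
    also have "\<dots> = ?K * (2 * weight n d G x + 2 * weight n d G y)" unfolding distrib_left[symmetric] w ..
    also have "\<dots> = 2 * (?K * (weight n d G x + weight n d G y))" by (simp add: distrib_left)
    finally have "4 * \<bar>B x y\<bar> \<le> 2 * (?K * (weight n d G x + weight n d G y))" .
    moreover have "?K * (weight n d G x + weight n d G y) \<ge> 0" using K weight_nonneg by (intro mult_nonneg_nonneg add_nonneg_nonneg)
    ultimately show ?thesis by linarith
  qed
  have "\<bar>B x y\<bar> \<le> 2 * ?K * (sqrt (weight n d G x) * sqrt (weight n d G y))"
  proof (cases "weight n d G x = 0 \<or> weight n d G y = 0")
    case True
    then have "B x y = 0" unfolding B_def using weight_eq_0[of x] weight_eq_0[of y] by auto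
    moreover have "0 \<le> 2 * ?K * (sqrt (weight n d G x) * sqrt (weight n d G y))"
      using K weight_nonneg by (intro mult_nonneg_nonneg) auto
    ultimately show ?thesis by simp
  next
    case False
    then have w: "weight n d G x > 0" "weight n d G y > 0" using weight_nonneg[of x] weight_nonneg[of y] by auto
    let ?a = "1 / sqrt (weight n d G x)" and ?b = "1 / sqrt (weight n d G y)"
    have "\<bar>B (\<lambda>i. ?a * x i) (\<lambda>i. ?b * y i)\<bar> \<le> ?K * (weight n d G (\<lambda>i. ?a * x i) + weight n d G (\<lambda>i. ?b * y i))" by (rule pol)
    also have "\<dots> = ?K * 2" unfolding weight_scale using w by (simp add: power_divide)
    also have "B (\<lambda>i. ?a * x i) (\<lambda>i. ?b * y i) = ?a * ?b * B x y"
      unfolding B_def sum_distrib_left by (intro sum.cong refl) (simp add: mult_ac)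
    finally have "?a * ?b * \<bar>B x y\<bar> \<le> 2 * ?K" using w by (simp add: abs_mult)
    then show ?thesis using w by (simp add: field_simps)
  qed
  then show ?thesis unfolding B_def by simp
qed

end

lemma prob_centred_bilinear:
  fixes n :: nat and d r :: real and p :: "nat \<times> nat \<Rightarrow> real"
  assumes n: "n > 0" and d: "d > 0" and r: "r \<ge> 1" "r \<le> d" "r \<le> n"
    and p: "\<And>e. e \<in> pairs n \<Longrightarrow> 0 \<le> p e \<and> p e \<le> 1 \<and> p e \<le> 2 * d / n"
  shows "measure_pmf.prob (Pi_pmf (pairs n) False (\<lambda>e. bernoulli_pmf (p e)))
     {G. \<forall>x y. \<bar>\<Sum>i<n. \<Sum>j<n. centred p G i j * x i * y j\<bar>
            \<le> 24000 * r / sqrt d * (sqrt (weight n d G x) * sqrt (weight n d G y))} \<ge> 1 - exp (- r)"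
proof -
  let ?M = "Pi_pmf (pairs n) False (\<lambda>e. bernoulli_pmf (p e))"
  \<comment> \<open>The value \<open>2\<close> is for the total degree; \<open>t\<close> stands for
    the sum of two levels. There are at most \<open>2 * n + 2 \<le> 4 * n\<close> values in
    all.\<close>
  define Z where "Z = insert 2 ((\<lambda>t. 2 * sqrt (2 ^ t / sqrt d)) ` {t. t \<le> 2 * n \<and> sqrt d \<le> 2 ^ t})"
  have fin: "finite {t. t \<le> 2 * n \<and> sqrt d \<le> 2 ^ t}" by (rule finite_subset[of _ "{..2 * n}"]) auto
  have Z1: "finite Z" unfolding Z_def using fin by simp
  have Z2: "card Z \<le> 4 * n"
  proof -
    have "card Z \<le> Suc (card ((\<lambda>t. 2 * sqrt (2 ^ t / sqrt d)) ` {t. t \<le> 2 * n \<and> sqrt d \<le> 2 ^ t}))"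
      unfolding Z_def using fin by (intro card_insert_le_m1) auto
    also have "\<dots> \<le> Suc (card {t. t \<le> 2 * n \<and> sqrt d \<le> 2 ^ t})" using fin by (simp add: card_image_le)
    also have "\<dots> \<le> Suc (card {..2 * n})" by (simp only: Suc_le_mono) (intro card_mono, auto)
    finally show ?thesis using n by simp
  qed
  have Z3: "s \<ge> 1" if "s \<in> Z" for s
  proof -
    have "2 * sqrt (2 ^ t / sqrt d) \<ge> 1" if "sqrt d \<le> 2 ^ t" for t :: nat
    proof -
      have "1 \<le> sqrt (2 ^ t / sqrt d)" using that d by simp
      then show ?thesis by linarith
    qed
    then show ?thesis using that unfolding Z_def by auto
  qed
  let ?B1 = "{x. \<exists>I J s. I \<subseteq> {..<n} \<and> I \<noteq> {} \<and> J \<subseteq> {..<n} \<and> J \<noteq> {} \<and> s \<in> Z \<and> \<not> few_edges n d r x s I J}"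
  let ?B2 = "{x. \<exists>m :: nat \<Rightarrow> int. (\<Sum>i<n. (m i)\<^sup>2) \<le> 5 * int n \<and>
       \<bar>light_form n d p x m\<bar> \<ge> 60 * sqrt d * n}"
  let ?G = "{G. \<forall>x y. \<bar>\<Sum>i<n. \<Sum>j<n. centred p G i j * x i * y j\<bar>
            \<le> 24000 * r / sqrt d * (sqrt (weight n d G x) * sqrt (weight n d G y))}"
  have "- ?G \<subseteq> ?B1 \<union> ?B2"
  proof
    fix G assume G: "G \<in> - ?G"
    show "G \<in> ?B1 \<union> ?B2"
    proof (rule ccontr)
      assume neg: "G \<notin> ?B1 \<union> ?B2"
      have disc: "few_edges n d r G s I J"
        if "I \<subseteq> {..<n}" "I \<noteq> {}" "J \<subseteq> {..<n}" "J \<noteq> {}"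
          "s = 2 \<or> (\<exists>t. t \<le> 2 * n \<and> sqrt d \<le> 2 ^ t \<and> s = 2 * sqrt (2 ^ t / sqrt d))" for I J s
      proof -
        have "s \<in> Z" using that(5) unfolding Z_def by auto
        moreover have "G \<notin> ?B1" using neg by blast
        ultimately show ?thesis using that(1-4) by blast
      qed
      have light: "\<bar>light_form n d p G m\<bar> \<le> 60 * sqrt d * n" if "(\<Sum>i<n. (m i)\<^sup>2) \<le> 5 * int n" for m :: "nat \<Rightarrow> int"
      proof -
        have "G \<notin> ?B2" using neg by blast
        then have "\<not> (\<bar>light_form n d p G m\<bar> \<ge> 60 * sqrt d * n)" using that unfolding mem_Collect_eq by blast
        then show ?thesis by linarith
      qed
      have p': "0 \<le> p e \<and> p e \<le> 2 * d / n" if "e \<in> pairs n" for e using p[OF that] by simp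
      have "G \<in> ?G" using centred_bilinear[OF n d r(1,2) p' light disc] by simp
      then show False using G by blast
    qed
  qed
  then have "measure_pmf.prob ?M (- ?G) \<le> measure_pmf.prob ?M (?B1 \<union> ?B2)"
    by (intro measure_pmf.finite_measure_mono) auto
  also have "\<dots> \<le> measure_pmf.prob ?M ?B1 + measure_pmf.prob ?M ?B2"
    by (intro measure_Un_le) auto
  also have "\<dots> \<le> exp (- r) / 2 + exp (- r) / 2"
    by (intro add_mono prob_discrepancy[OF n d p r(1) Z1 Z2 Z3] prob_light_pairs[OF n d p r(1,3)]) auto
  finally have "measure_pmf.prob ?M (- ?G) \<le> exp (- r)" by simp
  moreover have "measure_pmf.prob ?M (- ?G) = 1 - measure_pmf.prob ?M ?G"
    using measure_pmf.prob_compl[of ?G ?M] by (simp add: Compl_eq_Diff_UNIV)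
  ultimately show ?thesis by simp
qed

section \<open>Perturbation of the sign vector\<close>

lemma abs_sum_mult_le_L2_set: "\<bar>\<Sum>i\<in>A. f i * g i\<bar> \<le> L2_set f A * L2_set g A"
proof -
  have "\<bar>\<Sum>i\<in>A. f i * g i\<bar> \<le> (\<Sum>i\<in>A. \<bar>f i\<bar> * \<bar>g i\<bar>)"
    using sum_abs[of "\<lambda>i. f i * g i" A] by (simp add: abs_mult)
  then show ?thesis using L2_set_mult_ineq[of f g A] by simp
qed

text \<open>The diagonal term in \<open>AW\<close> records that there are no loops, although the
  block formula has \<open>a / n\<close> there. The assumption \<open>1 \<le> \<omega> * d\<close>
  lets this bounded correction be absorbed into the noise, and
  \<open>44 * \<omega> * d \<le> \<delta>\<close> says that the signal dominates it.\<close>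

locale perturbed_sbm =
  fixes n :: nat and s :: "nat \<Rightarrow> real" and A W :: "nat \<Rightarrow> nat \<Rightarrow> real" and d \<delta> a \<omega> :: real
  assumes n: "n > 0" and s2: "\<And>i. i < n \<Longrightarrow> s i * s i = 1" and s0: "(\<Sum>i<n. s i) = 0"
    and A0: "\<And>i j. A i j \<ge> 0" and Asym: "\<And>i j. A i j = A j i"
    and AW: "\<And>i j. i < n \<Longrightarrow> j < n \<Longrightarrow> A i j = W i j + (d / n + \<delta> / n * (s i * s j)) - (if i = j then a / n else 0)"
    and a: "0 \<le> a" "a \<le> n" and \<delta>d: "\<delta> \<le> d" and \<omega>1: "1 \<le> \<omega> * d" and \<omega>\<delta>: "44 * \<omega> * d \<le> \<delta>"
    and W: "\<And>x y. \<bar>\<Sum>i<n. \<Sum>j<n. W i j * x i * y j\<bar> \<le> \<omega> *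
       (sqrt (\<Sum>i<n. ((\<Sum>j<n. A i j) + d) * (x i)\<^sup>2) * sqrt (\<Sum>i<n. ((\<Sum>j<n. A i j) + d) * (y i)\<^sup>2))"
    and d0: "d > 0" and \<omega>0: "\<omega> > 0"
begin

definition "\<tau> = (\<Sum>i<n. \<Sum>j<n. A i j) / n"

definition "D i = (\<Sum>j<n. A i j) + \<tau>"

definition "N x = L2_set (\<lambda>i. sqrt (D i) * x i) {..<n}"

text \<open>The expected degree; it is not \<open>d\<close> because there are no loops.\<close>

definition "dm = d - a / n"

lemma \<omega>_small: "44 * \<omega> \<le> 1" and d_large: "44 \<le> d"
proof -
  have "44 * \<omega> * d \<le> 1 * d" using \<omega>\<delta> \<delta>d by simp
  then show 1: "44 * \<omega> \<le> 1" using d0 by (simp only: mult_le_cancel_right_pos)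
  then have "44 * \<omega> * d \<le> d" using d0 by (simp add: mult_le_cancel_right1)
  then show "44 \<le> d" using \<omega>1 by linarith
qed

lemma \<delta>0: "\<delta> > 0" using \<omega>\<delta> \<omega>1 by linarith

lemma dm: "dm \<le> d" "dm \<ge> 43/44 * d"
proof -
  have "0 \<le> a / n" "a / n \<le> 1" using a n by auto
  then show "dm \<le> d" "dm \<ge> 43/44 * d" using d_large unfolding dm_def by linarith+
qed

lemma row_W: "i < n \<Longrightarrow> (\<Sum>j<n. W i j) = (\<Sum>j<n. A i j) - dm"
proof -
  assume i: "i < n"
  have "(\<Sum>j<n. A i j) = (\<Sum>j<n. W i j + d / n + \<delta> / n * s i * s j - (if j = i then a / n else 0))"
    by (intro sum.cong) (auto simp: AW[OF i])
  also have "\<dots> = (\<Sum>j<n. W i j) + (\<Sum>j<n. d / n) + \<delta> / n * s i * (\<Sum>j<n. s j) - a / n"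
    using i by (simp add: sum.distrib sum_subtractf sum_distrib_left)
  also have "\<dots> = (\<Sum>j<n. W i j) + dm" unfolding s0 dm_def using n by simp
  finally show ?thesis by simp
qed

lemma deg_nonneg: "(\<Sum>j<n. A i j) \<ge> 0" using A0 by (intro sum_nonneg) auto

lemma \<tau>n: "(\<Sum>i<n. \<Sum>j<n. A i j) = n * \<tau>" unfolding \<tau>_def using n by simp

text \<open>The inequality for \<open>W\<close> is tested on two constant vectors. Its right-hand
  side contains \<tau> again, but with a coefficient of at most \<open>1 / 44\<close>, so it can be
  moved to the left.\<close>

lemma tau_bounds: "\<tau> \<ge> d / 2" "\<tau> \<le> 2 * d"
proof -
  have "(\<Sum>i<n. \<Sum>j<n. W i j) = (\<Sum>i<n. (\<Sum>j<n. A i j) - dm)"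
    by (intro sum.cong refl row_W) auto
  also have "\<dots> = n * \<tau> - n * dm" by (simp add: sum_subtractf \<tau>n)
  finally have 1: "(\<Sum>i<n. \<Sum>j<n. W i j) = n * (\<tau> - dm)" by (simp add: right_diff_distrib)
  have Z: "(\<Sum>i<n. (\<Sum>j<n. A i j) + d) = n * (\<tau> + d)" by (simp add: sum.distrib \<tau>n distrib_left)
  have t0: "\<tau> \<ge> 0" unfolding \<tau>_def using A0 by (intro divide_nonneg_nonneg sum_nonneg) auto
  have "\<bar>n * (\<tau> - dm)\<bar> \<le> \<omega> * (n * (\<tau> + d))"
    using W[of "\<lambda>_. 1" "\<lambda>_. 1"] t0 d0 unfolding mult_1_right power_one 1 Z by simp
  then have "n * \<bar>\<tau> - dm\<bar> \<le> n * (\<omega> * (\<tau> + d))" by (simp add: abs_mult mult_ac)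
  then have "\<bar>\<tau> - dm\<bar> \<le> \<omega> * (\<tau> + d)" using n by simp
  also have "\<dots> \<le> 1 / 44 * (\<tau> + d)" using \<omega>_small t0 d0 by (intro mult_right_mono) auto
  finally have "\<bar>\<tau> - dm\<bar> \<le> 1 / 44 * (\<tau> + d)" .
  then have "\<tau> - dm \<le> 1 / 44 * (\<tau> + d)" "dm - \<tau> \<le> 1 / 44 * (\<tau> + d)"
    using abs_ge_self[of "\<tau> - dm"] abs_ge_minus_self[of "\<tau> - dm"] by linarith+
  then have "44 * \<tau> - 44 * dm \<le> \<tau> + d" "44 * dm - 44 * \<tau> \<le> \<tau> + d" by auto
  moreover have "43 * d \<le> 44 * dm" "dm \<le> d" using dm by auto
  ultimately show "\<tau> \<ge> d / 2" "\<tau> \<le> 2 * d" using d0 by auto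
qed

lemma D_ge: "D i \<ge> \<tau>" "D i > 0" unfolding D_def using deg_nonneg[of i] tau_bounds d0 by auto

lemma N_sq: "(N x)\<^sup>2 = (\<Sum>i<n. D i * (x i)\<^sup>2)"
  unfolding N_def L2_set_def using D_ge(2) by (subst real_sqrt_pow2) (auto intro!: sum_nonneg simp: power_mult_distrib less_imp_le)

lemma N_nonneg: "N x \<ge> 0" unfolding N_def by simp

lemma W_bound: "\<bar>\<Sum>i<n. \<Sum>j<n. W i j * x i * y j\<bar> \<le> 2 * \<omega> * (N x * N y)"
proof -
  have *: "sqrt (\<Sum>i<n. ((\<Sum>j<n. A i j) + d) * (x i)\<^sup>2) \<le> sqrt 2 * N x" for x
  proof (rule real_le_lsqrt[THEN order_trans])
    show "(\<Sum>i<n. ((\<Sum>j<n. A i j) + d) * (x i)\<^sup>2) \<le> (sqrt 2 * N x)\<^sup>2"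
    proof -
      have "(\<Sum>i<n. ((\<Sum>j<n. A i j) + d) * (x i)\<^sup>2) \<le> (\<Sum>i<n. (2 * D i) * (x i)\<^sup>2)"
        using tau_bounds deg_nonneg unfolding D_def by (intro sum_mono mult_right_mono) (auto simp: add_increasing)
      also have "\<dots> = (sqrt 2 * N x)\<^sup>2" unfolding power_mult_distrib N_sq by (simp add: sum_distrib_left mult_ac)
      finally show ?thesis .
    qed
  qed (use N_nonneg in auto)
  have "\<bar>\<Sum>i<n. \<Sum>j<n. W i j * x i * y j\<bar> \<le> \<omega> * ((sqrt 2 * N x) * (sqrt 2 * N y))"
    using \<omega>0 N_nonneg A0 d0
    by (intro order_trans[OF W] mult_left_mono mult_mono *) (auto intro!: sum_nonneg mult_nonneg_nonneg add_nonneg_nonneg)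
  also have "\<dots> = \<omega> * ((sqrt 2 * sqrt 2) * (N x * N y))" by (simp only: mult_ac)
  finally show ?thesis by (simp add: mult_ac)
qed

lemma sum_D: "(\<Sum>i<n. D i) = 2 * n * \<tau>"
  unfolding D_def by (simp add: sum.distrib \<tau>n)

lemma N_sign: "(\<And>i. i < n \<Longrightarrow> x i * x i = 1) \<Longrightarrow> N x \<le> 2 * sqrt (n * d)"
proof -
  assume "\<And>i. i < n \<Longrightarrow> x i * x i = 1"
  then have "(N x)\<^sup>2 = (\<Sum>i<n. D i)" unfolding N_sq by (intro sum.cong) (auto simp: power2_eq_square)
  also have "\<dots> \<le> 4 * (n * d)" unfolding sum_D using tau_bounds n by simp
  also have "\<dots> = (2 * sqrt (n * d))\<^sup>2" using d0 by (simp add: power_mult_distrib)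
  finally show ?thesis by (rule power2_le_imp_le) (use d0 in simp)
qed

text \<open>The rows of \<open>W\<close> sum to degree deviations because the signs cancel. The
  bilinear inequality with one constant argument thus contains the concentration of degrees that is
  needed.\<close>

lemma W_one_bound: "\<bar>\<Sum>i<n. x i * (D i - (dm + \<tau>))\<bar> \<le> 4 * \<omega> * sqrt (n * d) * N x"
proof -
  have "(\<Sum>i<n. x i * (D i - (dm + \<tau>))) = (\<Sum>i<n. \<Sum>j<n. W i j * x i * 1)"
  proof (rule sum.cong[OF refl])
    fix i assume "i \<in> {..<n}"
    then have "(\<Sum>j<n. W i j) = D i - (dm + \<tau>)" using row_W[of i] unfolding D_def by simp
    then show "x i * (D i - (dm + \<tau>)) = (\<Sum>j<n. W i j * x i * 1)"
      by (simp add: sum_distrib_left[symmetric] sum_distrib_right[symmetric] mult.commute)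
  qed
  then have "\<bar>\<Sum>i<n. x i * (D i - (dm + \<tau>))\<bar> \<le> 2 * \<omega> * (N x * N (\<lambda>_. 1))" using W_bound[of x "\<lambda>_. 1"] by simp
  also have "\<dots> \<le> 2 * \<omega> * (N x * (2 * sqrt (n * d)))"
    using N_sign[of "\<lambda>_. 1"] \<omega>0 N_nonneg by (intro mult_left_mono) auto
  finally show ?thesis by (simp add: mult_ac)
qed

text \<open>Weighted orthogonality almost implies plain orthogonality: replacing \<open>D\<close> by
  its typical value \<open>dm + \<tau>\<close> costs only a degree deviation.\<close>

lemma plain_sum_bound:
  assumes "(\<Sum>i<n. D i * x i) = 0"
  shows "\<bar>\<Sum>i<n. x i\<bar> \<le> 4 * \<omega> * sqrt (n * d) * N x / d"
proof -
  have "(\<Sum>i<n. x i * (D i - (dm + \<tau>))) = - ((dm + \<tau>) * (\<Sum>i<n. x i))"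
    using assms by (simp add: right_diff_distrib sum_subtractf sum_distrib_right[symmetric] mult.commute)
  then have "(dm + \<tau>) * \<bar>\<Sum>i<n. x i\<bar> \<le> 4 * \<omega> * sqrt (n * d) * N x"
    using W_one_bound[of x] dm tau_bounds d0 by (simp add: abs_mult)
  moreover have "d * \<bar>\<Sum>i<n. x i\<bar> \<le> (dm + \<tau>) * \<bar>\<Sum>i<n. x i\<bar>"
    using dm tau_bounds d0 by (intro mult_right_mono) auto
  ultimately have "d * \<bar>\<Sum>i<n. x i\<bar> \<le> 4 * \<omega> * sqrt (n * d) * N x" by simp
  then show ?thesis using d0 by (simp add: field_simps)
qed

lemma L2_le_N: "L2_set x {..<n} \<le> sqrt 2 * N x / sqrt d"
proof (rule power2_le_imp_le)
  have "d * (\<Sum>i<n. (x i)\<^sup>2) \<le> 2 * (\<Sum>i<n. D i * (x i)\<^sup>2)"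
    unfolding sum_distrib_left mult.assoc[symmetric]
  proof (intro sum_mono mult_right_mono)
    fix i show "d \<le> 2 * D i" using D_ge(1)[of i] tau_bounds(1) by linarith
  qed simp
  then have "(\<Sum>i<n. (x i)\<^sup>2) \<le> 2 * (\<Sum>i<n. D i * (x i)\<^sup>2) / d" using d0 by (simp add: field_simps)
  then show "(L2_set x {..<n})\<^sup>2 \<le> (sqrt 2 * N x / sqrt d)\<^sup>2"
    unfolding power_divide power_mult_distrib N_sq L2_set_def using d0 by (simp add: sum_nonneg)
qed (use N_nonneg d0 in simp)

lemma A_form:
  "(\<Sum>i<n. \<Sum>j<n. A i j * x i * y j) = (\<Sum>i<n. \<Sum>j<n. W i j * x i * y j)
     + d / n * ((\<Sum>i<n. x i) * (\<Sum>i<n. y i)) + \<delta> / n * ((\<Sum>i<n. s i * x i) * (\<Sum>i<n. s i * y i)) - a / n * (\<Sum>i<n. x i * y i)"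
proof -
  have "(\<Sum>i<n. \<Sum>j<n. A i j * x i * y j) = (\<Sum>i<n. \<Sum>j<n. W i j * x i * y j + d / n * (x i * y j)
      + \<delta> / n * ((s i * x i) * (s j * y j)) - (if j = i then a / n * (x i * y i) else 0))"
    by (intro sum.cong refl) (auto simp: AW algebra_simps)
  also have "\<dots> = (\<Sum>i<n. \<Sum>j<n. W i j * x i * y j) + (\<Sum>i<n. \<Sum>j<n. d / n * (x i * y j))
      + (\<Sum>i<n. \<Sum>j<n. \<delta> / n * ((s i * x i) * (s j * y j))) - (\<Sum>i<n. a / n * (x i * y i))"
    by (simp add: sum.distrib sum_subtractf)
  finally show ?thesis unfolding sum_product unfolding sum_distrib_left .
qed

lemma regularized_form:
  "(\<Sum>i<n. \<Sum>j<n. (A i j + \<tau> / n) * x i * y j) = (\<Sum>i<n. \<Sum>j<n. A i j * x i * y j) + \<tau> / n * ((\<Sum>i<n. x i) * (\<Sum>i<n. y i))"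
  unfolding sum_product unfolding sum_distrib_left sum.distrib[symmetric]
  by (intro sum.cong refl) (simp add: algebra_simps)

text \<open>The test vector is \<open>s\<close> shifted by the constant \<open>c\<close> that makes
  it orthogonal to the constants in the weight \<open>D\<close>. The quadratic form is at least
  \<open>\<delta> * n\<close> minus \<open>17 * \<omega> * n * d\<close>, made up of
  \<open>8\<close> for the noise, \<open>8\<close> for the shift and \<open>1\<close> for the
  diagonal, hence at least \<open>\<delta> * n / 2\<close>; the weight of the test vector is at most
  \<open>4 * n * d\<close>.\<close>

lemma eigenvalue_ge:
  assumes var: "\<And>g. (\<Sum>i<n. D i * g i) = 0 \<Longrightarrow>
       (\<Sum>i<n. \<Sum>j<n. (A i j + \<tau> / n) * g i * g j) \<le> l * (\<Sum>i<n. D i * (g i)\<^sup>2)"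
  shows "l \<ge> \<delta> / (8 * d)"
proof -
  have nd: "real n * d > 0" using n d0 by simp
  have rr: "sqrt (n * d) * sqrt (n * d) = n * d" using nd by simp
  have nt: "2 * n * \<tau> \<ge> n * d" "2 * n * \<tau> \<le> 4 * (n * d)" using tau_bounds n by auto
  define b where "b = (\<Sum>i<n. D i * s i)"
  define c where "c = b / (2 * n * \<tau>)"
  have bc: "b = c * (2 * n * \<tau>)" 
  proof -
    have "2 * n * \<tau> \<noteq> 0" using nt(1) nd by linarith
    then show ?thesis unfolding c_def by simp
  qed
  have "b = (\<Sum>i<n. s i * (D i - (dm + \<tau>)))"
    unfolding b_def using s0 by (simp add: right_diff_distrib sum_subtractf sum_distrib_right[symmetric] mult.commute)
  then have "\<bar>b\<bar> \<le> 4 * \<omega> * sqrt (n * d) * N s" using W_one_bound[of s] by simp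
  also have "\<dots> \<le> 4 * \<omega> * sqrt (n * d) * (2 * sqrt (n * d))"
    using N_sign[of s] s2 \<omega>0 d0 by (intro mult_left_mono) auto
  also have "\<dots> = 8 * \<omega> * (sqrt (n * d) * sqrt (n * d))" by (simp only: mult_ac)
  also have "\<dots> = 8 * \<omega> * (n * d)" unfolding rr ..
  finally have b: "\<bar>b\<bar> \<le> 8 * \<omega> * (n * d)" .
  have "\<bar>c\<bar> * (n * d) \<le> \<bar>c\<bar> * (2 * n * \<tau>)" using nt by (intro mult_left_mono) auto
  also have "\<dots> = \<bar>b\<bar>" unfolding bc using tau_bounds(1) d0 by (simp add: abs_mult)
  finally have "\<bar>c\<bar> * (n * d) \<le> (8 * \<omega>) * (n * d)" using b by simp
  then have c: "\<bar>c\<bar> \<le> 8 * \<omega>" using nd by (simp only: mult_le_cancel_right_pos)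
  have c2: "c\<^sup>2 \<le> (8 * \<omega>)\<^sup>2" using c \<omega>0 by (metis abs_ge_zero power2_abs power_mono)
  have w2: "(8 * \<omega>)\<^sup>2 \<le> 2 * \<omega>" using \<omega>_small \<omega>0 mult_right_mono[of "44 * \<omega>" 1 \<omega>] by (simp add: power2_eq_square)
  define g where "g = (\<lambda>i. s i - c)"
  have g0: "(\<Sum>i<n. D i * g i) = 0"
    unfolding g_def by (simp add: right_diff_distrib sum_subtractf sum_distrib_right[symmetric] sum_D b_def[symmetric] bc)
  have gD: "(\<Sum>i<n. D i * (g i)\<^sup>2) = 2 * n * \<tau> * (1 - c\<^sup>2)"
  proof -
    have "(\<Sum>i<n. D i * (g i)\<^sup>2) = (\<Sum>i<n. D i + c\<^sup>2 * D i - 2 * c * (D i * s i))"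
    proof (rule sum.cong[OF refl])
      fix i assume "i \<in> {..<n}"
      then have "s i * s i = 1" using s2 by simp
      then have gi: "(g i)\<^sup>2 = 1 + c\<^sup>2 - 2 * c * s i" unfolding g_def by (simp add: power2_eq_square algebra_simps)
      show "D i * (g i)\<^sup>2 = D i + c\<^sup>2 * D i - 2 * c * (D i * s i)" unfolding gi by (simp add: algebra_simps)
    qed
    also have "\<dots> = 2 * n * \<tau> + c\<^sup>2 * (2 * n * \<tau>) - 2 * c * b"
      by (simp add: sum.distrib sum_subtractf sum_distrib_left[symmetric] sum_D b_def)
    finally show ?thesis unfolding bc by (simp add: power2_eq_square algebra_simps)
  qed
  have ss: "(\<Sum>i<n. s i * s i) = n" using s2 by simp
  have row: "(\<Sum>j<n. A i j + \<tau> / n) = D i" for i unfolding D_def using n by (simp add: sum.distrib)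
  have gB: "(\<Sum>i<n. \<Sum>j<n. (A i j + \<tau> / n) * g i * g j) = (\<Sum>i<n. \<Sum>j<n. (A i j + \<tau> / n) * s i * s j) - c\<^sup>2 * (2 * n * \<tau>)"
  proof -
    have expand: "K * (u - c) * (w - c) = K * u * w - c * (K * u) - c * (K * w) + c\<^sup>2 * K" for K u w
      by (simp add: power2_eq_square algebra_simps)
    have "(\<Sum>i<n. \<Sum>j<n. (A i j + \<tau> / n) * g i * g j) =
      (\<Sum>i<n. \<Sum>j<n. (A i j + \<tau> / n) * s i * s j) - (\<Sum>i<n. \<Sum>j<n. c * ((A i j + \<tau> / n) * s i))
       - (\<Sum>i<n. \<Sum>j<n. c * ((A i j + \<tau> / n) * s j)) + (\<Sum>i<n. \<Sum>j<n. c\<^sup>2 * (A i j + \<tau> / n))"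
      unfolding g_def sum.distrib[symmetric] sum_subtractf[symmetric]
      by (intro sum.cong refl) (rule expand)
    also have "(\<Sum>i<n. \<Sum>j<n. c * ((A i j + \<tau> / n) * s j)) = (\<Sum>j<n. \<Sum>i<n. c * ((A i j + \<tau> / n) * s j))"
      by (rule sum.swap)
    also have "\<dots> = (\<Sum>j<n. \<Sum>i<n. c * ((A j i + \<tau> / n) * s j))" by (simp add: Asym)
    also have "(\<Sum>i<n. \<Sum>j<n. c * ((A i j + \<tau> / n) * s i)) = c * b"
      by (simp only: sum_distrib_left[symmetric] sum_distrib_right[symmetric] row b_def)
    also have "(\<Sum>i<n. \<Sum>j<n. c\<^sup>2 * (A i j + \<tau> / n)) = c\<^sup>2 * (2 * n * \<tau>)"
      by (simp only: sum_distrib_left[symmetric] row sum_D)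
    finally show ?thesis unfolding bc by (simp add: power2_eq_square algebra_simps)
  qed
  have "(\<Sum>i<n. \<Sum>j<n. (A i j + \<tau> / n) * s i * s j) = (\<Sum>i<n. \<Sum>j<n. W i j * s i * s j) + \<delta> * n - a"
    unfolding regularized_form A_form s0 ss using n by simp
  moreover have "\<bar>\<Sum>i<n. \<Sum>j<n. W i j * s i * s j\<bar> \<le> 8 * \<omega> * (n * d)"
  proof -
    have "\<bar>\<Sum>i<n. \<Sum>j<n. W i j * s i * s j\<bar> \<le> 2 * \<omega> * (N s * N s)" by (rule W_bound)
    also have "\<dots> \<le> 2 * \<omega> * ((2 * sqrt (n * d)) * (2 * sqrt (n * d)))"
      using N_sign[of s] s2 \<omega>0 N_nonneg nd by (intro mult_left_mono mult_mono) auto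
    also have "\<dots> = 8 * \<omega> * (sqrt (n * d) * sqrt (n * d))" by (simp only: mult_ac)
  also have "\<dots> = 8 * \<omega> * (n * d)" unfolding rr ..
    finally show ?thesis .
  qed
  moreover have "c\<^sup>2 * (2 * n * \<tau>) \<le> (2 * \<omega>) * (4 * (n * d))"
  proof -
    have "c\<^sup>2 * (2 * n * \<tau>) \<le> (2 * \<omega>) * (2 * n * \<tau>)"
      using c2 w2 nt(1) nd by (intro mult_right_mono) linarith+
    also have "\<dots> \<le> (2 * \<omega>) * (4 * (n * d))" using nt(2) \<omega>0 by (intro mult_left_mono) auto
    finally show ?thesis .
  qed
  moreover have "l * (2 * n * \<tau> * (1 - c\<^sup>2)) \<ge> (\<Sum>i<n. \<Sum>j<n. (A i j + \<tau> / n) * s i * s j) - c\<^sup>2 * (2 * n * \<tau>)"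
    using var[OF g0] unfolding gB gD .
  moreover have "(2 * \<omega>) * (4 * (n * d)) = 8 * (\<omega> * (n * d))" "8 * \<omega> * (n * d) = 8 * (\<omega> * (n * d))" by auto
  ultimately have 1: "l * (2 * n * \<tau> * (1 - c\<^sup>2)) \<ge> \<delta> * n - a - 16 * (\<omega> * (n * d))"
    using abs_ge_minus_self[of "\<Sum>i<n. \<Sum>j<n. W i j * s i * s j"] by linarith
  have "17 * (\<omega> * (n * d)) = (17 * \<omega> * d) * n" by simp
  also have "\<dots> \<le> (\<delta> / 2) * n" using \<omega>\<delta> \<omega>1 by (intro mult_right_mono) auto
  finally have "17 * (\<omega> * (n * d)) \<le> \<delta> * n / 2" by simp
  moreover have "a \<le> 1 * (real n)" using a by simp
  moreover have "1 * real n \<le> (\<omega> * d) * real n" using \<omega>1 by (intro mult_right_mono) auto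
  moreover have "(\<omega> * d) * real n = \<omega> * (n * d)" by simp
  ultimately have 2: "l * (2 * n * \<tau> * (1 - c\<^sup>2)) \<ge> \<delta> * n / 2" using 1 by linarith
  have cc: "0 < 1 - c\<^sup>2" "1 - c\<^sup>2 \<le> 1" using c2 w2 \<omega>_small by auto
  have "\<delta> * n / 2 > 0" using \<delta>0 n by simp
  then have "l * (2 * n * \<tau> * (1 - c\<^sup>2)) > 0" using 2 by simp
  moreover have "2 * n * \<tau> * (1 - c\<^sup>2) > 0"
  proof (rule mult_pos_pos)
    show "2 * n * \<tau> > 0" using nt(1) nd by linarith
  qed (rule cc)
  \<comment> \<open>The sign of \<open>l\<close> has to be known before the weight in front of it
    may be enlarged.\<close>
  ultimately have l0: "l > 0" by (simp add: zero_less_mult_iff)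
  have "2 * n * \<tau> * (1 - c\<^sup>2) \<le> 4 * (n * d) * 1"
    using cc nd by (intro mult_mono[OF nt(2) cc(2)]) auto
  then have "l * (2 * n * \<tau> * (1 - c\<^sup>2)) \<le> l * (4 * (n * d) * 1)" using l0 by (intro mult_left_mono) auto
  then have "\<delta> * n / 2 \<le> l * (4 * (n * d) * 1)" using 2 by linarith
  then have "n * (\<delta> / 2) \<le> n * (4 * l * d)" by (simp add: mult_ac)
  then have "\<delta> / 2 \<le> 4 * l * d" using n by (simp only: mult_le_cancel_left)
  then show ?thesis using d0 by (simp add: field_simps)
qed


text \<open>The remainder \<open>z\<close> satisfies
  \<open>N z \<le> 224 * \<omega> * d / \<delta>\<close>, from \<open>2 + 18 + 6 + 2 = 28\<close>
  error terms divided by the eigenvalue bound. Replacing \<open>sqrt (D i)\<close> by a constant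
  adds \<open>4\<close>, and normalising the multiple of the signs to length \<open>1\<close>
  doubles the total to \<open>456\<close>.\<close>

theorem sign_vector_close:
  assumes f0: "(\<Sum>i<n. D i * f i) = 0" and f1: "(\<Sum>i<n. D i * (f i)\<^sup>2) = 1"
    and eig: "\<And>i. i < n \<Longrightarrow> (\<Sum>j<n. (A i j + \<tau> / n) * f j) = l * (D i * f i)"
    and var: "\<And>g. (\<Sum>i<n. D i * g i) = 0 \<Longrightarrow>
       (\<Sum>i<n. \<Sum>j<n. (A i j + \<tau> / n) * g i * g j) \<le> l * (\<Sum>i<n. D i * (g i)\<^sup>2)"
  obtains \<beta> :: real where "\<beta> = 1 \<or> \<beta> = -1"
    "L2_set (\<lambda>i. sqrt (D i) * f i - \<beta> * (s i / sqrt n)) {..<n} \<le> 460 * (\<omega> * d / \<delta>)"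
proof -
  have nd: "real n * d > 0" using n d0 by simp
  have snd: "sqrt (n * d) = sqrt n * sqrt d" by (simp add: real_sqrt_mult)
  have sd: "sqrt d > 0" "sqrt d * sqrt d = d" and sn: "sqrt n > 0" "sqrt n * sqrt n = real n" using d0 n by auto
  have nt: "2 * n * \<tau> \<ge> n * d" using tau_bounds n by auto
  then have nt0: "2 * n * \<tau> > 0" using nd by linarith
  have l: "l \<ge> \<delta> / (8 * d)" using eigenvalue_ge[OF var] .
  then have l0: "l > 0" using \<delta>0 d0 by (meson divide_pos_pos less_le_trans mult_pos_pos zero_less_numeral)
  have Nf: "N f = 1" using N_sq[of f] N_nonneg[of f] f1 by (simp add: power2_eq_1_iff)
  define b where "b = (\<Sum>i<n. D i * (s i * f i))"
  define c where "c = b / (2 * n * \<tau>)"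
  have bc: "b = c * (2 * n * \<tau>)"
  proof -
    have "2 * n * \<tau> \<noteq> 0" using nt0 by linarith
    then show ?thesis unfolding c_def by simp
  qed
  define z where "z = (\<lambda>i. f i - c * s i)"
  have DsS: "(\<Sum>i<n. D i * (s i * s i)) = 2 * n * \<tau>"
    unfolding sum_D[symmetric] by (intro sum.cong) (auto simp: s2)
  have sz: "(\<Sum>i<n. D i * (s i * z i)) = 0"
  proof -
    have "(\<Sum>i<n. D i * (s i * z i)) = (\<Sum>i<n. D i * (s i * f i)) - c * (\<Sum>i<n. D i * (s i * s i))"
      unfolding z_def sum_distrib_left sum_subtractf[symmetric] by (intro sum.cong refl) (simp add: algebra_simps)
    then show ?thesis unfolding DsS b_def[symmetric] bc by simp
  qed
  have zz: "(\<Sum>i<n. D i * (z i * f i)) = (N z)\<^sup>2"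
  proof -
    have "(\<Sum>i<n. D i * (z i * f i)) = (\<Sum>i<n. D i * (z i)\<^sup>2) + c * (\<Sum>i<n. D i * (s i * z i))"
      unfolding z_def sum_distrib_left sum.distrib[symmetric]
      by (intro sum.cong refl) (simp add: power2_eq_square algebra_simps)
    then show ?thesis unfolding sz N_sq by simp
  qed
  have ff: "(N z)\<^sup>2 + c\<^sup>2 * (2 * n * \<tau>) = 1"
  proof -
    have "(\<Sum>i<n. D i * (f i)\<^sup>2) = (\<Sum>i<n. D i * (z i)\<^sup>2) + 2 * c * (\<Sum>i<n. D i * (s i * z i)) + c\<^sup>2 * (\<Sum>i<n. D i * (s i * s i))"
      unfolding z_def sum_distrib_left sum.distrib[symmetric]
      by (intro sum.cong refl) (simp add: power2_eq_square algebra_simps)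
    then show ?thesis unfolding sz DsS N_sq f1 by simp
  qed
  define q where "q = N z"
  have q0: "q \<ge> 0" unfolding q_def by (rule N_nonneg)
  have w1: "\<bar>\<Sum>i<n. \<Sum>j<n. W i j * z i * f j\<bar> \<le> 2 * \<omega> * q"
    using W_bound[of z f] unfolding Nf q_def by simp
  have sumf: "\<bar>\<Sum>i<n. f i\<bar> \<le> 4 * \<omega> * sqrt (n * d) / d"
    using plain_sum_bound[OF f0] unfolding Nf by simp
  have one: "L2_set (\<lambda>_. 1) {..<n} = sqrt n" by (simp add: L2_set_constant)
  have sL2: "L2_set s {..<n} = sqrt n"
  proof -
    have "(\<Sum>i<n. (s i)\<^sup>2) = (\<Sum>i<n. 1)" by (intro sum.cong refl) (simp add: power2_eq_square s2)
    then show ?thesis unfolding L2_set_def by simp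
  qed
  have sumz: "\<bar>\<Sum>i<n. z i\<bar> \<le> sqrt n * (sqrt 2 * q / sqrt d)"
    using abs_sum_mult_le_L2_set[of "\<lambda>_. 1" z "{..<n}"] mult_left_mono[OF L2_le_N[of z], of "sqrt n"]
    unfolding one q_def by simp
  have sumsf: "\<bar>\<Sum>i<n. s i * f i\<bar> \<le> sqrt n * (sqrt 2 / sqrt d)"
    using abs_sum_mult_le_L2_set[of s f "{..<n}"] mult_left_mono[OF L2_le_N[of f], of "sqrt n"]
    unfolding sL2 Nf by simp
  \<comment> \<open>Orthogonality of \<open>z\<close> to the signs is orthogonality of
    \<open>s i * z i\<close> to the constants, and multiplication by signs preserves
    \<open>N\<close>.\<close>
  have sumsz: "\<bar>\<Sum>i<n. s i * z i\<bar> \<le> 4 * \<omega> * sqrt (n * d) * q / d"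
  proof -
    have "(N (\<lambda>i. s i * z i))\<^sup>2 = (N z)\<^sup>2"
      unfolding N_sq by (intro sum.cong refl) (simp add: power_mult_distrib power2_eq_square[of "s _"] s2)
    then have "N (\<lambda>i. s i * z i) = q" unfolding q_def using N_nonneg by (metis power2_eq_iff_nonneg)
    then show ?thesis using plain_sum_bound[OF sz] by simp
  qed
  have zf: "\<bar>\<Sum>i<n. z i * f i\<bar> \<le> (sqrt 2 * q / sqrt d) * (sqrt 2 / sqrt d)"
  proof -
    have "\<bar>\<Sum>i<n. z i * f i\<bar> \<le> L2_set z {..<n} * L2_set f {..<n}" by (rule abs_sum_mult_le_L2_set)
    also have "\<dots> \<le> (sqrt 2 * q / sqrt d) * (sqrt 2 / sqrt d)"
      using L2_le_N[of z] L2_le_N[of f] q0 d0 unfolding Nf q_def by (intro mult_mono) auto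
    finally show ?thesis .
  qed
  have sq2: "sqrt 2 \<le> (3/2::real)" by (rule real_le_lsqrt) (auto simp: power2_eq_square)
  \<comment> \<open>Only one of the two sums is small: \<open>f\<close> is orthogonal to the
    constants in the weight \<open>D\<close>, whereas \<open>z\<close> gets the Cauchy-Schwarz
    bound. In \<open>t2\<close> the roles are exchanged.\<close>
  have t1: "\<bar>(d + \<tau>) / n * ((\<Sum>i<n. z i) * (\<Sum>i<n. f i))\<bar> \<le> 18 * \<omega> * q"
  proof -
    have "\<bar>(d + \<tau>) / n * ((\<Sum>i<n. z i) * (\<Sum>i<n. f i))\<bar> = (d + \<tau>) / n * (\<bar>\<Sum>i<n. z i\<bar> * \<bar>\<Sum>i<n. f i\<bar>)"
      using d0 tau_bounds by (simp add: abs_mult)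
    also have "\<dots> \<le> (3 * d) / n * ((sqrt n * (sqrt 2 * q / sqrt d)) * (4 * \<omega> * sqrt (n * d) / d))"
      using sumz sumf tau_bounds d0 q0 \<omega>0 by (intro mult_mono divide_right_mono) auto
    also have "\<dots> = 12 * sqrt 2 * \<omega> * q" unfolding snd using sd sn n d0 by (simp add: field_simps)
    also have "\<dots> \<le> 12 * (3/2) * \<omega> * q" using sq2 \<omega>0 q0 by (intro mult_right_mono mult_left_mono) auto
    finally show ?thesis by simp
  qed
  have t2: "\<bar>\<delta> / n * ((\<Sum>i<n. s i * z i) * (\<Sum>i<n. s i * f i))\<bar> \<le> 6 * \<omega> * q"
  proof -
    have "\<bar>\<delta> / n * ((\<Sum>i<n. s i * z i) * (\<Sum>i<n. s i * f i))\<bar> = \<delta> / n * (\<bar>\<Sum>i<n. s i * z i\<bar> * \<bar>\<Sum>i<n. s i * f i\<bar>)"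
      using \<delta>0 by (simp add: abs_mult)
    also have "\<dots> \<le> d / n * ((4 * \<omega> * sqrt (n * d) * q / d) * (sqrt n * (sqrt 2 / sqrt d)))"
      using sumsz sumsf \<delta>d d0 \<delta>0 q0 \<omega>0 by (intro mult_mono divide_right_mono) auto
    also have "\<dots> = 4 * sqrt 2 * \<omega> * q" unfolding snd using sd sn n d0 by (simp add: field_simps)
    also have "\<dots> \<le> 4 * (3/2) * \<omega> * q" using sq2 \<omega>0 q0 by (intro mult_right_mono mult_left_mono) auto
    finally show ?thesis by simp
  qed
  have t3: "\<bar>a / n * (\<Sum>i<n. z i * f i)\<bar> \<le> 2 * \<omega> * q"
  proof -
    have dd: "(sqrt 2 * q / sqrt d) * (sqrt 2 / sqrt d) = 2 * q / d" using sd d0 by (simp add: field_simps)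
    have "\<bar>a / n * (\<Sum>i<n. z i * f i)\<bar> = a / n * \<bar>\<Sum>i<n. z i * f i\<bar>" using a by (simp add: abs_mult)
    also have "\<dots> \<le> 1 * (2 * q / d)" using zf a n unfolding dd by (intro mult_mono) auto
    also have "\<dots> \<le> 2 * \<omega> * q"
    proof -
      have "1 / d \<le> \<omega>" using \<omega>1 d0 by (simp add: field_simps)
      then have "2 * (1 / d) * q \<le> 2 * \<omega> * q" using q0 by (intro mult_right_mono mult_left_mono) auto
      then show ?thesis by simp
    qed
    finally show ?thesis .
  qed
  have "l * q\<^sup>2 = (\<Sum>i<n. \<Sum>j<n. (A i j + \<tau> / n) * z i * f j)"
  proof -
    have "(\<Sum>i<n. \<Sum>j<n. (A i j + \<tau> / n) * z i * f j) = (\<Sum>i<n. z i * (\<Sum>j<n. (A i j + \<tau> / n) * f j))"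
      by (simp add: sum_distrib_left mult_ac)
    also have "\<dots> = (\<Sum>i<n. l * (D i * (z i * f i)))"
      by (intro sum.cong refl) (simp only: eig lessThan_iff, simp add: mult_ac)
    also have "\<dots> = l * (\<Sum>i<n. D i * (z i * f i))" by (simp only: sum_distrib_left)
    finally show ?thesis unfolding zz q_def by simp
  qed
  also have "\<dots> = (\<Sum>i<n. \<Sum>j<n. W i j * z i * f j) + (d + \<tau>) / n * ((\<Sum>i<n. z i) * (\<Sum>i<n. f i))
     + \<delta> / n * ((\<Sum>i<n. s i * z i) * (\<Sum>i<n. s i * f i)) - a / n * (\<Sum>i<n. z i * f i)"
    unfolding regularized_form A_form by (simp add: add_divide_distrib distrib_right)
  also have "\<dots> \<le> 2 * \<omega> * q + 18 * \<omega> * q + 6 * \<omega> * q + 2 * \<omega> * q"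
    using w1 t1 t2 t3 unfolding abs_le_iff by linarith
  finally have lq: "(l * q) * q \<le> (28 * \<omega>) * q" by (simp add: power2_eq_square mult_ac)
  define \<eta> where "\<eta> = \<omega> * d / \<delta>"
  have qb: "q \<le> 224 * \<eta>"
  proof (cases "q = 0")
    case True
    then show ?thesis unfolding \<eta>_def using \<omega>0 d0 \<delta>0 by simp
  next
    case False
    then have "l * q \<le> 28 * \<omega>" using lq q0 by simp
    moreover have "\<delta> / (8 * d) * q \<le> l * q" using l q0 by (rule mult_right_mono)
    ultimately have "\<delta> / (8 * d) * q \<le> 28 * \<omega>" by linarith
    then show ?thesis unfolding \<eta>_def using \<delta>0 d0 by (simp add: field_simps)
  qed
  define Db where "Db = dm + \<tau>"
  have Db: "Db > 0" unfolding Db_def using dm tau_bounds d0 by auto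
  have D0: "D i > 0" for i by (rule D_ge)
  define g where "g = (\<lambda>i. D i - Db)"
  \<comment> \<open>A self-improving test vector: its squared norm \<open>N x\<close> is at most its
    pairing \<open>Q\<close> with the degree deviations, so \<open>W_one_bound\<close> bounds
    \<open>Q\<close> by a multiple of \<open>sqrt Q\<close>. The denominator also makes
    \<open>Q\<close> dominate the squared differences of \<open>sqrt (D i)\<close> and
    \<open>sqrt Db\<close>.\<close>
  define x where "x = (\<lambda>i. g i / (D i + Db))"
  define Q where "Q = (\<Sum>i<n. x i * g i)"
  have Qi: "x i * g i = (g i)\<^sup>2 / (D i + Db)" for i unfolding x_def by (simp add: power2_eq_square)
  have Q0: "Q \<ge> 0" unfolding Q_def Qi using D0 Db by (intro sum_nonneg divide_nonneg_pos) (auto simp: add_pos_pos)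
  have Nx: "N x \<le> sqrt Q"
  proof (rule real_le_rsqrt)
    show "(N x)\<^sup>2 \<le> Q" unfolding N_sq Q_def
    proof (rule sum_mono)
      fix i
      have p: "D i + Db > 0" using D0 Db by (simp add: add_pos_pos)
      have "D i * (x i)\<^sup>2 \<le> (D i + Db) * (x i)\<^sup>2" using Db by (intro mult_right_mono) auto
      also have "\<dots> = x i * g i" unfolding x_def using p by (simp add: power2_eq_square)
      finally show "D i * (x i)\<^sup>2 \<le> x i * g i" .
    qed
  qed
  have "Q \<le> 4 * \<omega> * sqrt (n * d) * N x" using W_one_bound[of x] unfolding Q_def g_def Db_def by simp
  also have "\<dots> \<le> 4 * \<omega> * sqrt (n * d) * sqrt Q" using Nx \<omega>0 nd by (intro mult_left_mono) auto
  finally have "sqrt Q * sqrt Q \<le> (4 * \<omega> * sqrt (n * d)) * sqrt Q" using Q0 by simp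
  then have sQ: "sqrt Q \<le> 4 * \<omega> * sqrt (n * d)"
  proof (cases "sqrt Q = 0")
    case True
    then show ?thesis unfolding True using \<omega>0 nd by simp
  next
    case False
    then have "sqrt Q > 0" using Q0 by simp
    then show ?thesis using \<open>sqrt Q * sqrt Q \<le> (4 * \<omega> * sqrt (n * d)) * sqrt Q\<close> by (rule mult_right_le_imp_le[rotated])
  qed
  have LD: "L2_set (\<lambda>i. sqrt (D i) - sqrt Db) {..<n} \<le> sqrt Q"
    unfolding L2_set_def Q_def
  proof (intro real_sqrt_le_mono sum_mono)
    fix i
    have p: "D i + Db > 0" using D0 Db by (simp add: add_pos_pos)
    have "(sqrt (D i) - sqrt Db)\<^sup>2 * (D i + Db) \<le> (sqrt (D i) - sqrt Db)\<^sup>2 * (sqrt (D i) + sqrt Db)\<^sup>2"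
      using D0[of i] Db by (intro mult_left_mono) (auto simp: power2_sum)
    also have "\<dots> = (sqrt (D i) * sqrt (D i) - sqrt Db * sqrt Db)\<^sup>2"
      unfolding power_mult_distrib[symmetric] by (simp add: algebra_simps)
    also have "\<dots> = (g i)\<^sup>2" unfolding g_def using D0[of i] Db by simp
    finally show "(sqrt (D i) - sqrt Db)\<^sup>2 \<le> x i * g i" unfolding Qi using p by (simp add: field_simps)
  qed
  define v where "v = (\<lambda>i. sqrt (D i) * f i)"
  define h where "h = (\<lambda>i. s i / sqrt n)"
  define k where "k = c * sqrt Db * sqrt n"
  have cb: "\<bar>c\<bar> * sqrt (n * d) \<le> 1"
  proof (rule power2_le_imp_le)
    have "(\<bar>c\<bar> * sqrt (n * d))\<^sup>2 = c\<^sup>2 * (n * d)" using nd by (simp add: power_mult_distrib)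
    also have "\<dots> \<le> c\<^sup>2 * (2 * n * \<tau>)" using nt by (intro mult_left_mono) auto
    also have "\<dots> \<le> 1\<^sup>2" unfolding power_one using ff zero_le_power2[of "N z"] by linarith
    finally show "(\<bar>c\<bar> * sqrt (n * d))\<^sup>2 \<le> 1\<^sup>2" .
  qed simp
  have vk: "L2_set (\<lambda>i. v i - k * h i) {..<n} \<le> 228 * \<eta>"
  proof -
    have "v i - k * h i = sqrt (D i) * z i + c * s i * (sqrt (D i) - sqrt Db)" for i
      unfolding v_def k_def h_def z_def using sn by (simp add: field_simps)
    then have "L2_set (\<lambda>i. v i - k * h i) {..<n} \<le> N z + L2_set (\<lambda>i. c * s i * (sqrt (D i) - sqrt Db)) {..<n}"
      unfolding N_def by (simp add: L2_set_triangle_ineq)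
    also have "L2_set (\<lambda>i. c * s i * (sqrt (D i) - sqrt Db)) {..<n} = \<bar>c\<bar> * L2_set (\<lambda>i. sqrt (D i) - sqrt Db) {..<n}"
    proof -
      have "(\<Sum>i<n. (c * s i * (sqrt (D i) - sqrt Db))\<^sup>2) = (\<Sum>i<n. c\<^sup>2 * (sqrt (D i) - sqrt Db)\<^sup>2)"
        by (intro sum.cong refl) (simp add: power_mult_distrib power2_eq_square[of "s _"] s2)
      then show ?thesis unfolding L2_set_def by (simp add: sum_distrib_left[symmetric] real_sqrt_mult)
    qed
    also have "\<bar>c\<bar> * L2_set (\<lambda>i. sqrt (D i) - sqrt Db) {..<n} \<le> \<bar>c\<bar> * (4 * \<omega> * sqrt (n * d))"
      using LD sQ by (intro mult_left_mono) auto
    also have "\<dots> = 4 * \<omega> * (\<bar>c\<bar> * sqrt (n * d))" by simp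
    also have "\<dots> \<le> 4 * \<omega> * 1" using cb \<omega>0 by (intro mult_left_mono) auto
    also have "\<dots> \<le> 4 * \<eta>" unfolding \<eta>_def using \<delta>d \<delta>0 \<omega>0 by (simp add: field_simps)
    finally show ?thesis using qb unfolding q_def by simp
  qed
  have Lv: "L2_set v {..<n} = 1" using Nf unfolding N_def v_def .
  have Lh: "L2_set (\<lambda>i. t * h i) {..<n} = \<bar>t\<bar>" for t
  proof -
    have "(\<Sum>i<n. (t * h i)\<^sup>2) = (\<Sum>i<n. t\<^sup>2 / n)"
      unfolding h_def by (intro sum.cong refl) (simp add: power_mult_distrib power_divide power2_eq_square[of "s _"] s2)
    then show ?thesis unfolding L2_set_def using n by simp
  qed
  \<comment> \<open>Both \<open>v\<close> and \<open>h\<close> have length \<open>1\<close>, so the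
    reverse triangle inequality bounds the distance of \<open>\<bar>k\<bar>\<close> from
    \<open>1\<close> by the error already obtained.\<close>
  define \<beta> where "\<beta> = (if k \<ge> 0 then 1 else -1 :: real)"
  have "\<bar>k - \<beta>\<bar> = \<bar>\<bar>k\<bar> - 1\<bar>" unfolding \<beta>_def by auto
  also have "\<dots> \<le> L2_set (\<lambda>i. v i - k * h i) {..<n}"
  proof -
    have "L2_set v {..<n} \<le> L2_set (\<lambda>i. v i - k * h i) {..<n} + L2_set (\<lambda>i. k * h i) {..<n}"
      using L2_set_triangle_ineq[of "\<lambda>i. v i - k * h i" "\<lambda>i. k * h i" "{..<n}"] by simp
    moreover have "L2_set (\<lambda>i. k * h i) {..<n} \<le> L2_set (\<lambda>i. k * h i - v i) {..<n} + L2_set v {..<n}"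
      using L2_set_triangle_ineq[of "\<lambda>i. k * h i - v i" v "{..<n}"] by simp
    moreover have "L2_set (\<lambda>i. k * h i - v i) {..<n} = L2_set (\<lambda>i. v i - k * h i) {..<n}"
      unfolding L2_set_def by (simp add: power2_commute)
    ultimately show ?thesis unfolding Lv Lh by linarith
  qed
  finally have kb: "\<bar>k - \<beta>\<bar> \<le> 228 * \<eta>" using vk by linarith
  have "L2_set (\<lambda>i. v i - \<beta> * h i) {..<n} = L2_set (\<lambda>i. (v i - k * h i) + (k - \<beta>) * h i) {..<n}"
    by (intro L2_set_cong refl) (simp add: algebra_simps)
  also have "\<dots> \<le> L2_set (\<lambda>i. v i - k * h i) {..<n} + L2_set (\<lambda>i. (k - \<beta>) * h i) {..<n}"
    by (rule L2_set_triangle_ineq)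
  also have "\<dots> \<le> 456 * \<eta>" unfolding Lh using vk kb by simp
  also have "\<dots> \<le> 460 * \<eta>"
  proof -
    have "\<eta> \<ge> 0" unfolding \<eta>_def using \<omega>0 d0 \<delta>0 by simp
    then show ?thesis by simp
  qed
  finally show ?thesis using that[of \<beta>] unfolding v_def h_def \<eta>_def \<beta>_def by auto
qed

end

section \<open>The expected matrix and misclassified vertices\<close>

text \<open>With a constant \<open>D\<close> the Rayleigh quotient can be compared exactly. Testing
  with \<open>s\<close> forces \<open>b\<^sup>2 \<ge> n / D\<close>, which is equality in
  Cauchy-Schwarz for \<open>f\<close> and \<open>s\<close>; hence \<open>f\<close> is a multiple of
  \<open>s\<close>, and no spectrum has to be computed.\<close>

lemma expected_sign_vector:
  fixes f s :: "nat \<Rightarrow> real"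
  assumes n: "n > 0" and s2: "\<And>i. i < n \<Longrightarrow> s i * s i = 1" and s0: "(\<Sum>i<n. s i) = 0" and \<delta>: "\<delta> > 0" and D: "D > 0"
    and B: "\<And>i j. i < n \<Longrightarrow> j < n \<Longrightarrow> B i j = c + \<delta> / n * (s i * s j) - (if i = j then a else 0)"
    and f0: "(\<Sum>i<n. D * f i) = 0" and f1: "(\<Sum>i<n. D * (f i)\<^sup>2) = 1"
    and eig: "\<And>i. i < n \<Longrightarrow> (\<Sum>j<n. B i j * f j) = l * (D * f i)"
    and var: "\<And>g. (\<Sum>i<n. D * g i) = 0 \<Longrightarrow> (\<Sum>i<n. \<Sum>j<n. B i j * g i * g j) \<le> l * (\<Sum>i<n. D * (g i)\<^sup>2)"
  obtains \<beta> :: real where "\<beta> = 1 \<or> \<beta> = -1" "\<And>i. i < n \<Longrightarrow> sqrt D * f i = \<beta> * (s i / sqrt n)"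
proof -
  have form: "(\<Sum>i<n. \<Sum>j<n. B i j * x i * x j) = c * (\<Sum>i<n. x i)\<^sup>2 + \<delta> / n * (\<Sum>i<n. s i * x i)\<^sup>2 - a * (\<Sum>i<n. (x i)\<^sup>2)" for x
  proof -
    have "(\<Sum>i<n. \<Sum>j<n. B i j * x i * x j) = (\<Sum>i<n. \<Sum>j<n. c * (x i * x j) + \<delta> / n * ((s i * x i) * (s j * x j)) - (if j = i then a * (x i)\<^sup>2 else 0))"
      by (intro sum.cong refl) (auto simp: B power2_eq_square algebra_simps)
    also have "\<dots> = (\<Sum>i<n. \<Sum>j<n. c * (x i * x j)) + (\<Sum>i<n. \<Sum>j<n. \<delta> / n * ((s i * x i) * (s j * x j))) - (\<Sum>i<n. a * (x i)\<^sup>2)"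
      by (simp add: sum.distrib sum_subtractf)
    finally show ?thesis unfolding power2_eq_square sum_product unfolding sum_distrib_left .
  qed
  have ss: "(\<Sum>i<n. s i * s i) = n" "(\<Sum>i<n. (s i)\<^sup>2) = n" using s2 by (auto simp: power2_eq_square)
  have f2: "(\<Sum>i<n. (f i)\<^sup>2) = 1 / D" using f1 D by (simp add: sum_distrib_left[symmetric] field_simps)
  have fs: "(\<Sum>i<n. f i) = 0" using f0 D by (simp add: sum_distrib_left[symmetric])
  have "(\<Sum>i<n. \<Sum>j<n. B i j * s i * s j) \<le> l * (\<Sum>i<n. D * (s i)\<^sup>2)"
    using s0 by (intro var) (simp add: sum_distrib_left[symmetric])
  then have 1: "\<delta> * n - a * n \<le> l * (D * n)"
    unfolding form ss s0 sum_distrib_left[symmetric] using n by (simp add: power2_eq_square)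
  have "(\<Sum>i<n. \<Sum>j<n. B i j * f i * f j) = (\<Sum>i<n. f i * (\<Sum>j<n. B i j * f j))"
    by (simp add: sum_distrib_left mult_ac)
  also have "\<dots> = (\<Sum>i<n. l * (D * (f i)\<^sup>2))"
    by (intro sum.cong refl) (simp only: eig lessThan_iff, simp add: power2_eq_square mult_ac)
  also have "\<dots> = l" using f1 by (simp add: sum_distrib_left[symmetric])
  finally have 2: "\<delta> / n * (\<Sum>i<n. s i * f i)\<^sup>2 - a / D = l" unfolding form fs f2 by simp
  define b where "b = (\<Sum>i<n. s i * f i)"
  have "D * l = \<delta> / n * (D * b\<^sup>2) - a" using D by (simp add: 2[symmetric] b_def field_simps)
  moreover have "\<delta> - a \<le> l * D" using 1 n by (simp add: left_diff_distrib[symmetric] mult.assoc[symmetric])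
  ultimately have "\<delta> * 1 \<le> \<delta> * (D * b\<^sup>2 / n)" by (simp add: mult.commute)
  then have "1 \<le> D * b\<^sup>2 / n" using \<delta> by (simp only: mult_le_cancel_left_pos)
  then have b2: "n / D \<le> b\<^sup>2" using n D by (simp add: field_simps)
  have sq: "(\<Sum>i<n. (f i - b / n * s i)\<^sup>2) = 1 / D - b\<^sup>2 / n"
  proof -
    have "(\<Sum>i<n. (f i - b / n * s i)\<^sup>2) = (\<Sum>i<n. (f i)\<^sup>2 - 2 * (b / n) * (s i * f i) + (b / n)\<^sup>2 * (s i * s i))"
      by (intro sum.cong refl) (simp add: power2_eq_square algebra_simps)
    also have "\<dots> = 1 / D - 2 * (b / n) * b + (b / n)\<^sup>2 * n"
      by (simp only: sum.distrib sum_subtractf sum_distrib_left[symmetric] f2 ss b_def[symmetric])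
    also have "\<dots> = 1 / D - b\<^sup>2 / n" using n by (simp add: power2_eq_square field_simps)
    finally show ?thesis .
  qed
  have "1 / D - b\<^sup>2 / n \<le> 0" using b2 n D by (simp add: field_simps)
  then have sq0: "(\<Sum>i<n. (f i - b / n * s i)\<^sup>2) = 0" 
  proof -
    have "0 \<le> (\<Sum>i<n. (f i - b / n * s i)\<^sup>2)" by (intro sum_nonneg) auto
    then show ?thesis using sq \<open>1 / D - b\<^sup>2 / n \<le> 0\<close> by linarith
  qed
  then have fi: "f i = b / n * s i" if "i < n" for i
    using that by (subst (asm) sum_nonneg_eq_0_iff) auto
  have bn: "b\<^sup>2 = n / D" using sq sq0 n D by (simp add: field_simps)
  define \<beta> where "\<beta> = sqrt D * b / sqrt n"
  have "\<beta>\<^sup>2 = 1" unfolding \<beta>_def using bn n D by (simp add: power_mult_distrib power_divide)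
  then have "\<beta> = 1 \<or> \<beta> = -1" by (simp add: power2_eq_1_iff)
  moreover have "sqrt D * f i = \<beta> * (s i / sqrt n)" if "i < n" for i
    unfolding fi[OF that] \<beta>_def using n by (simp add: field_simps)
  ultimately show ?thesis using that by blast
qed

lemma adjacency_mat_index:
  assumes "i < n" "j < n"
  shows "adjacency_mat n G $$ (i,j) = adj G i j"
  using assms by (simp add: adjacency_mat_def adj_def)

lemma adj_sym: "adj G i j = adj G j i"
  by (simp add: adj_def min.commute max.commute)

lemma expected_sbm_index:
  assumes ij: "i < n" "j < n" and p: "\<And>i j. 0 \<le> sbm_edge_prob n S a b i j" "\<And>i j. sbm_edge_prob n S a b i j \<le> 1"
  shows "expected_mat n (sbm n S a b) $$ (i,j) = (if i = j then 0 else sbm_edge_prob n S a b i j)"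
proof -
  let ?p = "\<lambda>(i,j). sbm_edge_prob n S a b i j"
  let ?M = "Pi_pmf (pairs n) False (\<lambda>e. bernoulli_pmf (?p e))"
  have "expected_mat n (sbm n S a b) $$ (i,j) = measure_pmf.expectation ?M (\<lambda>G. adjacency_mat n G $$ (i,j))"
    using ij by (simp add: expected_mat_def sbm_def pairs_def case_prod_unfold)
  also have "\<dots> = measure_pmf.expectation ?M (\<lambda>G. adj G i j)" using ij by (simp add: adjacency_mat_index)
  also have "\<dots> = (if i = j then 0 else sbm_edge_prob n S a b i j)"
  proof (cases "i = j")
    case False
    let ?e = "(min i j, max i j)"
    have e: "?e \<in> pairs n" using ij False by (auto simp: pairs_def)
    have "measure_pmf.expectation ?M (\<lambda>G. adj G i j) = measure_pmf.expectation (map_pmf (\<lambda>G. G ?e) ?M) of_bool"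
      using False by (simp add: adj_def)
    also have "map_pmf (\<lambda>G. G ?e) ?M = bernoulli_pmf (?p ?e)"
      using e by (simp add: Pi_pmf_component)
    also have "measure_pmf.expectation (bernoulli_pmf (?p ?e)) of_bool = ?p ?e" using p by simp
    also have "?p ?e = sbm_edge_prob n S a b i j" by (auto simp: sbm_edge_prob_def min_def max_def)
    finally show ?thesis using False by simp
  qed (simp add: adj_def)
  finally show ?thesis .
qed

lemma euclidean_norm_L2_set: "dim_vec v = n \<Longrightarrow> euclidean_norm v = L2_set (\<lambda>i. v $ i) {..<n}"
  unfolding euclidean_norm_def L2_set_def scalar_prod_def by (simp add: power2_eq_square lessThan_atLeast0)

text \<open>A wrong or zero sign costs at least \<open>1 / n\<close> in squared distance, so the
  misclassified fraction is at most \<open>E\<^sup>2\<close>, which is below \<open>E\<close> as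
  \<open>E \<le> 1\<close>.\<close>

lemma misclassified_le:
  assumes n: "n > 0" and E: "E \<ge> 0" "E \<le> 1" and v: "L2_set (\<lambda>i. v $ i - s i / sqrt n) {..<n} \<le> E"
    and s: "\<And>i. i < n \<Longrightarrow> s i = (if i \<in> P then 1 else -1)"
  shows "real (card (misclassified n P v)) \<le> E * n"
proof -
  let ?M = "misclassified n P v"
  have sub: "?M \<subseteq> {..<n}" unfolding misclassified_def by auto
  have "real (card ?M) / n = (\<Sum>i\<in>?M. 1 / n)" by simp
  also have "\<dots> \<le> (\<Sum>i\<in>?M. (v $ i - s i / sqrt n)\<^sup>2)"
  proof (rule sum_mono)
    fix i assume i: "i \<in> ?M"
    then have lt: "i < n" using sub by auto
    have "1 / sqrt n \<le> \<bar>v $ i - s i / sqrt n\<bar>"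
      using i s[OF lt] unfolding misclassified_def by (auto split: if_splits)
    then have "(1 / sqrt n)\<^sup>2 \<le> \<bar>v $ i - s i / sqrt n\<bar>\<^sup>2" by (intro power_mono) auto
    then show "1 / n \<le> (v $ i - s i / sqrt n)\<^sup>2" by (simp add: power_divide)
  qed
  also have "\<dots> \<le> (\<Sum>i<n. (v $ i - s i / sqrt n)\<^sup>2)" using sub by (intro sum_mono2) auto
  also have "\<dots> = (L2_set (\<lambda>i. v $ i - s i / sqrt n) {..<n})\<^sup>2" unfolding L2_set_def by (simp add: sum_nonneg)
  also have "\<dots> \<le> E\<^sup>2" using v by (intro power_mono) auto
  also have "\<dots> \<le> E * 1" unfolding power2_eq_square using E by (intro mult_left_mono) auto
  finally show ?thesis using n by (simp add: field_simps)
qed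

text \<open>Settles the case \<epsilon> \<ge> 2, in which the assumption on \<open>a - b\<close>
  need not make the degrees large.\<close>

lemma euclidean_norm_add_le_2:
  assumes "dim_vec v = n" "dim_vec w = n" "euclidean_norm v = 1" "euclidean_norm w = 1"
  shows "euclidean_norm (v + 1 \<cdot>\<^sub>v w) \<le> 2"
proof -
  have "euclidean_norm (v + 1 \<cdot>\<^sub>v w) = L2_set (\<lambda>i. v $ i + w $ i) {..<n}"
    using assms by (subst euclidean_norm_L2_set[of _ n]) (auto intro!: L2_set_cong)
  also have "\<dots> \<le> L2_set (\<lambda>i. v $ i) {..<n} + L2_set (\<lambda>i. w $ i) {..<n}" by (rule L2_set_triangle_ineq)
  also have "\<dots> = 2" using assms euclidean_norm_L2_set[of v n] euclidean_norm_L2_set[of w n] by simp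
  finally show ?thesis .
qed

section \<open>Recovery of the communities\<close>

lemma regularize_index:
  "B \<in> carrier_mat n n \<Longrightarrow> i < n \<Longrightarrow> j < n \<Longrightarrow> regularize t B $$ (i,j) = B $$ (i,j) + t / n"
  by (simp add: regularize_def)

lemma regularize_carrier: "B \<in> carrier_mat n n \<Longrightarrow> regularize t B \<in> carrier_mat n n"
  by (auto simp: regularize_def)

lemma row_sum_regularize:
  assumes "B \<in> carrier_mat n n" "i < n"
  shows "row_sum (regularize t B) i = (\<Sum>j<n. B $$ (i,j)) + t"
proof -
  have "row_sum (regularize t B) i = (\<Sum>j<n. B $$ (i,j) + t / n)"
    using assms regularize_carrier[OF assms(1), of t] by (simp add: row_sum_def regularize_index)
  then show ?thesis using assms(2) by (simp add: sum.distrib)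
qed

lemma is_v2_laplacian_dim: "B \<in> carrier_mat n n \<Longrightarrow> is_v2 (laplacian B) v \<Longrightarrow> dim_vec v = n"
  unfolding is_v2_def eigenvector_def laplacian_def Let_def by (auto simp: mat_diag_def)

context
  fixes \<epsilon> r a b d \<delta> \<omega> :: real and n :: nat and S :: "nat set"
  assumes eps: "0 < \<epsilon>" "\<epsilon> < 2" and r: "r \<ge> 1" and n: "n > 0" and S: "S \<subseteq> {..<n}" "2 * card S = n"
    and ab: "0 \<le> b" "b < a" "a \<le> real n" and gap: "(a - b)\<^sup>2 > ((8 * 10 ^ 14) * r ^ 4 / \<epsilon>\<^sup>2) * (a + b)"
  defines "d \<equiv> (a + b) / 2" and "\<delta> \<equiv> (a - b) / 2" and "\<omega> \<equiv> 24000 * r / sqrt d"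
begin

lemma d_pos: "d > 0" and \<delta>_pos: "\<delta> > 0" and \<delta>_le_d: "\<delta> \<le> d" and d_le_n: "d \<le> n"
  using ab unfolding d_def \<delta>_def by auto

text \<open>
  The constant of the theorem is chosen so that \<open>sqrt (C / 2) = 2 * 10^7\<close> exceeds \<open>460 * 24000\<close>, the product of the constants
  in \<open>sign_vector_close\<close> and \<open>prob_centred_bilinear\<close>.
\<close>

lemma gap_sqrt: "20000000 * (r\<^sup>2 * sqrt d) < \<epsilon> * \<delta>"
proof (rule power2_less_imp_less)
  have "(8 * 10 ^ 14) * r ^ 4 * (a + b) < (a - b)\<^sup>2 * \<epsilon>\<^sup>2"
    using gap eps by (simp add: field_simps)
  moreover have "a + b = 2 * d" "a - b = 2 * \<delta>" unfolding d_def \<delta>_def by auto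
  ultimately have "(8 * 10 ^ 14) * r ^ 4 * (2 * d) < (2 * \<delta>)\<^sup>2 * \<epsilon>\<^sup>2" by simp
  then show "(20000000 * (r\<^sup>2 * sqrt d))\<^sup>2 < (\<epsilon> * \<delta>)\<^sup>2"
    using d_pos by (simp add: power_mult_distrib mult_ac flip: power_mult)
qed (use eps \<delta>_pos in simp)

lemma r_le_r2: "r \<le> r\<^sup>2" using r by (simp add: power2_eq_square)

text \<open>Since \<open>\<delta> \<le> d\<close> and \<epsilon> < 2, a large gap forces a large
  degree. This is the source of \<open>r \<le> d\<close>, and with \<open>d \<le> n\<close> of
  \<open>r \<le> n\<close>.\<close>

lemma sqrt_d_large: "10000000 * r < sqrt d"
proof -
  have "20000000 * (r * sqrt d) \<le> 20000000 * (r\<^sup>2 * sqrt d)" using r_le_r2 d_pos by simp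
  also have "\<dots> < 2 * d"
  proof -
    have "\<epsilon> * \<delta> \<le> 2 * d" using eps \<delta>_le_d \<delta>_pos by (intro mult_mono) auto
    then show ?thesis using gap_sqrt by linarith
  qed
  also have "2 * d = 2 * (sqrt d * sqrt d)" using d_pos by simp
  finally have "(10000000 * r) * sqrt d < sqrt d * sqrt d" by (simp only: mult_ac)
  then show ?thesis using d_pos by (simp only: mult_less_cancel_right_pos real_sqrt_gt_zero)
qed

lemma r_le_d: "r \<le> d"
proof -
  have s: "sqrt d > 1" "r \<le> sqrt d" using sqrt_d_large r by linarith+
  have "sqrt d * 1 \<le> sqrt d * sqrt d" using s by (intro mult_left_mono) auto
  then show ?thesis using s d_pos by simp
qed

lemma omega_d: "\<omega> * d = 24000 * (r * sqrt d)"
  unfolding \<omega>_def using d_pos real_div_sqrt[of d] by (simp add: field_simps)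

lemma omega_bounds: "\<omega> > 0" "1 \<le> \<omega> * d" "44 * \<omega> * d \<le> \<delta>" "460 * (\<omega> * d / \<delta>) \<le> \<epsilon>"
proof -
  show "\<omega> > 0" unfolding \<omega>_def using r d_pos by simp
  have "1 \<le> sqrt d" using sqrt_d_large r by linarith
  then have "1 * 1 \<le> r * sqrt d" using r by (intro mult_mono) auto
  then show "1 \<le> \<omega> * d" unfolding omega_d by simp
  have q: "r * sqrt d \<le> r\<^sup>2 * sqrt d" using r_le_r2 d_pos by (intro mult_right_mono) auto
  have p: "0 < r * sqrt d" using r d_pos by simp
  have "\<epsilon> * \<delta> \<le> 2 * \<delta>" using eps \<delta>_pos by (intro mult_right_mono) auto
  then show "44 * \<omega> * d \<le> \<delta>" using gap_sqrt q p omega_d by (simp add: mult.assoc)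
  have "460 * (\<omega> * d) \<le> \<epsilon> * \<delta>" using gap_sqrt q p omega_d by simp
  then show "460 * (\<omega> * d / \<delta>) \<le> \<epsilon>" using \<delta>_pos by (simp add: field_simps)
qed

lemma edge_prob_bounds:
  "0 \<le> sbm_edge_prob n S a b i j" "sbm_edge_prob n S a b i j \<le> 1" "sbm_edge_prob n S a b i j \<le> 2 * d / n"
  using ab n unfolding sbm_edge_prob_def d_def by (auto simp: field_simps)

lemma sbm_recovery:
  assumes bil: "\<And>x y. \<bar>\<Sum>i<n. \<Sum>j<n. centred (\<lambda>(i,j). sbm_edge_prob n S a b i j) G i j * x i * y j\<bar>
            \<le> 24000 * r / sqrt d * (sqrt (weight n d G x) * sqrt (weight n d G y))"
    and v: "is_v2 (laplacian (regularize (average_degree (adjacency_mat n G)) (adjacency_mat n G))) v"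
  shows "is_v2 (laplacian (regularize (average_degree (adjacency_mat n G)) (expected_mat n (sbm n S a b)))) w \<Longrightarrow>
       (MIN \<beta>\<in>{1, -1}. euclidean_norm (v + \<beta> \<cdot>\<^sub>v w)) \<le> \<epsilon>"
    and "\<exists>P\<in>{S, {..<n} - S}. real (card (misclassified n P v)) \<le> \<epsilon> * real n"
proof -
  let ?p = "\<lambda>(i,j). sbm_edge_prob n S a b i j"
  let ?A = "adjacency_mat n G" and ?E = "expected_mat n (sbm n S a b)"
  define s :: "nat \<Rightarrow> real" where "s = (\<lambda>i. if i \<in> S then 1 else -1)"
  define \<eta> where "\<eta> = 460 * (\<omega> * d / \<delta>)"
  have s2: "s i * s i = 1" for i unfolding s_def by simp
  have s0: "(\<Sum>i<n. s i) = 0"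
  proof -
    have fin: "finite S" using S(1) finite_subset by blast
    have "(\<Sum>i<n. s i) = (\<Sum>i<n. if i \<in> S then 2 else 0) - (\<Sum>i<n. 1)"
      unfolding s_def sum_subtractf[symmetric] by (intro sum.cong) auto
    also have "(\<Sum>i<n. if i \<in> S then 2 else 0) = (2::real) * card S"
      using S(1) by (simp add: sum.If_cases Int_absorb1)
    also have "2 * real (card S) = n" using S(2) by (metis of_nat_mult of_nat_numeral)
    finally show ?thesis by simp
  qed
  have n2: "n \<ge> 2" using S(2) n by (cases "card S") auto
  have prob: "sbm_edge_prob n S a b i j = d / n + \<delta> / n * (s i * s j)" for i j
    unfolding sbm_edge_prob_def d_def \<delta>_def s_def by (simp add: add_divide_distrib diff_divide_distrib)
  interpret P: perturbed_sbm n s "adj G" "centred ?p G" d \<delta> a \<omega>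
  proof
    show "adj G i j = centred ?p G i j + (d / n + \<delta> / n * (s i * s j)) - (if i = j then a / n else 0)" for i j
    proof (cases "i = j")
      case True
      have "d + \<delta> = a" unfolding d_def \<delta>_def by (simp add: field_simps)
      then have "d / n + \<delta> / n = a / n" by (simp add: add_divide_distrib[symmetric])
      then show ?thesis unfolding True by (simp add: adj_def centred_def s2)
    next
      case False
      have "sbm_edge_prob n S a b (min i j) (max i j) = d / n + \<delta> / n * (s i * s j)"
        unfolding prob by (simp add: min_def max_def mult.commute)
      then show ?thesis using False by (simp add: adj_def centred_def)
    qed
    show "\<bar>\<Sum>i<n. \<Sum>j<n. centred ?p G i j * x i * y j\<bar> \<le> \<omega> *
       (sqrt (\<Sum>i<n. ((\<Sum>j<n. adj G i j) + d) * (x i)\<^sup>2) * sqrt (\<Sum>i<n. ((\<Sum>j<n. adj G i j) + d) * (y i)\<^sup>2))" for x y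
      using bil[of x y] unfolding weight_def vertex_degree_def \<omega>_def .
    show "adj G i j = adj G j i" for i j by (rule adj_sym)
  qed (use n s2 s0 ab \<delta>_le_d omega_bounds d_pos in \<open>auto simp: adj_def\<close>)
  define t where "t = average_degree ?A"
  have Ac: "?A \<in> carrier_mat n n" by (simp add: adjacency_mat_def)
  have Ec: "?E \<in> carrier_mat n n" by (simp add: expected_mat_def)
  have rowA: "(\<Sum>j<n. ?A $$ (i,j)) = (\<Sum>j<n. adj G i j)" if "i < n" for i
    using that by (simp add: adjacency_mat_index)
  have t: "t = P.\<tau>"
    unfolding t_def average_degree_def P.\<tau>_def row_sum_def using Ac by (simp add: rowA)
  \<comment> \<open>A positive \<tau> makes every entry of the regularised matrices positive, as
    \<open>is_v2_laplacianE\<close> demands.\<close>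
  have tpos: "t > 0" using P.tau_bounds(1) d_pos unfolding t by linarith
  obtain f l where f: "dim_vec v = n" "\<And>i. i < n \<Longrightarrow> v $ i = sqrt (P.D i) * f i"
    "(\<Sum>i<n. P.D i * f i) = 0" "(\<Sum>i<n. P.D i * (f i)\<^sup>2) = 1"
    "\<And>i. i < n \<Longrightarrow> (\<Sum>j<n. regularize t ?A $$ (i,j) * f j) = l * (P.D i * f i)"
    "\<And>g. (\<Sum>i<n. P.D i * g i) = 0 \<Longrightarrow>
       (\<Sum>i<n. \<Sum>j<n. regularize t ?A $$ (i,j) * g i * g j) \<le> l * (\<Sum>i<n. P.D i * (g i)\<^sup>2)"
  proof (rule is_v2_laplacianE[OF regularize_carrier[OF Ac] n2 _ _ _ v[folded t_def]])
    show "regularize t ?A $$ (i,j) = regularize t ?A $$ (j,i)" if "i < n" "j < n" for i j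
      using that by (simp add: regularize_index[OF Ac] adjacency_mat_index adj_sym)
    show "regularize t ?A $$ (i,j) > 0" if "i < n" "j < n" for i j
      using that tpos n by (simp add: regularize_index[OF Ac] adjacency_mat_index adj_def add_nonneg_pos)
    show "P.D i = row_sum (regularize t ?A) i" if "i < n" for i
      using that by (simp add: row_sum_regularize[OF Ac] rowA P.D_def t)
  qed blast
  obtain \<beta> :: real where \<beta>: "\<beta> = 1 \<or> \<beta> = -1"
    and close: "L2_set (\<lambda>i. sqrt (P.D i) * f i - \<beta> * (s i / sqrt n)) {..<n} \<le> 460 * (\<omega> * d / \<delta>)"
  proof (rule P.sign_vector_close[OF f(3,4)])
    show "(\<Sum>j<n. (adj G i j + P.\<tau> / n) * f j) = l * (P.D i * f i)" if "i < n" for i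
      using f(5)[OF that] that by (simp add: regularize_index[OF Ac] adjacency_mat_index t)
    show "(\<Sum>i<n. \<Sum>j<n. (adj G i j + P.\<tau> / n) * g i * g j) \<le> l * (\<Sum>i<n. P.D i * (g i)\<^sup>2)"
      if "(\<Sum>i<n. P.D i * g i) = 0" for g
      using f(6)[OF that] by (simp add: regularize_index[OF Ac] adjacency_mat_index t)
  qed blast
  have vclose: "L2_set (\<lambda>i. v $ i - \<beta> * s i / sqrt n) {..<n} \<le> \<eta>"
  proof -
    have "L2_set (\<lambda>i. v $ i - \<beta> * s i / sqrt n) {..<n} = L2_set (\<lambda>i. sqrt (P.D i) * f i - \<beta> * (s i / sqrt n)) {..<n}"
      by (intro L2_set_cong refl) (simp add: f(2))
    then show ?thesis using close unfolding \<eta>_def by simp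
  qed
  have \<eta>: "\<eta> \<le> \<epsilon>" unfolding \<eta>_def by (rule omega_bounds)
  show "(MIN \<beta>\<in>{1, -1}. euclidean_norm (v + \<beta> \<cdot>\<^sub>v w)) \<le> \<epsilon>"
    if w: "is_v2 (laplacian (regularize (average_degree ?A) ?E)) w"
  proof -
    \<comment> \<open>All rows of the expected matrix have the same sum because the communities are
      balanced; here \<open>\<tau>\<close> is still the random average degree.\<close>
    define D0 where "D0 = d - a / n + t"
    have Eij: "?E $$ (i,j) = d / n + \<delta> / n * (s i * s j) - (if i = j then a / n else 0)" if "i < n" "j < n" for i j
    proof -
      have "d + \<delta> = a" unfolding d_def \<delta>_def by (simp add: field_simps)
      then have "d / n + \<delta> / n = a / n" by (simp add: add_divide_distrib[symmetric])
      then show ?thesis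
        unfolding expected_sbm_index[OF that edge_prob_bounds(1,2)] prob by (simp add: s2)
    qed
    have rowE: "(\<Sum>j<n. ?E $$ (i,j)) = d - a / n" if "i < n" for i
    proof -
      have "(\<Sum>j<n. ?E $$ (i,j)) = (\<Sum>j<n. d / n + \<delta> / n * s i * s j - (if j = i then a / n else 0))"
        by (intro sum.cong refl) (auto simp: Eij that)
      also have "\<dots> = (\<Sum>j<n. d / n) + \<delta> / n * s i * (\<Sum>j<n. s j) - a / n"
        using that by (simp add: sum.distrib sum_subtractf sum_distrib_left)
      finally show ?thesis unfolding s0 using n by simp
    qed
    have D0: "D0 > 0"
    proof -
      have "a / n \<le> 1" using ab n by simp
      then show ?thesis unfolding D0_def using tpos P.d_large by linarith
    qed
    obtain f' l' where f': "dim_vec w = n" "\<And>i. i < n \<Longrightarrow> w $ i = sqrt D0 * f' i"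
      "(\<Sum>i<n. D0 * f' i) = 0" "(\<Sum>i<n. D0 * (f' i)\<^sup>2) = 1"
      "\<And>i. i < n \<Longrightarrow> (\<Sum>j<n. regularize t ?E $$ (i,j) * f' j) = l' * (D0 * f' i)"
      "\<And>g. (\<Sum>i<n. D0 * g i) = 0 \<Longrightarrow>
         (\<Sum>i<n. \<Sum>j<n. regularize t ?E $$ (i,j) * g i * g j) \<le> l' * (\<Sum>i<n. D0 * (g i)\<^sup>2)"
    proof (rule is_v2_laplacianE[OF regularize_carrier[OF Ec] n2 _ _ _ w[folded t_def]])
      show "regularize t ?E $$ (i,j) = regularize t ?E $$ (j,i)" if "i < n" "j < n" for i j
        using that by (simp add: regularize_index[OF Ec] Eij mult.commute)
      show "regularize t ?E $$ (i,j) > 0" if "i < n" "j < n" for i j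
      proof -
        have "?E $$ (i,j) \<ge> 0" unfolding expected_sbm_index[OF that edge_prob_bounds(1,2)] using edge_prob_bounds(1) by simp
        then show ?thesis using that tpos n by (simp add: regularize_index[OF Ec] add_nonneg_pos)
      qed
      show "D0 = row_sum (regularize t ?E) i" if "i < n" for i
        using that by (simp add: row_sum_regularize[OF Ec] rowE D0_def)
    qed blast
    obtain \<beta>' :: real where \<beta>': "\<beta>' = 1 \<or> \<beta>' = -1" and w': "\<And>i. i < n \<Longrightarrow> sqrt D0 * f' i = \<beta>' * (s i / sqrt n)"
    proof (rule expected_sign_vector[OF n s2 s0 \<delta>_pos D0 _ f'(3-6)])
      show "regularize t ?E $$ (i,j) = (d + t) / n + \<delta> / n * (s i * s j) - (if i = j then a / n else 0)" if "i < n" "j < n" for i j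
        using that by (simp add: regularize_index[OF Ec] Eij add_divide_distrib)
    qed blast+
    \<comment> \<open>The two orientations combine into one sign: \<open>\<beta>'\<close> undoes the
      orientation of \<open>w\<close>, and \<open>- \<beta>\<close> turns the sum into the distance
      already bounded.\<close>
    have "euclidean_norm (v + (- \<beta> * \<beta>') \<cdot>\<^sub>v w) = L2_set (\<lambda>i. v $ i - \<beta> * s i / sqrt n) {..<n}"
    proof -
      have "(v + (- \<beta> * \<beta>') \<cdot>\<^sub>v w) $ i = v $ i - \<beta> * s i / sqrt n" if "i < n" for i
      proof -
        have "w $ i = \<beta>' * (s i / sqrt n)" using f'(2) w' that by simp
        then show ?thesis using \<beta>' f(1) f'(1) that by auto
      qed
      then show ?thesis using f'(1) by (subst euclidean_norm_L2_set[of _ n]) (auto intro!: L2_set_cong)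
    qed
    then have "euclidean_norm (v + (- \<beta> * \<beta>') \<cdot>\<^sub>v w) \<le> \<epsilon>" using vclose \<eta> by simp
    moreover have "- \<beta> * \<beta>' \<in> {1,-1}" using \<beta> \<beta>' by auto
    ultimately show ?thesis by (subst Min_le_iff) auto
  qed
  show "\<exists>P\<in>{S, {..<n} - S}. real (card (misclassified n P v)) \<le> \<epsilon> * real n"
  proof (cases "\<epsilon> \<ge> 1")
    case True
    have "card (misclassified n S v) \<le> card {..<n}"
      unfolding misclassified_def by (intro card_mono) auto
    also have "real (card {..<n}) \<le> \<epsilon> * n" using True n by simp
    finally show ?thesis by auto
  next
    case False
    \<comment> \<open>If \<open>v\<close> is close to the negative of the sign vector, its positive
      entries mark the other community.\<close>
    define P where "P = (if \<beta> = 1 then S else {..<n} - S)"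
    have "real (card (misclassified n P v)) \<le> \<eta> * n"
    proof (rule misclassified_le[OF n])
      show "\<eta> \<ge> 0" unfolding \<eta>_def using omega_bounds(1) d_pos \<delta>_pos by simp
      show "\<eta> \<le> 1" using \<eta> False by simp
      show "L2_set (\<lambda>i. v $ i - \<beta> * s i / sqrt n) {..<n} \<le> \<eta>" by (rule vclose)
      show "\<beta> * s i = (if i \<in> P then 1 else -1)" if "i < n" for i
        using \<beta> that unfolding P_def s_def by auto
    qed
    also have "\<dots> \<le> \<epsilon> * n" using \<eta> n by simp
    finally show ?thesis unfolding P_def by (auto split: if_splits)
  qed
qed

end

theorem corollary1p4:
  shows "\<exists>C::real. C > 0 \<and>
    (\<forall>(\<epsilon>::real) (r::real) (n::nat) (S::nat set) (a::real) (b::real).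
       \<epsilon> > 0 \<longrightarrow> r \<ge> 1 \<longrightarrow>
       n > 0 \<longrightarrow> S \<subseteq> {..<n} \<longrightarrow> 2 * card S = n \<longrightarrow>
       0 \<le> b \<longrightarrow> b < a \<longrightarrow> a \<le> real n \<longrightarrow>
       (a - b)\<^sup>2 > (C * r ^ 4 / \<epsilon>\<^sup>2) * (a + b) \<longrightarrow>
       measure_pmf.prob (sbm n S a b)
         {A. let \<tau> = average_degree A;
                 L = laplacian (regularize \<tau> A);
                 L' = laplacian (regularize \<tau> (expected_mat n (sbm n S a b)))
             in \<forall>v. is_v2 L v \<longrightarrow>
                  (\<forall>w. is_v2 L' w \<longrightarrow>
                     (MIN \<beta>\<in>{1, -1}. euclidean_norm (v + \<beta> \<cdot>\<^sub>v w)) \<le> \<epsilon>) \<and>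
                  (\<exists>P\<in>{S, {..<n} - S}. real (card (misclassified n P v)) \<le> \<epsilon> * real n)}
       \<ge> 1 - exp (- r))"
proof (intro exI[of _ "8 * 10 ^ 14"] conjI allI impI)
  fix \<epsilon> r :: real and n :: nat and S :: "nat set" and a b :: real
  assume eps: "\<epsilon> > 0" and r: "r \<ge> 1" and n: "n > 0" and S: "S \<subseteq> {..<n}" "2 * card S = n"
    and ab: "0 \<le> b" "b < a" "a \<le> real n" and gap: "(a - b)\<^sup>2 > ((8 * 10 ^ 14) * r ^ 4 / \<epsilon>\<^sup>2) * (a + b)"
  let ?good = "\<lambda>A. let \<tau> = average_degree A;
                 L = laplacian (regularize \<tau> A);
                 L' = laplacian (regularize \<tau> (expected_mat n (sbm n S a b)))
             in \<forall>v. is_v2 L v \<longrightarrow>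
                  (\<forall>w. is_v2 L' w \<longrightarrow>
                     (MIN \<beta>\<in>{1, -1}. euclidean_norm (v + \<beta> \<cdot>\<^sub>v w)) \<le> \<epsilon>) \<and>
                  (\<exists>P\<in>{S, {..<n} - S}. real (card (misclassified n P v)) \<le> \<epsilon> * real n)"
  let ?p = "\<lambda>(i,j). sbm_edge_prob n S a b i j"
  let ?M = "Pi_pmf (pairs n) False (\<lambda>e. bernoulli_pmf (?p e))"
  have sbm: "measure_pmf.prob (sbm n S a b) {A. ?good A} = measure_pmf.prob ?M {G. ?good (adjacency_mat n G)}"
    unfolding sbm_def measure_map_pmf vimage_def mem_Collect_eq by (simp add: pairs_def case_prod_unfold)
  show "measure_pmf.prob (sbm n S a b) {A. ?good A} \<ge> 1 - exp (- r)"
  proof (cases "\<epsilon> < 2")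
    case True
    note ctx = eps True r n S ab gap
    define d where "d = (a + b) / 2"
    have d: "d > 0" "r \<le> d" "r \<le> n"
      using d_pos[OF ctx] r_le_d[OF ctx] d_le_n[OF ctx] unfolding d_def by auto
    have p: "0 \<le> ?p e \<and> ?p e \<le> 1 \<and> ?p e \<le> 2 * d / n" for e
      using edge_prob_bounds[OF ctx] unfolding d_def by (cases e) auto
    have "1 - exp (- r) \<le> measure_pmf.prob ?M
     {G. \<forall>x y. \<bar>\<Sum>i<n. \<Sum>j<n. centred ?p G i j * x i * y j\<bar>
            \<le> 24000 * r / sqrt d * (sqrt (weight n d G x) * sqrt (weight n d G y))}"
      by (rule prob_centred_bilinear[OF n d(1) r d(2,3) p])
    also have "\<dots> \<le> measure_pmf.prob ?M {G. ?good (adjacency_mat n G)}"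
    proof (intro measure_pmf.finite_measure_mono subsetI CollectI)
      fix G assume "G \<in> {G. \<forall>x y. \<bar>\<Sum>i<n. \<Sum>j<n. centred ?p G i j * x i * y j\<bar>
            \<le> 24000 * r / sqrt d * (sqrt (weight n d G x) * sqrt (weight n d G y))}"
      then have bil: "\<And>x y. \<bar>\<Sum>i<n. \<Sum>j<n. centred ?p G i j * x i * y j\<bar>
            \<le> 24000 * r / sqrt ((a + b) / 2) * (sqrt (weight n ((a + b) / 2) G x) * sqrt (weight n ((a + b) / 2) G y))"
        unfolding d_def by blast
      show "?good (adjacency_mat n G)"
        unfolding Let_def using sbm_recovery[OF ctx bil] by blast
    qed simp
    finally show ?thesis unfolding sbm .
  next
    case False
    have Ec: "expected_mat n (sbm n S a b) \<in> carrier_mat n n" by (simp add: expected_mat_def)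
    have "?good (adjacency_mat n G)" for G
    proof -
      have Ac: "adjacency_mat n G \<in> carrier_mat n n" by (simp add: adjacency_mat_def)
      have mis: "real (card (misclassified n S v)) \<le> \<epsilon> * real n" for v
      proof -
        have "card (misclassified n S v) \<le> card {..<n}"
          unfolding misclassified_def by (intro card_mono) auto
        also have "real (card {..<n}) \<le> \<epsilon> * n" using False n by simp
        finally show ?thesis by simp
      qed
      have "(MIN \<beta>\<in>{1, -1}. euclidean_norm (v + \<beta> \<cdot>\<^sub>v w)) \<le> \<epsilon>"
        if v: "is_v2 (laplacian (regularize t (adjacency_mat n G))) v"
          and w: "is_v2 (laplacian (regularize t (expected_mat n (sbm n S a b)))) w" for t v w
      proof -
        have "euclidean_norm (v + 1 \<cdot>\<^sub>v w) \<le> 2"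
          using v w is_v2_laplacian_dim[OF regularize_carrier[OF Ac] v] is_v2_laplacian_dim[OF regularize_carrier[OF Ec] w]
          by (intro euclidean_norm_add_le_2) (auto simp: is_v2_def)
        then show ?thesis using False by (subst Min_le_iff) auto
      qed
      then show ?thesis unfolding Let_def using mis by blast
    qed
    then have "{G. ?good (adjacency_mat n G)} = UNIV" by blast
    then show ?thesis unfolding sbm by simp
  qed
qed simp

end
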